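(* Let $\mathbf{Z}=(Z_n)_{n\ge 0}$ be the balanced excited random walk in $2=1+1$ dimensions. For every $T>0$, as $n\to\infty$, the process $(n^{-1/2}Z_{\lfloor nt\rfloor})_{t\in[0,T]}$ converges weakly to $((B_t,0_t))_{t\in[0,T]}$ (as random elements of the Skorokhod space of càdlàg functions from $[0,T]$ to $\mathbb{R}^2$), where $(B_t)_{t\ge0}$ is a standard one-dimensional Brownian motion and $0_t=0$ for all $t$.
   Context: The balanced excited random walk (BERW) in $2=1+1$ dimensions is the following nearest-neighbour walk $\mathbf{Z}=(Z_n)_{n\ge0}$ on $\mathbb{Z}^2$ started at $Z_0=(0,0)$. On the first departure from each site, the walk makes a vertical step ($\pm(0,1)$); on all subsequent departures from that site, it makes a horizontal step ($\pm(1,0)$). In each case the step is to one of the two corresponding neighbours with probability $1/2$ each, independently of all previous randomness. The first coordinate is the horizontal one. *)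

theory Defs
  imports "HOL-Probability.Probability"
begin

section \<open>Balanced excited random walk\<close>

text \<open>
  The law of the next step, given that the positions at times \<open>0, \<dots>, n\<close> are \<open>z 0, \<dots>, z n\<close>.
  Every visit to \<open>z n\<close> before time \<open>n\<close> was followed by a departure, so the departure at time
  \<open>n\<close> is the first one from its site iff \<open>z n\<close> is not among \<open>z 0, \<dots>, z (n - 1)\<close>.
\<close>

definition berw_steps :: "(nat \<Rightarrow> int \<times> int) \<Rightarrow> nat \<Rightarrow> (int \<times> int) set" where
  "berw_steps z n = (if z n \<notin> z ` {..<n} then {(0, 1), (0, -1)} else {(1, 0), (-1, 0)})"

definition berw_kernel :: "(nat \<Rightarrow> int \<times> int) \<Rightarrow> nat \<Rightarrow> (int \<times> int) pmf" where
  "berw_kernel z n = map_pmf (\<lambda>s. z n + s) (pmf_of_set (berw_steps z n))"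

definition balanced_excited_random_walk :: "'a measure \<Rightarrow> (nat \<Rightarrow> 'a \<Rightarrow> int \<times> int) \<Rightarrow> bool" where
  "balanced_excited_random_walk M Z \<longleftrightarrow>
     prob_space M \<and>
     (\<forall>n. Z n \<in> M \<rightarrow>\<^sub>M count_space UNIV) \<and>
     (AE \<omega> in M. Z 0 \<omega> = (0, 0)) \<and>
     (\<forall>n z y. \<P>(\<omega> in M. \<forall>k\<le>n. Z k \<omega> = z k) > 0 \<longrightarrow>
        \<P>(\<omega> in M. Z (Suc n) \<omega> = y \<bar> \<forall>k\<le>n. Z k \<omega> = z k) = pmf (berw_kernel z n) y)"


section \<open>Brownian motion\<close>

definition standard_brownian_motion :: "'a measure \<Rightarrow> (real \<Rightarrow> 'a \<Rightarrow> real) \<Rightarrow> bool" where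
  "standard_brownian_motion M B \<longleftrightarrow>
     prob_space M \<and>
     (\<forall>t\<ge>0. B t \<in> borel_measurable M) \<and>
     (AE \<omega> in M. B 0 \<omega> = 0) \<and>
     (\<forall>s t. 0 \<le> s \<and> s < t \<longrightarrow>
        distributed M lborel (\<lambda>\<omega>. B t \<omega> - B s \<omega>) (normal_density 0 (sqrt (t - s)))) \<and>
     (\<forall>(k::nat) t. 0 \<le> t 0 \<and> (\<forall>i<k. t i \<le> t (Suc i)) \<longrightarrow>
        prob_space.indep_vars M (\<lambda>_. borel) (\<lambda>i \<omega>. B (t (Suc i)) \<omega> - B (t i) \<omega>) {..<k}) \<and>
     (\<forall>\<omega>\<in>space M. continuous_on {0..} (\<lambda>t. B t \<omega>))"


section \<open>Skorokhod space\<close>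

text \<open>
  Functions on \<open>[0, T]\<close> are represented as functions on the reals that take the value
  \<open>undefined\<close> outside \<open>[0, T]\<close>.
\<close>

definition cadlag :: "real \<Rightarrow> (real \<Rightarrow> 'b::metric_space) set" where
  "cadlag T = {f \<in> extensional {0..T}.
     (\<forall>t\<in>{0..<T}. (f \<longlongrightarrow> f t) (at_right t)) \<and> (\<forall>t\<in>{0<..T}. \<exists>l. (f \<longlongrightarrow> l) (at_left t))}"

definition time_changes :: "real \<Rightarrow> (real \<Rightarrow> real) set" where
  "time_changes T = {l. strict_mono_on {0..T} l \<and> continuous_on {0..T} l \<and> l ` {0..T} = {0..T}}"

text \<open>
  Skorokhod's \<open>J1\<close> metric in the form given by Billingsley.  The value outside the space of
  cadlag functions is irrelevant; it is set to 0 because the locale \<^locale>\<open>Metric_space\<close> demands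
  nonnegativity and symmetry for all arguments.
\<close>

definition skorokhod_bounds ::
    "real \<Rightarrow> (real \<Rightarrow> 'b::metric_space) \<Rightarrow> (real \<Rightarrow> 'b) \<Rightarrow> real set" where
  "skorokhod_bounds T f g = {e. e > 0 \<and>
     (\<exists>l\<in>time_changes T. \<forall>t\<in>{0..T}. \<bar>l t - t\<bar> \<le> e \<and> dist (f t) (g (l t)) \<le> e)}"

definition skorokhod_dist ::
    "real \<Rightarrow> (real \<Rightarrow> 'b::metric_space) \<Rightarrow> (real \<Rightarrow> 'b) \<Rightarrow> real" where
  "skorokhod_dist T f g =
     (if f \<in> cadlag T \<and> g \<in> cadlag T then Inf (skorokhod_bounds T f g) else 0)"

definition skorokhod_topology :: "real \<Rightarrow> (real \<Rightarrow> 'b::metric_space) topology" where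
  "skorokhod_topology T = Metric_space.mtopology (cadlag T) (skorokhod_dist T)"

lemma cadlag_locally_bounded:
  fixes f :: "real \<Rightarrow> 'b::metric_space"
  assumes f: "f \<in> cadlag T" and t: "t \<in> {0..T}"
  shows "\<exists>U. open U \<and> t \<in> U \<and> bounded (f ` (U \<inter> {0..T}))"
proof -
  have R: "\<exists>b>t. bounded (f ` ({t<..<b} \<inter> {0..T}))"
  proof (cases "t < T")
    case True
    then have "(f \<longlongrightarrow> f t) (at_right t)" using f t by (auto simp: cadlag_def)
    then have "eventually (\<lambda>s. dist (f s) (f t) < 1) (at_right t)"
      by (rule tendstoD) simp
    then obtain b where "b > t" "\<And>s. t < s \<Longrightarrow> s < b \<Longrightarrow> dist (f s) (f t) < 1"
      by (auto simp: eventually_at_right_field)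
    then have "f ` ({t<..<b} \<inter> {0..T}) \<subseteq> cball (f t) 1"
      by (force simp: dist_commute)
    then show ?thesis using \<open>b > t\<close> bounded_cball bounded_subset by blast
  next
    case False
    then have "{t<..<t+1} \<inter> {0..T} = {}" using t by auto
    then show ?thesis by (intro exI[of _ "t+1"]) auto
  qed
  have L: "\<exists>a<t. bounded (f ` ({a<..<t} \<inter> {0..T}))"
  proof (cases "0 < t")
    case True
    then have "t \<in> {0<..T}" using t by simp
    then obtain l where "(f \<longlongrightarrow> l) (at_left t)" using f unfolding cadlag_def by blast
    then have "eventually (\<lambda>s. dist (f s) l < 1) (at_left t)"
      by (rule tendstoD) simp
    then obtain b where "b < t" "\<And>s. b < s \<Longrightarrow> s < t \<Longrightarrow> dist (f s) l < 1"
      by (auto simp: eventually_at_left_field)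
    then have "f ` ({b<..<t} \<inter> {0..T}) \<subseteq> cball l 1"
      by (force simp: dist_commute)
    then show ?thesis using \<open>b < t\<close> bounded_cball bounded_subset by blast
  next
    case False
    then have "{t-1<..<t} \<inter> {0..T} = {}" using t by auto
    then show ?thesis by (intro exI[of _ "t-1"]) auto
  qed
  obtain a b where ab: "b > t" "bounded (f ` ({t<..<b} \<inter> {0..T}))"
    "a < t" "bounded (f ` ({a<..<t} \<inter> {0..T}))" using R L by blast
  have "bounded (f ` ({t<..<b} \<inter> {0..T}) \<union> f ` ({a<..<t} \<inter> {0..T}) \<union> {f t})"
    using ab by simp
  moreover have "{a<..<b} \<inter> {0..T} \<subseteq>
      ({t<..<b} \<inter> {0..T}) \<union> ({a<..<t} \<inter> {0..T}) \<union> {t}"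
    by auto
  then have "f ` ({a<..<b} \<inter> {0..T}) \<subseteq>
      f ` ({t<..<b} \<inter> {0..T}) \<union> f ` ({a<..<t} \<inter> {0..T}) \<union> {f t}"
    by blast
  ultimately have "bounded (f ` ({a<..<b} \<inter> {0..T}))" by (rule bounded_subset)
  then show ?thesis using ab by (intro exI[of _ "{a<..<b}"]) auto
qed

lemma cadlag_bounded:
  fixes f :: "real \<Rightarrow> 'b::metric_space"
  assumes f: "f \<in> cadlag T"
  shows "bounded (f ` {0..T})"
proof -
  obtain U where U: "\<And>t. t \<in> {0..T} \<Longrightarrow> open (U t) \<and> t \<in> U t \<and> bounded (f ` (U t \<inter> {0..T}))"
    using cadlag_locally_bounded[OF f] by metis
  have "compact {0..T}" by simp
  then obtain D where D: "D \<subseteq> {0..T}" "finite D" "{0..T} \<subseteq> (\<Union>t\<in>D. U t)"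
    by (rule compactE_image[of _ "{0..T}" U]) (use U in auto)
  have "bounded (\<Union>t\<in>D. f ` (U t \<inter> {0..T}))"
    using D U by (intro bounded_UN) auto
  moreover have "f ` {0..T} \<subseteq> (\<Union>t\<in>D. f ` (U t \<inter> {0..T}))" using D by blast
  ultimately show ?thesis by (rule bounded_subset)
qed

lemma id_time_changes: "(\<lambda>t. t) \<in> time_changes T"
  by (auto simp: time_changes_def strict_mono_on_def)

lemma time_changesD:
  assumes "l \<in> time_changes T"
  shows "continuous_on {0..T} l" "l ` {0..T} = {0..T}"
    "t \<in> {0..T} \<Longrightarrow> l t \<in> {0..T}"
    "s \<in> {0..T} \<Longrightarrow> t \<in> {0..T} \<Longrightarrow> s < t \<Longrightarrow> l s < l t"
proof -
  show "continuous_on {0..T} l" and im: "l ` {0..T} = {0..T}"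
    using assms by (simp_all add: time_changes_def)
  show "l t \<in> {0..T}" if "t \<in> {0..T}" using imageI[OF that, of l] unfolding im .
  show "l s < l t" if "s \<in> {0..T}" "t \<in> {0..T}" "s < t"
    using assms that by (simp add: time_changes_def strict_mono_on_def)
qed

lemma time_changes_comp:
  assumes k: "k \<in> time_changes T" and l: "l \<in> time_changes T"
  shows "(\<lambda>t. k (l t)) \<in> time_changes T"
proof -
  have "continuous_on {0..T} (\<lambda>t. k (l t))"
    by (rule continuous_on_compose2[OF time_changesD(1)[OF k] time_changesD(1)[OF l]])
       (simp only: time_changesD(2)[OF l] order_refl)
  moreover have "strict_mono_on {0..T} (\<lambda>t. k (l t))"
    by (intro strict_mono_onI time_changesD(4)[OF k] time_changesD(3,4)[OF l])
  moreover have "(\<lambda>t. k (l t)) ` {0..T} = {0..T}"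
    using image_image[of k l "{0..T}"] by (simp only: time_changesD(2)[OF l] time_changesD(2)[OF k])
  ultimately show ?thesis by (simp add: time_changes_def)
qed

lemma time_changes_inv:
  assumes l: "l \<in> time_changes T"
  obtains k where "k \<in> time_changes T"
    "\<And>t. t \<in> {0..T} \<Longrightarrow> k t \<in> {0..T}" "\<And>t. t \<in> {0..T} \<Longrightarrow> l (k t) = t"
proof -
  have sm: "strict_mono_on {0..T} l" and im: "l ` {0..T} = {0..T}" and co: "continuous_on {0..T} l"
    using l by (auto simp: time_changes_def)
  have inj: "inj_on l {0..T}" using sm by (rule strict_mono_on_imp_inj_on)
  define k where "k = inv_into {0..T} l"
  have k1: "k t \<in> {0..T}" "l (k t) = t" if "t \<in> {0..T}" for t
    unfolding k_def
    by (rule inv_into_into, simp only: im that, rule f_inv_into_f, simp only: im that)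
  have k2: "k (l t) = t" if "t \<in> {0..T}" for t
    using that inj by (simp add: k_def)
  have "continuous_on {0..T} k"
    using continuous_on_inv[OF co compact_Icc, of k] k2 unfolding im by blast
  moreover have "k ` {0..T} = {0..T}"
    using inv_into_image_cancel[OF inj order_refl] unfolding k_def im .
  moreover have "strict_mono_on {0..T} k"
  proof (rule strict_mono_onI)
    fix r s assume rs: "r \<in> {0..T}" "s \<in> {0..T}" "r < s"
    show "k r < k s"
    proof (rule ccontr)
      assume "\<not> k r < k s"
      then have "k s \<le> k r" by simp
      then have "l (k s) \<le> l (k r)"
        by (rule strict_mono_on_leD[OF sm k1(1)[OF rs(2)] k1(1)[OF rs(1)]])
      then show False using k1(2)[OF rs(1)] k1(2)[OF rs(2)] rs by simp
    qed
  qed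
  ultimately have "k \<in> time_changes T" by (simp add: time_changes_def)
  then show ?thesis using k1 by (rule that)
qed

lemma skorokhod_bounds_nonempty:
  fixes f g :: "real \<Rightarrow> 'b::metric_space"
  assumes "f \<in> cadlag T" "g \<in> cadlag T"
  shows "skorokhod_bounds T f g \<noteq> {}"
proof -
  have "bounded (f ` {0..T} \<union> g ` {0..T})" using assms cadlag_bounded by auto
  then obtain c e where e: "\<And>y. y \<in> f ` {0..T} \<union> g ` {0..T} \<Longrightarrow> dist c y \<le> e"
    unfolding bounded_def by metis
  have "dist (f t) (g t) \<le> 2 * \<bar>e\<bar> + 1" if "t \<in> {0..T}" for t
  proof -
    have "dist c (f t) \<le> e" "dist c (g t) \<le> e" using e that by auto
    moreover have "dist (f t) (g t) \<le> dist c (f t) + dist c (g t)" by (rule dist_triangle3)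
    ultimately show ?thesis by linarith
  qed
  then have "2 * \<bar>e\<bar> + 1 \<in> skorokhod_bounds T f g"
    unfolding skorokhod_bounds_def using id_time_changes
    by (auto intro!: bexI[of _ "\<lambda>t. t"])
  then show ?thesis by blast
qed

lemma skorokhod_bounds_bdd_below: "bdd_below (skorokhod_bounds T f g)"
  by (rule bdd_belowI[of _ 0]) (auto simp: skorokhod_bounds_def)

lemma skorokhod_bounds_commute_le:
  "skorokhod_bounds T f g \<subseteq> skorokhod_bounds T g f"
proof
  fix e assume "e \<in> skorokhod_bounds T f g"
  then obtain l where l: "e > 0" "l \<in> time_changes T"
    "\<And>t. t \<in> {0..T} \<Longrightarrow> \<bar>l t - t\<bar> \<le> e \<and> dist (f t) (g (l t)) \<le> e"
    by (auto simp: skorokhod_bounds_def)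
  obtain k where k: "k \<in> time_changes T"
    "\<And>t. t \<in> {0..T} \<Longrightarrow> k t \<in> {0..T}" "\<And>t. t \<in> {0..T} \<Longrightarrow> l (k t) = t"
    using time_changes_inv[OF l(2)] by metis
  have "\<bar>k t - t\<bar> \<le> e \<and> dist (g t) (f (k t)) \<le> e" if "t \<in> {0..T}" for t
    using l(3)[of "k t"] k(2,3)[OF that] by (simp add: abs_minus_commute dist_commute)
  then show "e \<in> skorokhod_bounds T g f"
    using l(1) k(1) unfolding skorokhod_bounds_def by blast
qed

lemma skorokhod_bounds_commute: "skorokhod_bounds T f g = skorokhod_bounds T g f"
  by (intro subset_antisym skorokhod_bounds_commute_le)

lemma skorokhod_bounds_add:
  assumes "d \<in> skorokhod_bounds T f g" "e \<in> skorokhod_bounds T g h"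
  shows "d + e \<in> skorokhod_bounds T f h"
proof -
  obtain l where l: "d > 0" "l \<in> time_changes T"
    "\<And>t. t \<in> {0..T} \<Longrightarrow> \<bar>l t - t\<bar> \<le> d \<and> dist (f t) (g (l t)) \<le> d"
    using assms(1) by (auto simp: skorokhod_bounds_def)
  obtain k where k: "e > 0" "k \<in> time_changes T"
    "\<And>t. t \<in> {0..T} \<Longrightarrow> \<bar>k t - t\<bar> \<le> e \<and> dist (g t) (h (k t)) \<le> e"
    using assms(2) by (auto simp: skorokhod_bounds_def)
  have "\<bar>k (l t) - t\<bar> \<le> d + e \<and> dist (f t) (h (k (l t))) \<le> d + e" if t: "t \<in> {0..T}" for t
  proof -
    have "l t \<in> {0..T}" using time_changesD(3)[OF l(2)] t .
    then have "\<bar>k (l t) - l t\<bar> \<le> e" "dist (g (l t)) (h (k (l t))) \<le> e" using k(3) by auto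
    moreover have "\<bar>l t - t\<bar> \<le> d" "dist (f t) (g (l t)) \<le> d" using l(3) t by auto
    moreover have "dist (f t) (h (k (l t))) \<le> dist (f t) (g (l t)) + dist (g (l t)) (h (k (l t)))"
      by (rule dist_triangle)
    ultimately show ?thesis by linarith
  qed
  then have "\<exists>m\<in>time_changes T. \<forall>t\<in>{0..T}. \<bar>m t - t\<bar> \<le> d + e \<and> dist (f t) (h (m t)) \<le> d + e"
    by (intro bexI[OF _ time_changes_comp[OF k(2) l(2)]] ballI)
  moreover have "d + e > 0" using l(1) k(1) by simp
  ultimately show ?thesis by (simp add: skorokhod_bounds_def)
qed

lemma skorokhod_dist_less:
  assumes "f \<in> cadlag T" "g \<in> cadlag T" "skorokhod_dist T f g < r"
  obtains e where "e \<in> skorokhod_bounds T f g" "e < r"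
proof -
  have "Inf (skorokhod_bounds T f g) < r" using assms by (simp add: skorokhod_dist_def)
  from cInf_lessD[OF skorokhod_bounds_nonempty[OF assms(1,2)] this] show ?thesis
    using that by blast
qed

lemma skorokhod_dist_le:
  assumes "f \<in> cadlag T" "g \<in> cadlag T" "e \<in> skorokhod_bounds T f g"
  shows "skorokhod_dist T f g \<le> e"
  using assms(1,2) cInf_lower[OF assms(3) skorokhod_bounds_bdd_below]
  by (simp add: skorokhod_dist_def)

lemma skorokhod_dist_nonneg: "0 \<le> skorokhod_dist T f g"
proof (cases "f \<in> cadlag T \<and> g \<in> cadlag T")
  case True
  then have "0 \<le> Inf (skorokhod_bounds T f g)"
    by (intro cInf_greatest skorokhod_bounds_nonempty) (auto simp: skorokhod_bounds_def)
  then show ?thesis using True by (simp add: skorokhod_dist_def)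
next
  case False
  then show ?thesis by (auto simp: skorokhod_dist_def)
qed

lemma skorokhod_dist_eq_0_imp:
  fixes f g :: "real \<Rightarrow> 'b::metric_space"
  assumes f: "f \<in> cadlag T" and g: "g \<in> cadlag T" and 0: "skorokhod_dist T f g = 0"
  shows "f = g"
proof (rule extensionalityI[of f "{0..T}"])
  show "f \<in> extensional {0..T}" "g \<in> extensional {0..T}"
    using f g by (auto simp: cadlag_def)
  fix t assume t: "t \<in> {0..T}"
  have small: "\<exists>l\<in>time_changes T. \<forall>s\<in>{0..T}. \<bar>l s - s\<bar> \<le> r \<and> dist (f s) (g (l s)) \<le> r"
    if r: "r > 0" for r
  proof -
    obtain e where e: "e \<in> skorokhod_bounds T f g" "e < r"
      by (rule skorokhod_dist_less[OF f g, of r]) (use 0 r in auto)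
    then obtain l where "l \<in> time_changes T"
      "\<And>s. s \<in> {0..T} \<Longrightarrow> \<bar>l s - s\<bar> \<le> e \<and> dist (f s) (g (l s)) \<le> e"
      by (auto simp: skorokhod_bounds_def)
    then show ?thesis using e(2) by (intro bexI[of _ l]) force+
  qed
  have close: "dist (f t) (g t) \<le> 3 * r" if r: "r > 0" for r
  proof (cases "t < T")
    case True
    have "eventually (\<lambda>s. dist (f s) (f t) < r \<and> dist (g s) (g t) < r) (at_right t)"
      using f g t True r by (intro eventually_conj tendstoD) (auto simp: cadlag_def)
    then obtain b0 where b0: "b0 > t"
      "\<And>s. t < s \<Longrightarrow> s < b0 \<Longrightarrow> dist (f s) (f t) < r \<and> dist (g s) (g t) < r"
      by (auto simp: eventually_at_right_field)
    define d where "d = min b0 T - t"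
    have d: "d > 0" "t + d \<le> b0" "t + d \<le> T" using b0 True by (auto simp: d_def)
    have "min r (d / 4) > 0" using r d by simp
    from small[OF this] obtain l where l: "\<And>s. s \<in> {0..T} \<Longrightarrow>
        \<bar>l s - s\<bar> \<le> min r (d / 4) \<and> dist (f s) (g (l s)) \<le> min r (d / 4)"
      by blast
    define s where "s = t + d / 2"
    have s: "s \<in> {0..T}" "t < s" "s < b0" using d t by (auto simp: s_def)
    have ls: "\<bar>l s - s\<bar> \<le> d / 4" "dist (f s) (g (l s)) \<le> r" using l[OF s(1)] by auto
    then have "t < l s" "l s < b0" using d unfolding s_def by linarith+
    then have "dist (g (l s)) (g t) < r" "dist (f s) (f t) < r" using b0 s by auto
    then show ?thesis
      using ls(2) dist_triangle3[of "f t" "g t" "f s"] dist_triangle[of "f s" "g t" "g (l s)"]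
      by linarith
  next
    case False
    then have tT: "t = T" using t by auto
    obtain l where l: "l \<in> time_changes T" "\<And>s. s \<in> {0..T} \<Longrightarrow> dist (f s) (g (l s)) \<le> r"
      using small[OF r] by blast
    have im: "l ` {0..T} = {0..T}" and sm: "strict_mono_on {0..T} l"
      using l(1) by (auto simp: time_changes_def)
    have TT: "T \<in> {0..T}" using t tT by simp
    then have "T \<in> l ` {0..T}" unfolding im .
    then obtain u where u: "u \<in> {0..T}" "l u = T" by blast
    have "l u \<le> l T" by (rule strict_mono_on_leD[OF sm u(1) TT]) (use u(1) in simp)
    moreover have "l T \<in> {0..T}" by (rule time_changesD(3)[OF l(1) TT])
    ultimately have "l T = T" using u by auto
    then show ?thesis using l(2)[OF TT] r tT by simp
  qed
  show "f t = g t"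
  proof (rule ccontr)
    assume "f t \<noteq> g t"
    then have "dist (f t) (g t) > 0" by simp
    then show False using close[of "dist (f t) (g t) / 4"] by linarith
  qed
qed

lemma Metric_space_skorokhod:
  "Metric_space (cadlag T :: (real \<Rightarrow> 'b::metric_space) set) (skorokhod_dist T)"
proof
  fix f g h :: "real \<Rightarrow> 'b"
  show "0 \<le> skorokhod_dist T f g" by (rule skorokhod_dist_nonneg)
  show "skorokhod_dist T f g = skorokhod_dist T g f"
    by (simp add: skorokhod_dist_def skorokhod_bounds_commute[of T f g])
  show "(skorokhod_dist T f g = 0) = (f = g)" if fg: "f \<in> cadlag T" "g \<in> cadlag T"
  proof
    show "f = g" if "skorokhod_dist T f g = 0" using skorokhod_dist_eq_0_imp fg that by blast
    assume "f = g"
    have "skorokhod_dist T f g \<le> 0"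
    proof (rule field_le_epsilon)
      fix e :: real assume "e > 0"
      then have "e \<in> skorokhod_bounds T f g"
        using id_time_changes \<open>f = g\<close>
        by (auto simp: skorokhod_bounds_def intro!: bexI[of _ "\<lambda>t. t"])
      then show "skorokhod_dist T f g \<le> 0 + e" using skorokhod_dist_le fg by auto
    qed
    then show "skorokhod_dist T f g = 0" using skorokhod_dist_nonneg[of T f g] by linarith
  qed
  show "skorokhod_dist T f h \<le> skorokhod_dist T f g + skorokhod_dist T g h"
    if fgh: "f \<in> cadlag T" "g \<in> cadlag T" "h \<in> cadlag T"
  proof (rule field_le_epsilon)
    fix e :: real assume e: "e > 0"
    obtain a where a: "a \<in> skorokhod_bounds T f g" "a < skorokhod_dist T f g + e / 2"
      using skorokhod_dist_less[OF fgh(1,2), of "skorokhod_dist T f g + e / 2"] e by auto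
    obtain b where b: "b \<in> skorokhod_bounds T g h" "b < skorokhod_dist T g h + e / 2"
      using skorokhod_dist_less[OF fgh(2,3), of "skorokhod_dist T g h + e / 2"] e by auto
    have "skorokhod_dist T f h \<le> a + b"
      using skorokhod_dist_le[OF fgh(1,3) skorokhod_bounds_add[OF a(1) b(1)]] .
    then show "skorokhod_dist T f h \<le> skorokhod_dist T f g + skorokhod_dist T g h + e"
      using a b by linarith
  qed
qed

lemma topspace_skorokhod: "topspace (skorokhod_topology T) = cadlag T"
  unfolding skorokhod_topology_def
  by (rule Metric_space.topspace_mtopology[OF Metric_space_skorokhod])


section \<open>Weak convergence\<close>

definition borel_of :: "'c topology \<Rightarrow> 'c measure" where
  "borel_of S = sigma (topspace S) {U. openin S U}"

text \<open>
  Weak convergence of the random elements \<open>X n\<close>, defined on \<open>M\<close>, to the random element \<open>Y\<close>,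
  defined on a possibly different probability space \<open>N\<close>.  Being a random element of \<open>S\<close>
  (measurability with respect to the Borel sets of \<open>S\<close>) is part of the assertion.
\<close>

definition converges_weakly ::
    "'c topology \<Rightarrow> 'a measure \<Rightarrow> (nat \<Rightarrow> 'a \<Rightarrow> 'c) \<Rightarrow> 'b measure \<Rightarrow> ('b \<Rightarrow> 'c) \<Rightarrow> bool" where
  "converges_weakly S M X N Y \<longleftrightarrow>
     (\<forall>n. X n \<in> M \<rightarrow>\<^sub>M borel_of S) \<and>
     Y \<in> N \<rightarrow>\<^sub>M borel_of S \<and>
     (\<forall>F. continuous_map S euclideanreal F \<and> bounded (F ` topspace S) \<longrightarrow>
        (\<lambda>n. \<integral>\<omega>. F (X n \<omega>) \<partial>M) \<longlonglongrightarrow> (\<integral>\<omega>. F (Y \<omega>) \<partial>N))"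

end

theory Submission
  imports Defs "HOL-Real_Asymp.Real_Asymp"
begin

text \<open>
  Every step changes the sum of the two coordinates by a fair sign that is independent of the past,
  so \<open>H + V\<close> is a simple random walk and Donsker's theorem applies to it. The height \<open>V\<close> is a
  martingale whose quadratic variation is the number of new sites, so everything reduces to showing
  that the expected number of new sites among the first \<open>m\<close> is \<open>o(m)\<close>.

  Allow arbitrary initial sets of old sites. The largest expected number of new sites in \<open>m\<close> steps is
  then subadditive in \<open>m\<close>, so it grows at some linear rate \<open>\<phi>\<close>. Suppose \<open>\<phi> > 0\<close>. A nearly optimal
  start must meet new sites at rate about \<open>\<phi>\<close> in almost every block of bounded length, since no block
  can do much better. Hence the walk has covariance \<open>diag(1 - \<phi>, \<phi>)\<close> on large scales, and the potential
  \<open>ln(1 + x\<^sup>2/(1 - \<phi>) + y\<^sup>2/\<phi>)\<close> shows that, as in the recurrent planar random walk, the time spent near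
  a point already visited exceeds its naive value by a logarithmic factor. So only a vanishing
  fraction of the time can be spent discovering new cells, which contradicts \<open>\<phi> > 0\<close>.

  For Donsker's theorem, paths are compared with step functions on a grid of \<open>k\<close> blocks. The block
  increments are independent and converge in law, hence converge pointwise after a change of
  probability space; a fourth moment maximal inequality controls the oscillation within the blocks.
  Bounded continuous functionals are approximated from below by bounded Lipschitz ones.
\<close>

section \<open>Fair coins and the transition operator\<close>

text \<open>The position alone is not Markov and the set of old sites is never controlled, so all
  estimates concern the chain of pairs (old set, position) and hold from every start. Every block of
  suitable length \<open>b\<close> then has at most (\<open>growth\<close> + \<delta>) b expected
  new sites. The deficit of a block below this bound is nonnegative, deficits add up along the walk,
  and a nearly optimal start has a small total deficit. This one-sided bookkeeping takes the place
  of a law of large numbers.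

  The contradiction is a double count. A marker is the position at a multiple of r^2. Around each
  marker in a new cell of side r, Dynkin's formula for the potential forces the occupation of a bump
  of width r during J r^2 steps to be of order r^2 ln J. At a fixed time the bumps around markers in
  different cells have a bounded sum. Hence at most of order J / ln J of the J markers lie in new
  cells, and each of these accounts for O(r^2) new sites. The horizon is doubled to leave room for
  the window of every marker; the half with the markers sees few new sites, and the other half
  cannot compensate.\<close>

type_synonym site = "int \<times> int"

text \<open>The set of sites already departed from, and the current position.\<close>

type_synonym state = "site set \<times> site"

definition sgn_of :: "bool \<Rightarrow> int" where
  "sgn_of b = (if b then 1 else - 1)"

text \<open>The same coin supplies the sign of a vertical and of a horizontal step, so the coins are
  exactly the increments of the coordinate sum, whatever the set of old sites.\<close>

definition step :: "state \<Rightarrow> bool \<Rightarrow> state" where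
  "step s b = (insert (snd s) (fst s),
     snd s + (if snd s \<in> fst s then (sgn_of b, 0) else (0, sgn_of b)))"

abbreviation run :: "state \<Rightarrow> bool list \<Rightarrow> state" where
  "run \<equiv> foldl step"

text \<open>The mean over all sequences of \<open>m\<close> fair coins, as a recursion instead of an
  integral. No measurability or integrability conditions arise, and the first coin splits off by
  definition, which suits arguments from a changing start.\<close>

primrec coin :: "nat \<Rightarrow> (bool list \<Rightarrow> real) \<Rightarrow> real" where
  "coin 0 F = F []"
| "coin (Suc m) F = (coin m (\<lambda>w. F (True # w)) + coin m (\<lambda>w. F (False # w))) / 2"

lemma coin_mono: "(\<And>w. length w = m \<Longrightarrow> F w \<le> G w) \<Longrightarrow> coin m F \<le> coin m G"
proof (induction m arbitrary: F G)
  case (Suc m)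
  then have "coin m (\<lambda>w. F (True # w)) \<le> coin m (\<lambda>w. G (True # w))"
    "coin m (\<lambda>w. F (False # w)) \<le> coin m (\<lambda>w. G (False # w))"
    by (auto intro!: Suc.IH Suc.prems)
  then show ?case by simp
qed simp

lemma coin_cong: "(\<And>w. length w = m \<Longrightarrow> F w = G w) \<Longrightarrow> coin m F = coin m G"
  by (intro antisym coin_mono) auto

lemma coin_const [simp]: "coin m (\<lambda>w. c) = c"
  by (induction m) auto

lemma coin_add: "coin m (\<lambda>w. F w + G w) = coin m F + coin m G"
  by (induction m arbitrary: F G) (auto simp: add_divide_distrib)

lemma coin_cmult: "coin m (\<lambda>w. c * F w) = c * coin m F"
  by (induction m arbitrary: F) (auto simp: algebra_simps add_divide_distrib)

lemma coin_minus: "coin m (\<lambda>w. - F w) = - coin m F"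
  using coin_cmult[of m "-1" F] by simp

lemma coin_diff: "coin m (\<lambda>w. F w - G w) = coin m F - coin m G"
  using coin_add[of m F "\<lambda>w. - G w"] by (simp add: coin_minus)

lemma coin_divide: "coin m (\<lambda>w. F w / c) = coin m F / c"
  using coin_cmult[of m "inverse c" F] by (simp add: field_simps)

lemma coin_sum: "coin m (\<lambda>w. \<Sum>i\<in>I. F i w) = (\<Sum>i\<in>I. coin m (F i))"
  by (induction I rule: infinite_finite_induct) (auto simp: coin_add)

lemma coin_append: "coin (m + n) F = coin m (\<lambda>u. coin n (\<lambda>v. F (u @ v)))"
  by (induction m arbitrary: F) auto

lemma coin_take: "k \<le> m \<Longrightarrow> coin m (\<lambda>w. F (take k w)) = coin k F"
proof -
  assume "k \<le> m"
  then have "coin m (\<lambda>w. F (take k w)) = coin (k + (m - k)) (\<lambda>w. F (take k w))" by simp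
  also have "\<dots> = coin k F"
    unfolding coin_append by (rule coin_cong) simp
  finally show ?thesis .
qed

lemma coin_split:
  assumes "k \<le> m"
  shows "coin m F = coin k (\<lambda>u. coin (m - k) (\<lambda>v. F (u @ v)))"
  using coin_append[of k "m - k" F] assms by simp

lemma coin_abs: "\<bar>coin m F\<bar> \<le> coin m (\<lambda>w. \<bar>F w\<bar>)"
proof -
  have "coin m F \<le> coin m (\<lambda>w. \<bar>F w\<bar>)" "coin m (\<lambda>w. - F w) \<le> coin m (\<lambda>w. \<bar>F w\<bar>)"
    by (intro coin_mono; simp)+
  then show ?thesis by (simp add: coin_minus)
qed

section \<open>Semigroup, truncated Green operator and generator of the chain on states\<close>

definition trans_op :: "nat \<Rightarrow> (state \<Rightarrow> real) \<Rightarrow> state \<Rightarrow> real" where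
  "trans_op k g s = coin k (\<lambda>w. g (run s w))"

definition occ :: "(state \<Rightarrow> real) \<Rightarrow> nat \<Rightarrow> state \<Rightarrow> real" where
  "occ g m s = (\<Sum>k<m. trans_op k g s)"

definition gen :: "(state \<Rightarrow> real) \<Rightarrow> state \<Rightarrow> real" where
  "gen f s = (f (step s True) + f (step s False)) / 2 - f s"

lemma trans_op_0 [simp]: "trans_op 0 g s = g s"
  by (simp add: trans_op_def)

lemma trans_op_add: "trans_op (j + k) g s = trans_op j (trans_op k g) s"
  by (simp add: trans_op_def coin_append)

lemma trans_op_mono: "(\<And>s. f s \<le> g s) \<Longrightarrow> trans_op k f s \<le> trans_op k g s"
  by (simp add: trans_op_def coin_mono)

lemma trans_op_const [simp]: "trans_op k (\<lambda>s. c) s = c"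
  by (simp add: trans_op_def)

lemma trans_op_lin:
  "trans_op k (\<lambda>s. f s + g s) s = trans_op k f s + trans_op k g s"
  "trans_op k (\<lambda>s. f s - g s) s = trans_op k f s - trans_op k g s"
  "trans_op k (\<lambda>s. c * f s) s = c * trans_op k f s"
  by (simp_all add: trans_op_def coin_add coin_diff coin_cmult)

lemma trans_op_abs: "\<bar>trans_op k g s\<bar> \<le> trans_op k (\<lambda>s. \<bar>g s\<bar>) s"
  by (simp add: trans_op_def coin_abs)

lemma occ_mono: "(\<And>s. f s \<le> g s) \<Longrightarrow> occ f m s \<le> occ g m s"
  by (simp add: occ_def sum_mono trans_op_mono)

lemma occ_const [simp]: "occ (\<lambda>s. c) m s = c * m"
  by (simp add: occ_def)

lemma occ_lin:
  "occ (\<lambda>s. f s + g s) m s = occ f m s + occ g m s"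
  "occ (\<lambda>s. f s - g s) m s = occ f m s - occ g m s"
  "occ (\<lambda>s. c * f s) m s = c * occ f m s"
  by (simp_all add: occ_def trans_op_lin sum.distrib sum_subtractf sum_distrib_left)

lemma occ_Suc: "occ g (Suc m) s = occ g m s + trans_op m g s"
  by (simp add: occ_def)

text \<open>The Markov property at time \<open>m\<close>. It turns suprema over all starts into
  subadditivity and lets estimates for blocks be added.\<close>

lemma occ_add: "occ g (m + n) s = occ g m s + trans_op m (occ g n) s"
proof (induction n)
  case 0
  have "occ g 0 = (\<lambda>s. 0)" by (simp add: occ_def fun_eq_iff)
  then show ?case by simp
next
  case (Suc n)
  have "occ g (Suc n) = (\<lambda>s. occ g n s + trans_op n g s)" by (simp add: occ_Suc fun_eq_iff)
  then show ?case using Suc by (simp add: occ_Suc trans_op_lin trans_op_add)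
qed

text \<open>Dynkin's formula, here a telescoping sum. The moment bounds, the potential estimate and
  the maximal inequalities all rest on it.\<close>

lemma occ_dynkin: "trans_op m f s = f s + occ (gen f) m s"
proof (induction m)
  case (Suc m)
  have "trans_op (Suc m) f s = trans_op m (trans_op 1 f) s"
    using trans_op_add[of m 1 f s] by simp
  also have "trans_op 1 f = (\<lambda>s. f s + gen f s)"
    by (auto simp: trans_op_def gen_def)
  finally show ?case using Suc by (simp add: trans_op_lin occ_def)
qed (simp add: occ_def)

lemma occ_path: "occ g m s = coin m (\<lambda>w. \<Sum>k<m. g (run s (take k w)))"
  unfolding occ_def trans_op_def coin_sum
  by (intro sum.cong refl) (simp add: coin_take[where F = "\<lambda>w. g (run s w)"])

section \<open>The expected number of new sites and its linear rate\<close>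

definition new :: "state \<Rightarrow> real" where
  "new s = of_bool (snd s \<notin> fst s)"

lemma new_bounds: "0 \<le> new s" "new s \<le> 1"
  by (auto simp: new_def)

text \<open>The supremum ranges over every set of old sites, finite or infinite, reachable or not,
  so that the state after any number of steps is again an admissible start.\<close>

definition new_max :: "nat \<Rightarrow> real" where
  "new_max m = (SUP s. occ new m s)"

lemma occ_new_bounds: "0 \<le> occ new m s" "occ new m s \<le> m"
  using occ_mono[of "\<lambda>_. 0" new m s] occ_mono[of new "\<lambda>_. 1" m s] new_bounds by auto

lemma occ_new_le_new_max: "occ new m s \<le> new_max m"
  unfolding new_max_def by (rule cSUP_upper) (auto intro!: bdd_aboveI occ_new_bounds(2))

lemma new_max_least: "(\<And>s. occ new m s \<le> c) \<Longrightarrow> new_max m \<le> c"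
  unfolding new_max_def by (rule cSUP_least) auto

lemma new_max_nonneg: "0 \<le> new_max m"
  using occ_new_bounds(1) occ_new_le_new_max order_trans by blast

lemma new_max_le: "new_max m \<le> m"
  by (rule new_max_least) (rule occ_new_bounds)

lemma new_max_add: "new_max (m + n) \<le> new_max m + new_max n"
proof (rule new_max_least)
  fix s
  have "trans_op m (occ new n) s \<le> new_max n"
    using trans_op_mono[of "occ new n" "\<lambda>_. new_max n" m s] occ_new_le_new_max by simp
  then show "occ new (m + n) s \<le> new_max m + new_max n"
    using occ_new_le_new_max[of m s] by (simp add: occ_add)
qed

lemma new_max_mult: "new_max (q * b) \<le> q * new_max b"
proof (induction q)
  case 0
  then show ?case using new_max_le[of 0] by simp
next
  case (Suc q)
  then show ?case using new_max_add[of b "q * b"] by (simp add: algebra_simps)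
qed

text \<open>
  A walk that turns back after two vertical steps finds itself on an old site.
\<close>

lemma new_max_3: "new_max 3 \<le> 5 / 2"
proof (rule new_max_least)
  fix s :: "state"
  have ne0: "(0, 0) = (0 :: site)" "(0, 1) \<noteq> (0 :: site)" "(0, - 1) \<noteq> (0 :: site)" by (simp_all add: zero_prod_def)
  have *: "(\<Sum>k<3. new (run s (take k w))) \<le> 3 - of_bool (w ! 0 \<noteq> w ! 1)" if "length w = 3" for w
  proof -
    obtain a b c where w: "w = [a, b, c]"
      using \<open>length w = 3\<close> by (auto simp: numeral_3_eq_3 length_Suc_conv)
    obtain A z where s: "s = (A, z)" by (cases s)
    obtain x y where z: "z = (x, y)" by (cases z)
    have "(\<Sum>k<3. new (run s (take k w))) =
        new s + new (step s a) + new (step (step s a) b)"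
      by (simp add: w eval_nat_numeral)
    also have "\<dots> \<le> 3 - of_bool (a \<noteq> b)"
      by (cases a; cases b) (auto simp: s z new_def step_def sgn_of_def ne0)
    finally show ?thesis by (simp add: w)
  qed
  have "occ new 3 s \<le> coin 3 (\<lambda>w. 3 - of_bool (w ! 0 \<noteq> w ! 1))"
    unfolding occ_path by (rule coin_mono) (rule *)
  also have "\<dots> = 5 / 2" by (simp add: numeral_3_eq_3)
  finally show "occ new 3 s \<le> 5 / 2" .
qed

text \<open>Fekete's limit, taken as an infimum. In this form it is immediate that the best start
  achieves at least \<open>growth * m\<close> at every length, and little more than that at some
  length \<open>b\<close>.\<close>

definition growth :: real where
  "growth = (INF m\<in>{1..}. new_max m / m)"

lemma growth_le: "m \<ge> 1 \<Longrightarrow> growth * m \<le> new_max m"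
proof -
  assume m: "m \<ge> 1"
  have "growth \<le> new_max m / m"
    unfolding growth_def using m new_max_nonneg by (intro cINF_lower bdd_belowI[of _ 0]) auto
  then show ?thesis using m by (simp add: field_simps)
qed

lemma growth_approx:
  assumes "\<delta> > 0"
  obtains b where "b \<ge> 1" "new_max b \<le> (growth + \<delta>) * b"
proof -
  have "\<exists>x\<in>(\<lambda>m. new_max m / m) ` {1..}. x < growth + \<delta>"
    unfolding growth_def
    by (subst cInf_less_iff[symmetric])
       (use assms new_max_nonneg in \<open>auto intro!: bdd_belowI[of _ 0]\<close>)
  then obtain b where "b \<ge> 1" "new_max b / b < growth + \<delta>" by auto
  then show ?thesis by (intro that[of b]) (auto simp: field_simps)
qed

lemma growth_nonneg: "0 \<le> growth"
  unfolding growth_def by (rule cINF_greatest) (use new_max_nonneg in auto)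

text \<open>\<open>1 - growth\<close> becomes the horizontal variance and a divisor; the bound 5 / 2
  at length 3 keeps it positive.\<close>

lemma growth_less_1: "growth < 1"
  using growth_le[of 3] new_max_3 by simp

section \<open>Moments and the logarithmic potential\<close>

definition hdiff :: "(site \<Rightarrow> real) \<Rightarrow> site \<Rightarrow> real" where
  "hdiff h z = (h (z + (1, 0)) + h (z + (- 1, 0))) / 2 - h z"

definition vdiff :: "(site \<Rightarrow> real) \<Rightarrow> site \<Rightarrow> real" where
  "vdiff h z = (h (z + (0, 1)) + h (z + (0, - 1))) / 2 - h z"

lemma gen_position:
  "gen (\<lambda>s. h (snd s)) s = new s * vdiff h (snd s) + (1 - new s) * hdiff h (snd s)"
  by (simp add: gen_def step_def new_def hdiff_def vdiff_def sgn_of_def)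

definition sqdist :: "site \<Rightarrow> site \<Rightarrow> real" where
  "sqdist c z = (real_of_int (fst z - fst c))\<^sup>2 + (real_of_int (snd z - snd c))\<^sup>2"

lemma sqdist_nonneg: "0 \<le> sqdist c z"
  by (simp add: sqdist_def)

lemma gen_sqdist: "gen (\<lambda>s. sqdist c (snd s)) s = 1"
proof -
  have "hdiff (sqdist c) z = 1" "vdiff (sqdist c) z = 1" for z
    by (simp_all add: hdiff_def vdiff_def sqdist_def power2_eq_square field_simps)
  then show ?thesis by (simp add: gen_position)
qed

lemma trans_op_sqdist: "trans_op m (\<lambda>s. sqdist c (snd s)) s = sqdist c (snd s) + m"
proof -
  have "gen (\<lambda>s. sqdist c (snd s)) = (\<lambda>s. 1)" by (simp add: gen_sqdist fun_eq_iff)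
  then show ?thesis by (simp add: occ_dynkin)
qed

lemma gen_sqdist_sq: "gen (\<lambda>s. (sqdist c (snd s))\<^sup>2) s \<le> 6 * sqdist c (snd s) + 1"
proof -
  have "hdiff (\<lambda>z. (sqdist c z)\<^sup>2) z \<le> 6 * sqdist c z + 1 \<and>
        vdiff (\<lambda>z. (sqdist c z)\<^sup>2) z \<le> 6 * sqdist c z + 1" for z
  proof -
    define x y where xy: "x = real_of_int (fst z) - fst c" "y = real_of_int (snd z) - snd c"
    have s: "real_of_int (fst z) = x + fst c" "real_of_int (snd z) = y + snd c"
      by (simp_all add: xy)
    have "hdiff (\<lambda>z. (sqdist c z)\<^sup>2) z = 2 * (x\<^sup>2 + y\<^sup>2) + 4 * x\<^sup>2 + 1"
      by (simp add: hdiff_def sqdist_def s) (simp add: power2_eq_square field_simps)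
    moreover have "vdiff (\<lambda>z. (sqdist c z)\<^sup>2) z = 2 * (x\<^sup>2 + y\<^sup>2) + 4 * y\<^sup>2 + 1"
      by (simp add: vdiff_def sqdist_def s) (simp add: power2_eq_square field_simps)
    moreover have "sqdist c z = x\<^sup>2 + y\<^sup>2" by (simp add: sqdist_def s)
    ultimately show ?thesis by simp
  qed
  then show ?thesis
    unfolding gen_position[of "\<lambda>z. (sqdist c z)\<^sup>2"] by (simp add: new_def)
qed

text \<open>The squared distance has mean k at time k, so the generator of its square has mean at
  most 6 k + 1, and these sum to 3 m^2 - 2 m.\<close>

lemma trans_op_sqdist_sq:
  "trans_op m (\<lambda>s. (sqdist (snd s0) (snd s))\<^sup>2) s0 \<le> 3 * (real m)\<^sup>2"
proof -
  have "trans_op m (\<lambda>s. (sqdist (snd s0) (snd s))\<^sup>2) s0 =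
      (sqdist (snd s0) (snd s0))\<^sup>2 + occ (gen (\<lambda>s. (sqdist (snd s0) (snd s))\<^sup>2)) m s0"
    by (rule occ_dynkin)
  also have "\<dots> \<le> occ (\<lambda>s. 6 * sqdist (snd s0) (snd s) + 1) m s0"
    using occ_mono[OF gen_sqdist_sq] by (simp add: sqdist_def)
  also have "\<dots> = (\<Sum>k<m. 6 * real k + 1)"
    by (simp add: occ_def trans_op_lin trans_op_sqdist) (simp add: sqdist_def)
  also have "\<dots> \<le> 3 * (real m)\<^sup>2"
    by (induction m) (auto simp: power2_eq_square algebra_simps)
  finally show ?thesis .
qed

text \<open>A quadratic minorant in \<open>t\<close>, so that two moments bound the mean of a
  logarithm from below. For \<open>t \<le> 1\<close> concavity suffices; beyond that, t - t^2 / 8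
  never exceeds its maximum 2, while \<open>ln (1 + t * y)\<close> is at least
  \<open>ln (1 + y)\<close>.\<close>

lemma ln_ge_quadratic:
  fixes t y :: real
  assumes "t \<ge> 0" "y \<ge> 0"
  shows "ln (1 + t * y) \<ge> ln (1 + y) / 2 * (t - t\<^sup>2 / 8)"
proof (cases "t \<le> 1")
  case True
  have "t * ln (1 + y) \<le> ln ((1 - t) * 1 + t * (1 + y))"
    using concave_onD[OF ln_concave, of t 1 "1 + y"] assms True by (simp add: algebra_simps)
  moreover have "ln (1 + y) / 2 * (t - t\<^sup>2 / 8) \<le> ln (1 + y) * t"
  proof -
    have "(t - t\<^sup>2 / 8) / 2 \<le> t" using assms(1) by (simp add: field_simps)
    then have "ln (1 + y) * ((t - t\<^sup>2 / 8) / 2) \<le> ln (1 + y) * t"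
      using assms(2) by (intro mult_left_mono) auto
    then show ?thesis by simp
  qed
  ultimately show ?thesis by (simp add: algebra_simps)
next
  case False
  have "t - t\<^sup>2 / 8 \<le> 2" using zero_le_power2[of "t - 4"] by (simp add: power2_eq_square algebra_simps)
  then have "ln (1 + y) / 2 * (t - t\<^sup>2 / 8) \<le> ln (1 + y) / 2 * 2"
    using assms(2) by (intro mult_left_mono) auto
  also have "\<dots> \<le> ln (1 + t * y)"
    using False assms(2) mult_right_mono[of 1 t y] by simp
  finally show ?thesis .
qed

text \<open>With t = sqdist / m, the mean of t is 1 and that of t^2 at most 3, so t - t^2 / 8 has
  mean at least 5 / 8, and half of this exceeds 1 / 4. Both kinds of step have length 1, which makes
  the bound uniform in the start.\<close>

lemma trans_op_ln_sqdist:
  assumes "R > 0" "m \<ge> 1"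
  shows "ln (1 + m / R) / 4 \<le> trans_op m (\<lambda>s. ln (1 + sqdist (snd s0) (snd s) / R)) s0"
proof -
  define l where "l = ln (1 + m / R)"
  have l: "l \<ge> 0" using assms by (simp add: l_def)
  define W where "W = (\<lambda>s :: state. sqdist (snd s0) (snd s))"
  have "l / 4 \<le> l / 2 * (1 - 3 / 8)" using l by simp
  also have "\<dots> \<le> l / 2 * (trans_op m W s0 / m - trans_op m (\<lambda>s. (W s)\<^sup>2) s0 / (8 * m\<^sup>2))"
  proof (rule mult_left_mono)
    have "trans_op m W s0 = m" unfolding W_def by (simp add: trans_op_sqdist) (simp add: sqdist_def)
    moreover have "trans_op m (\<lambda>s. (W s)\<^sup>2) s0 / (8 * m\<^sup>2) \<le> 3 / 8"
      using trans_op_sqdist_sq[of m s0] assms by (simp add: W_def field_simps)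
    ultimately show "1 - 3 / 8 \<le> trans_op m W s0 / m - trans_op m (\<lambda>s. (W s)\<^sup>2) s0 / (8 * m\<^sup>2)"
      using assms by simp
  qed (use l in simp)
  also have "\<dots> = trans_op m (\<lambda>s. (l / 2 / m) * W s - (l / 2 / (8 * m\<^sup>2)) * (W s)\<^sup>2) s0"
    by (simp only: trans_op_lin) (simp add: algebra_simps)
  also have "\<dots> \<le> trans_op m (\<lambda>s. ln (1 + W s / R)) s0"
  proof (rule trans_op_mono)
    fix s
    have "l / 2 * (W s / m - (W s / m)\<^sup>2 / 8) \<le> ln (1 + (W s / m) * (m / R))"
      unfolding l_def using assms by (intro ln_ge_quadratic) (auto simp: W_def sqdist_nonneg)
    then show "(l / 2 / m) * W s - (l / 2 / (8 * m\<^sup>2)) * (W s)\<^sup>2 \<le> ln (1 + W s / R)"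
      using assms by (simp add: power_divide field_simps)
  qed
  finally show ?thesis by (simp add: l_def W_def)
qed

text \<open>The second derivative of \<^term>\<open>\<lambda>x. ln (c + x\<^sup>2) :: real\<close>.\<close>

definition ln2 :: "real \<Rightarrow> real \<Rightarrow> real" where
  "ln2 c x = 2 * (c - x\<^sup>2) / (c + x\<^sup>2)\<^sup>2"

lemma ln2_bound:
  assumes "c \<ge> 1"
  shows "\<bar>ln2 c x\<bar> \<le> 2"
proof -
  have p: "c + x\<^sup>2 \<ge> 1" using assms by (simp add: add_increasing2)
  have "\<bar>c - x\<^sup>2\<bar> \<le> c + x\<^sup>2" using assms by (simp add: abs_le_iff)
  also have "\<dots> \<le> (c + x\<^sup>2)\<^sup>2" using p by (simp add: power2_eq_square)
  finally have "\<bar>c - x\<^sup>2\<bar> / (c + x\<^sup>2)\<^sup>2 \<le> 1" using p by (simp add: divide_le_eq)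
  moreover have "ln2 c x = 2 * ((c - x\<^sup>2) / (c + x\<^sup>2)\<^sup>2)" by (simp add: ln2_def)
  ultimately show ?thesis by (simp only: abs_mult abs_divide) simp
qed

lemma ln2_lipschitz1:
  assumes "c \<ge> 1"
  shows "\<bar>ln2 c x - ln2 c y\<bar> \<le> 16 * \<bar>x - y\<bar>"
proof -
  define d where "d = (\<lambda>t. (4 * t ^ 3 - 12 * c * t) / (c + t\<^sup>2) ^ 3)"
  have pos: "c + t\<^sup>2 \<ge> 1" for t using assms by (simp add: add_increasing2)
  have "(ln2 c has_field_derivative d t) (at t)" for t
  proof -
    have ne: "c + t\<^sup>2 \<noteq> 0" using pos[of t] by linarith
    have "((\<lambda>x. 2 * (c - x\<^sup>2) / (c + x\<^sup>2)\<^sup>2) has_field_derivative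
      (2 * (0 - 2 * t) * (c + t\<^sup>2)\<^sup>2 - 2 * (c - t\<^sup>2) * (2 * (c + t\<^sup>2) * (2 * t))) /
        ((c + t\<^sup>2)\<^sup>2 * (c + t\<^sup>2)\<^sup>2)) (at t)"
      using ne by (auto intro!: derivative_eq_intros)
    also have "(2 * (0 - 2 * t) * (c + t\<^sup>2)\<^sup>2 - 2 * (c - t\<^sup>2) * (2 * (c + t\<^sup>2) * (2 * t))) /
        ((c + t\<^sup>2)\<^sup>2 * (c + t\<^sup>2)\<^sup>2) = d t"
      unfolding d_def using ne by (simp add: divide_simps) algebra
    finally show ?thesis unfolding ln2_def .
  qed
  moreover have "\<bar>d t\<bar> \<le> 16" for t
  proof -
    have p: "c + t\<^sup>2 \<ge> 1" by (rule pos)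
    have t1: "\<bar>t\<bar> \<le> c + t\<^sup>2"
    proof (cases "\<bar>t\<bar> \<le> 1")
      case False
      then have "\<bar>t\<bar> * 1 \<le> \<bar>t\<bar> * \<bar>t\<bar>" by (intro mult_left_mono) auto
      then show ?thesis using assms by (simp add: power2_eq_square)
    qed (use p in simp)
    have "\<bar>4 * t ^ 3 - 12 * c * t\<bar> = \<bar>t\<bar> * \<bar>4 * t\<^sup>2 - 12 * c\<bar>"
      unfolding abs_mult[symmetric] by (simp add: algebra_simps power2_eq_square power3_eq_cube)
    also have "\<bar>4 * t\<^sup>2 - 12 * c\<bar> \<le> 16 * (c + t\<^sup>2)" using assms by (simp add: abs_le_iff)
    also have "\<bar>t\<bar> * (16 * (c + t\<^sup>2)) \<le> (c + t\<^sup>2) * (16 * (c + t\<^sup>2))"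
      using t1 p by (intro mult_right_mono) auto
    also have "\<dots> \<le> 16 * (c + t\<^sup>2) ^ 3"
    proof -
      have "q * (16 * q) \<le> 16 * q ^ 3" if "q \<ge> 1" for q :: real
        using that mult_left_mono[of 1 q "q * q"] by (simp add: power3_eq_cube)
      then show ?thesis using p by blast
    qed
    finally have "\<bar>4 * t ^ 3 - 12 * c * t\<bar> \<le> 16 * (c + t\<^sup>2) ^ 3"
      by (simp add: mult_left_mono)
    then show ?thesis using p by (simp add: d_def divide_le_eq)
  qed
  ultimately have "norm (ln2 c y - ln2 c x) \<le> 16 * norm (y - x)"
    by (intro field_differentiable_bound[of UNIV "ln2 c" d]) (auto intro: DERIV_subset)
  then show ?thesis by (simp add: abs_minus_commute)
qed

text \<open>\<open>ln2 (1 + x\<^sup>2) u\<close> is the second derivative of ln (1 + x^2 + u^2) in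
  \<open>u\<close>; this is its variation when the other coordinate moves. With
  \<open>ln2_lipschitz1\<close> it controls the second derivatives of the potential along every unit
  step.\<close>

lemma ln2_lipschitz2:
  "\<bar>ln2 (1 + x\<^sup>2) u - ln2 (1 + y\<^sup>2) u\<bar> \<le> 16 * \<bar>x - y\<bar>"
proof -
  define d where "d = (\<lambda>t. 4 * t * (3 * u\<^sup>2 - (1 + t\<^sup>2)) / (1 + t\<^sup>2 + u\<^sup>2) ^ 3)"
  have pos: "1 + t\<^sup>2 + u\<^sup>2 \<ge> 1" for t by simp
  have "((\<lambda>x. ln2 (1 + x\<^sup>2) u) has_field_derivative d t) (at t)" for t
  proof -
    have ne: "1 + t\<^sup>2 + u\<^sup>2 \<noteq> 0" using pos[of t] by linarith
    have "((\<lambda>x. 2 * (1 + x\<^sup>2 - u\<^sup>2) / (1 + x\<^sup>2 + u\<^sup>2)\<^sup>2) has_field_derivative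
      (2 * (2 * t) * (1 + t\<^sup>2 + u\<^sup>2)\<^sup>2 - 2 * (1 + t\<^sup>2 - u\<^sup>2) * (2 * (1 + t\<^sup>2 + u\<^sup>2) * (2 * t))) /
        ((1 + t\<^sup>2 + u\<^sup>2)\<^sup>2 * (1 + t\<^sup>2 + u\<^sup>2)\<^sup>2)) (at t)"
      using ne by (auto intro!: derivative_eq_intros)
    also have "(2 * (2 * t) * (1 + t\<^sup>2 + u\<^sup>2)\<^sup>2 - 2 * (1 + t\<^sup>2 - u\<^sup>2) * (2 * (1 + t\<^sup>2 + u\<^sup>2) * (2 * t))) /
        ((1 + t\<^sup>2 + u\<^sup>2)\<^sup>2 * (1 + t\<^sup>2 + u\<^sup>2)\<^sup>2) = d t"
      unfolding d_def using ne by (simp add: divide_simps) algebra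
    finally show ?thesis unfolding ln2_def .
  qed
  moreover have "\<bar>d t\<bar> \<le> 16" for t
  proof -
    define q where "q = 1 + t\<^sup>2 + u\<^sup>2"
    have p: "q \<ge> 1" unfolding q_def by (rule pos)
    have t1: "\<bar>t\<bar> \<le> q"
    proof (cases "\<bar>t\<bar> \<le> 1")
      case False
      then have "\<bar>t\<bar> * 1 \<le> \<bar>t\<bar> * \<bar>t\<bar>" by (intro mult_left_mono) auto
      then show ?thesis using zero_le_square[of u] unfolding q_def power2_eq_square by linarith
    qed (use p in simp)
    have "\<bar>4 * t * (3 * u\<^sup>2 - (1 + t\<^sup>2))\<bar> = \<bar>t\<bar> * (4 * \<bar>3 * u\<^sup>2 - (1 + t\<^sup>2)\<bar>)"
      by (simp add: abs_mult)
    also have "4 * \<bar>3 * u\<^sup>2 - (1 + t\<^sup>2)\<bar> \<le> 16 * q"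
      using zero_le_power2[of u] zero_le_power2[of t] unfolding q_def by (simp add: abs_if)
    also have "\<bar>t\<bar> * (16 * q) \<le> q * (16 * q)"
      using t1 p by (intro mult_right_mono) auto
    also have "\<dots> \<le> 16 * q ^ 3"
      using p mult_left_mono[of 1 "q" "q * q"] by (simp add: power3_eq_cube)
    finally have "\<bar>4 * t * (3 * u\<^sup>2 - (1 + t\<^sup>2))\<bar> \<le> 16 * q ^ 3"
      by (simp add: mult_left_mono)
    then show ?thesis using p by (simp add: d_def pos_divide_le_eq flip: q_def)
  qed
  ultimately have "norm (ln2 (1 + y\<^sup>2) u - ln2 (1 + x\<^sup>2) u) \<le> 16 * norm (y - x)"
    by (intro field_differentiable_bound[of UNIV _ d]) (auto intro: DERIV_subset)
  then show ?thesis by (simp add: abs_minus_commute)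
qed

text \<open>Second order Taylor expansions on both sides: the first order terms cancel, and
  replacing \<open>ln2\<close> at the two intermediate points by its value at \<open>x\<close> costs
  16 h each, in all h^2 / 2 times 32 h.\<close>

lemma ln_second_difference:
  assumes c: "c \<ge> 1" and h: "h > 0"
  shows "\<bar>ln (c + (x + h)\<^sup>2) + ln (c + (x - h)\<^sup>2) - 2 * ln (c + x\<^sup>2) - h\<^sup>2 * ln2 c x\<bar> \<le> 16 * h ^ 3"
proof -
  define D :: "nat \<Rightarrow> real \<Rightarrow> real" where
    "D = (\<lambda>m. if m = 0 then (\<lambda>x. ln (c + x\<^sup>2)) else if m = 1 then (\<lambda>x. 2 * x / (c + x\<^sup>2)) else ln2 c)"
  have pos: "c + t\<^sup>2 > 0" for t using c by (simp add: add_pos_nonneg)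
  have der: "\<forall>m t. m < 2 \<and> x - h \<le> t \<and> t \<le> x + h \<longrightarrow> DERIV (D m) t :> D (Suc m) t"
  proof (intro allI impI)
    fix m :: nat and t assume "m < 2 \<and> x - h \<le> t \<and> t \<le> x + h"
    then consider "m = 0" | "m = 1" by linarith
    then show "DERIV (D m) t :> D (Suc m) t"
    proof cases
      case 1
      have "((\<lambda>x. ln (c + x\<^sup>2)) has_field_derivative 2 * t / (c + t\<^sup>2)) (at t)"
        using pos[of t] by (auto intro!: derivative_eq_intros)
      then show ?thesis using 1 by (simp add: D_def)
    next
      case 2
      have ne: "c + t\<^sup>2 \<noteq> 0" using pos[of t] by linarith
      have "((\<lambda>x. 2 * x / (c + x\<^sup>2)) has_field_derivative
        (2 * (c + t\<^sup>2) - 2 * t * (2 * t)) / ((c + t\<^sup>2) * (c + t\<^sup>2))) (at t)"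
        using ne by (auto intro!: derivative_eq_intros)
      also have "(2 * (c + t\<^sup>2) - 2 * t * (2 * t)) / ((c + t\<^sup>2) * (c + t\<^sup>2)) = ln2 c t"
        unfolding ln2_def by (simp add: power2_eq_square algebra_simps)
      finally show ?thesis using 2 by (simp add: D_def)
    qed
  qed
  have "\<exists>t>x. t < x + h \<and> D 0 (x + h) =
      (\<Sum>m<2. (D m x / fact m) * (x + h - x) ^ m) + (D 2 t / fact 2) * (x + h - x)\<^sup>2"
    by (rule Taylor_up) (use der h in auto)
  then obtain s where s: "x < s" "s < x + h"
    "D 0 (x + h) = D 0 x + D 1 x * h + ln2 c s / 2 * h\<^sup>2"
    by (auto simp: eval_nat_numeral D_def)
  have "\<exists>t>x - h. t < x \<and> D 0 (x - h) =
      (\<Sum>m<2. (D m x / fact m) * (x - h - x) ^ m) + (D 2 t / fact 2) * (x - h - x)\<^sup>2"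
    by (rule Taylor_down) (use der h in auto)
  then obtain t where t: "x - h < t" "t < x"
    "D 0 (x - h) = D 0 x - D 1 x * h + ln2 c t / 2 * h\<^sup>2"
    by (auto simp: eval_nat_numeral D_def)
  have "ln (c + (x + h)\<^sup>2) + ln (c + (x - h)\<^sup>2) - 2 * ln (c + x\<^sup>2) - h\<^sup>2 * ln2 c x
     = h\<^sup>2 / 2 * ((ln2 c s - ln2 c x) + (ln2 c t - ln2 c x))"
    using s(3) t(3) by (simp add: D_def field_simps)
  also have "\<bar>\<dots>\<bar> = h\<^sup>2 / 2 * \<bar>(ln2 c s - ln2 c x) + (ln2 c t - ln2 c x)\<bar>"
    by (simp add: abs_mult)
  also have "\<dots> \<le> h\<^sup>2 / 2 * (16 * h + 16 * h)"
  proof (rule mult_left_mono)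
    have "\<bar>ln2 c s - ln2 c x\<bar> \<le> 16 * h" "\<bar>ln2 c t - ln2 c x\<bar> \<le> 16 * h"
      using ln2_lipschitz1[OF c, of s x] ln2_lipschitz1[OF c, of t x] s(1,2) t(1,2) by simp_all
    then show "\<bar>(ln2 c s - ln2 c x) + (ln2 c t - ln2 c x)\<bar> \<le> 16 * h + 16 * h" by linarith
  qed simp
  finally show ?thesis by (simp add: power2_eq_square power3_eq_cube)
qed

section \<open>Occupation of the neighbourhood of the starting point\<close>

definition unit_steps :: "site set" where
  "unit_steps = {(1, 0), (- 1, 0), (0, 1), (0, - 1)}"

lemma run_lipschitz:
  fixes h :: "site \<Rightarrow> real"
  assumes "\<And>z e. e \<in> unit_steps \<Longrightarrow> \<bar>h (z + e) - h z\<bar> \<le> L"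
  shows "\<bar>h (snd (run s w)) - h (snd s)\<bar> \<le> L * length w"
proof (induction w rule: rev_induct)
  case (snoc b w)
  have "\<bar>h (snd (run s (w @ [b]))) - h (snd (run s w))\<bar> \<le> L"
    using assms by (auto simp: step_def sgn_of_def unit_steps_def)
  then show ?case using snoc by (simp add: algebra_simps abs_le_iff)
qed simp

text \<open>\<open>\<Gamma>\<close> is frozen at the start of the block; its movement costs at most
  \<open>L * b\<close> at each of \<open>b\<close> times. What remains is \<open>\<Gamma>\<close>
  times the discrepancy of the count. Because the deficit
  \<open>(\<phi> + \<delta>) * b - occ new b s\<close> is nonnegative, the absolute discrepancy is
  at most the deficit plus \<open>\<delta> * b\<close>. The resulting bound is affine in the count,
  hence additive over blocks.\<close>

lemma occ_block:
  assumes \<Gamma>: "\<And>z. \<bar>\<Gamma> z\<bar> \<le> K"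
    and lip: "\<And>z e. e \<in> unit_steps \<Longrightarrow> \<bar>\<Gamma> (z + e) - \<Gamma> z\<bar> \<le> L"
    and \<phi>: "0 \<le> \<phi>" "\<phi> \<le> 1" and \<delta>: "0 \<le> \<delta>"
    and b: "occ new b s \<le> (\<phi> + \<delta>) * b"
  shows "\<bar>occ (\<lambda>s. (new s - \<phi>) * \<Gamma> (snd s)) b s\<bar>
    \<le> K * ((\<phi> + \<delta>) * b - occ new b s + \<delta> * b) + L * (real b)\<^sup>2"
proof -
  have K: "K \<ge> 0" using \<Gamma>[of 0] by linarith
  have L: "L \<ge> 0" using lip[of "(1, 0)" 0] by (simp add: unit_steps_def)
  define d where "d = (\<lambda>s'. (new s' - \<phi>) * (\<Gamma> (snd s') - \<Gamma> (snd s)))"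
  have "occ (\<lambda>s. (new s - \<phi>) * \<Gamma> (snd s)) b s = occ (\<lambda>s'. \<Gamma> (snd s) * (new s' - \<phi>) + d s') b s"
    by (simp add: d_def algebra_simps)
  also have "\<dots> = \<Gamma> (snd s) * (occ new b s - \<phi> * b) + occ d b s"
    by (simp add: occ_lin)
  finally have eq: "occ (\<lambda>s. (new s - \<phi>) * \<Gamma> (snd s)) b s = \<dots>" .
  have "\<bar>occ d b s\<bar> \<le> L * (real b)\<^sup>2"
  proof -
    have "\<bar>trans_op k d s\<bar> \<le> L * b" if "k < b" for k
    proof -
      have "\<bar>trans_op k d s\<bar> \<le> coin k (\<lambda>w. \<bar>d (run s w)\<bar>)"
        unfolding trans_op_def by (rule coin_abs)
      also have "\<dots> \<le> coin k (\<lambda>w. L * b)"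
      proof (rule coin_mono)
        fix w :: "bool list" assume w: "length w = k"
        have "\<bar>\<Gamma> (snd (run s w)) - \<Gamma> (snd s)\<bar> \<le> L * length w"
          by (rule run_lipschitz[where h = \<Gamma>]) (rule lip)
        also have "\<dots> \<le> L * b" using w that L by (intro mult_left_mono) auto
        finally have g: "\<bar>\<Gamma> (snd (run s w)) - \<Gamma> (snd s)\<bar> \<le> L * b" .
        have "\<bar>new (run s w) - \<phi>\<bar> \<le> 1" using new_bounds[of "run s w"] \<phi> by linarith
        then have "\<bar>d (run s w)\<bar> \<le> 1 * (L * b)"
          unfolding d_def abs_mult by (intro mult_mono g) auto
        then show "\<bar>d (run s w)\<bar> \<le> L * b" by simp
      qed
      finally show ?thesis by simp
    qed
    then have "(\<Sum>k<b. \<bar>trans_op k d s\<bar>) \<le> (\<Sum>k<b. L * b)" by (intro sum_mono) simp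
    then show ?thesis
      unfolding occ_def by (intro order_trans[OF sum_abs]) (simp add: power2_eq_square algebra_simps)
  qed
  moreover have "\<bar>\<Gamma> (snd s) * (occ new b s - \<phi> * b)\<bar>
      \<le> K * ((\<phi> + \<delta>) * b - occ new b s + \<delta> * b)"
  proof -
    have "0 \<le> \<delta> * b" using \<delta> by simp
    then have "\<bar>occ new b s - \<phi> * b\<bar> \<le> (\<phi> + \<delta>) * b - occ new b s + \<delta> * b"
      using b by (simp add: abs_le_iff algebra_simps)
    then show ?thesis unfolding abs_mult using K by (intro mult_mono \<Gamma>) auto
  qed
  ultimately show ?thesis unfolding eq by linarith
qed

text \<open>The bound for one block is affine in \<open>occ new\<close>, so its averages over the
  states reached recombine, by the Markov property, into the deficit of the whole stretch.\<close>

lemma occ_blocks: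
  assumes \<Gamma>: "\<And>z. \<bar>\<Gamma> z\<bar> \<le> K"
    and lip: "\<And>z e. e \<in> unit_steps \<Longrightarrow> \<bar>\<Gamma> (z + e) - \<Gamma> z\<bar> \<le> L"
    and \<phi>: "0 \<le> \<phi>" "\<phi> \<le> 1" and \<delta>: "0 \<le> \<delta>"
    and b: "new_max b \<le> (\<phi> + \<delta>) * b"
  shows "\<bar>occ (\<lambda>s. (new s - \<phi>) * \<Gamma> (snd s)) (q * b) s\<bar>
    \<le> K * ((\<phi> + \<delta>) * real (q * b) - occ new (q * b) s + \<delta> * real (q * b)) + L * (q * (real b)\<^sup>2)"
proof (induction q arbitrary: s)
  case 0
  then show ?case by (simp add: occ_def)
next
  case (Suc q)
  define g where "g = (\<lambda>s. (new s - \<phi>) * \<Gamma> (snd s))"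
  have 1: "\<bar>occ g b s\<bar> \<le> K * ((\<phi> + \<delta>) * b - occ new b s + \<delta> * b) + L * (real b)\<^sup>2"
    unfolding g_def using occ_new_le_new_max[of b s] b by (intro occ_block \<Gamma> lip \<phi> \<delta>) auto
  have 2: "\<bar>trans_op b (occ g (q * b)) s\<bar> \<le>
    K * ((\<phi> + \<delta>) * real (q * b) - trans_op b (occ new (q * b)) s + \<delta> * real (q * b)) + L * (q * (real b)\<^sup>2)"
  proof -
    have "\<bar>trans_op b (occ g (q * b)) s\<bar> \<le> trans_op b (\<lambda>s. \<bar>occ g (q * b) s\<bar>) s"
      by (rule trans_op_abs)
    also have "\<dots> \<le> trans_op b (\<lambda>s. K * ((\<phi> + \<delta>) * real (q * b) - occ new (q * b) s + \<delta> * real (q * b))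
        + L * (q * (real b)\<^sup>2)) s"
      unfolding g_def by (intro trans_op_mono Suc.IH)
    finally show ?thesis by (simp add: trans_op_lin)
  qed
  have s: "occ f (Suc q * b) s = occ f b s + trans_op b (occ f (q * b)) s" for f
    using occ_add[of f b "q * b" s] by simp
  have "\<bar>occ g (Suc q * b) s\<bar> \<le> \<bar>occ g b s\<bar> + \<bar>trans_op b (occ g (q * b)) s\<bar>"
    unfolding s by (rule abs_triangle_ineq)
  also have "\<dots> \<le> K * ((\<phi> + \<delta>) * real (Suc q * b) - occ new (Suc q * b) s + \<delta> * real (Suc q * b))
    + L * (Suc q * (real b)\<^sup>2)"
    using add_mono[OF 1 2] unfolding s by (simp add: algebra_simps)
  finally show ?case unfolding g_def .
qed

text \<open>
  A walk that makes vertical steps at rate \<open>\<phi>\<close> has covariance matrix \<open>diag(1 - \<phi>, \<phi>)\<close>; these are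
  the coordinates, at scale \<open>\<rho>\<close>, in which it is isotropic.
\<close>

definition xc :: "real \<Rightarrow> real \<Rightarrow> site \<Rightarrow> site \<Rightarrow> real" where
  "xc \<phi> \<rho> c z = real_of_int (fst z - fst c) / (sqrt (1 - \<phi>) * \<rho>)"

definition yc :: "real \<Rightarrow> real \<Rightarrow> site \<Rightarrow> site \<Rightarrow> real" where
  "yc \<phi> \<rho> c z = real_of_int (snd z - snd c) / (sqrt \<phi> * \<rho>)"

definition potential :: "real \<Rightarrow> real \<Rightarrow> site \<Rightarrow> site \<Rightarrow> real" where
  "potential \<phi> \<rho> c z = ln (1 + (xc \<phi> \<rho> c z)\<^sup>2 + (yc \<phi> \<rho> c z)\<^sup>2)"

text \<open>Half the Laplacian of \<open>potential\<close> in the rescaled coordinates. It is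
  positive and decays like the inverse fourth power of the distance.\<close>

definition bump :: "real \<Rightarrow> real \<Rightarrow> site \<Rightarrow> site \<Rightarrow> real" where
  "bump \<phi> \<rho> c z = 2 / (1 + (xc \<phi> \<rho> c z)\<^sup>2 + (yc \<phi> \<rho> c z)\<^sup>2)\<^sup>2"

text \<open>Half the difference between the second derivatives of \<open>potential\<close> along
  vertical and horizontal unit steps. It multiplies \<open>new s - \<phi>\<close> in the generator
  and so carries the effect of an uneven rate of new sites.\<close>

definition anisotropy :: "real \<Rightarrow> real \<Rightarrow> site \<Rightarrow> site \<Rightarrow> real" where
  "anisotropy \<phi> \<rho> c z =
    (ln2 (1 + (xc \<phi> \<rho> c z)\<^sup>2) (yc \<phi> \<rho> c z) / \<phi> - ln2 (1 + (yc \<phi> \<rho> c z)\<^sup>2) (xc \<phi> \<rho> c z) / (1 - \<phi>)) / (2 * \<rho>\<^sup>2)"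

definition ellipticity :: "real \<Rightarrow> real" where
  "ellipticity \<phi> = 1 / sqrt (1 - \<phi>) + 1 / sqrt \<phi>"

context
  fixes \<phi> \<rho> :: real
  assumes \<phi>: "0 < \<phi>" "\<phi> < 1" and \<rho>: "0 < \<rho>"
begin

private abbreviation "\<kappa> \<equiv> ellipticity \<phi>"

lemma ellipticity_ge: "1 / sqrt (1 - \<phi>) \<le> \<kappa>" "1 / sqrt \<phi> \<le> \<kappa>" "1 / (1 - \<phi>) \<le> \<kappa>\<^sup>2" "1 / \<phi> \<le> \<kappa>\<^sup>2" "0 < \<kappa>"
proof -
  show 1: "1 / sqrt (1 - \<phi>) \<le> \<kappa>" "1 / sqrt \<phi> \<le> \<kappa>" using \<phi> by (auto simp: ellipticity_def)
  have "(1 / sqrt (1 - \<phi>))\<^sup>2 \<le> \<kappa>\<^sup>2" "(1 / sqrt \<phi>)\<^sup>2 \<le> \<kappa>\<^sup>2"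
    using \<phi> by (intro power_mono 1; simp)+
  then show "1 / (1 - \<phi>) \<le> \<kappa>\<^sup>2" "1 / \<phi> \<le> \<kappa>\<^sup>2" using \<phi> by (simp_all add: power_divide)
  show "0 < \<kappa>" using \<phi> by (auto simp: ellipticity_def intro!: add_pos_pos)
qed

lemma xc_shift:
  "xc \<phi> \<rho> c (z + e) = xc \<phi> \<rho> c z + real_of_int (fst e) / (sqrt (1 - \<phi>) * \<rho>)"
  "yc \<phi> \<rho> c (z + e) = yc \<phi> \<rho> c z + real_of_int (snd e) / (sqrt \<phi> * \<rho>)"
  by (simp_all add: xc_def yc_def add_divide_distrib[symmetric])

lemma step_size:
  "1 / (sqrt (1 - \<phi>) * \<rho>) \<le> \<kappa> / \<rho>" "1 / (sqrt \<phi> * \<rho>) \<le> \<kappa> / \<rho>"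
  using ellipticity_ge(1,2) \<rho> divide_right_mono[of "1 / sqrt (1 - \<phi>)" \<kappa> \<rho>]
    divide_right_mono[of "1 / sqrt \<phi>" \<kappa> \<rho>] by simp_all

lemma anisotropy_bound: "\<bar>anisotropy \<phi> \<rho> c z\<bar> \<le> 2 * \<kappa>\<^sup>2 / \<rho>\<^sup>2"
proof -
  define u where "u = ln2 (1 + (xc \<phi> \<rho> c z)\<^sup>2) (yc \<phi> \<rho> c z)"
  define v where "v = ln2 (1 + (yc \<phi> \<rho> c z)\<^sup>2) (xc \<phi> \<rho> c z)"
  have uv: "\<bar>u\<bar> \<le> 2" "\<bar>v\<bar> \<le> 2" unfolding u_def v_def by (intro ln2_bound; simp)+
  have "\<bar>u / \<phi>\<bar> \<le> 2 * \<kappa>\<^sup>2"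
    using mult_mono[OF uv(1) ellipticity_ge(4)] \<phi> by (simp add: abs_mult)
  moreover have "\<bar>v / (1 - \<phi>)\<bar> \<le> 2 * \<kappa>\<^sup>2"
    using mult_mono[OF uv(2) ellipticity_ge(3)] \<phi> by (simp add: abs_mult)
  ultimately have "\<bar>u / \<phi> - v / (1 - \<phi>)\<bar> \<le> 4 * \<kappa>\<^sup>2" by linarith
  then have "\<bar>u / \<phi> - v / (1 - \<phi>)\<bar> / (2 * \<rho>\<^sup>2) \<le> 4 * \<kappa>\<^sup>2 / (2 * \<rho>\<^sup>2)"
    by (rule divide_right_mono) simp
  then show ?thesis unfolding anisotropy_def u_def[symmetric] v_def[symmetric]
    by simp
qed

lemma anisotropy_lipschitz:
  assumes e: "e \<in> unit_steps"
  shows "\<bar>anisotropy \<phi> \<rho> c (z + e) - anisotropy \<phi> \<rho> c z\<bar> \<le> 16 * \<kappa> ^ 3 / \<rho> ^ 3"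
proof -
  define x y x' y' where xy: "x = xc \<phi> \<rho> c z" "y = yc \<phi> \<rho> c z" "x' = xc \<phi> \<rho> c (z + e)" "y' = yc \<phi> \<rho> c (z + e)"
  have *: "\<bar>x' - x\<bar> + \<bar>y' - y\<bar> \<le> \<kappa> / \<rho>"
    using e step_size \<rho> \<phi> unfolding xy xc_shift unit_steps_def by auto
  have lip: "\<bar>ln2 (1 + x'\<^sup>2) y' - ln2 (1 + x\<^sup>2) y\<bar> \<le> 16 * (\<bar>x' - x\<bar> + \<bar>y' - y\<bar>)" for x y x' y'
    using ln2_lipschitz1[of "1 + x'\<^sup>2" y' y] ln2_lipschitz2[of x' y x] by simp
  have 1: "\<bar>ln2 (1 + x'\<^sup>2) y' - ln2 (1 + x\<^sup>2) y\<bar> \<le> 16 * (\<kappa> / \<rho>)" (is "\<bar>?u\<bar> \<le> _")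
    "\<bar>ln2 (1 + y'\<^sup>2) x' - ln2 (1 + y\<^sup>2) x\<bar> \<le> 16 * (\<kappa> / \<rho>)" (is "\<bar>?v\<bar> \<le> _")
    using order_trans[OF lip[of x' y' x y], of "16 * (\<kappa> / \<rho>)"]
      order_trans[OF lip[of y' x' y x], of "16 * (\<kappa> / \<rho>)"] * by simp_all
  have k: "0 \<le> \<kappa> / \<rho>" using ellipticity_ge(5) \<rho> by simp
  have "\<bar>?u / \<phi>\<bar> \<le> 16 * (\<kappa> / \<rho>) * \<kappa>\<^sup>2"
    using mult_mono[OF 1(1) ellipticity_ge(4)] k \<phi> by (simp add: abs_mult)
  moreover have "\<bar>?v / (1 - \<phi>)\<bar> \<le> 16 * (\<kappa> / \<rho>) * \<kappa>\<^sup>2"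
    using mult_mono[OF 1(2) ellipticity_ge(3)] k \<phi> by (simp add: abs_mult)
  ultimately have "\<bar>?u / \<phi> - ?v / (1 - \<phi>)\<bar> \<le> 32 * (\<kappa> / \<rho>) * \<kappa>\<^sup>2" by linarith
  then have "\<bar>?u / \<phi> - ?v / (1 - \<phi>)\<bar> / (2 * \<rho>\<^sup>2) \<le> 32 * (\<kappa> / \<rho>) * \<kappa>\<^sup>2 / (2 * \<rho>\<^sup>2)"
    by (rule divide_right_mono) simp
  also have "32 * (\<kappa> / \<rho>) * \<kappa>\<^sup>2 / (2 * \<rho>\<^sup>2) = 16 * \<kappa> ^ 3 / \<rho> ^ 3"
    by (simp add: power2_eq_square power3_eq_cube)
  also have "\<bar>?u / \<phi> - ?v / (1 - \<phi>)\<bar> / (2 * \<rho>\<^sup>2) = \<bar>(?u / \<phi> - ?v / (1 - \<phi>)) / (2 * \<rho>\<^sup>2)\<bar>"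
    by simp
  also have "(?u / \<phi> - ?v / (1 - \<phi>)) / (2 * \<rho>\<^sup>2) = anisotropy \<phi> \<rho> c (z + e) - anisotropy \<phi> \<rho> c z"
    unfolding anisotropy_def xy[symmetric] diff_divide_distrib by simp
  finally show ?thesis .
qed

text \<open>The weight \<open>new s\<close> is split into \<open>\<phi>\<close> and
  \<open>new s - \<phi>\<close>. In the first part the stretching of the coordinates cancels the
  weights and leaves the Laplacian, that is \<open>bump\<close>; the second part is the anisotropy
  term. The remainder is the third order Taylor error for steps of rescaled length at most
  \<open>\<kappa> / \<rho>\<close>.\<close>

lemma gen_potential:
  "gen (\<lambda>s. potential \<phi> \<rho> c (snd s)) s \<le> bump \<phi> \<rho> c (snd s) / \<rho>\<^sup>2
     + (new s - \<phi>) * anisotropy \<phi> \<rho> c (snd s) + 8 * \<kappa> ^ 3 / \<rho> ^ 3"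
proof -
  define x y where xy: "x = xc \<phi> \<rho> c (snd s)" "y = yc \<phi> \<rho> c (snd s)"
  define h k where hk: "h = 1 / (sqrt (1 - \<phi>) * \<rho>)" "k = 1 / (sqrt \<phi> * \<rho>)"
  have hk0: "h > 0" "k > 0" using \<phi> \<rho> by (auto simp: hk)
  have hk2: "h\<^sup>2 = 1 / (1 - \<phi>) / \<rho>\<^sup>2" "k\<^sup>2 = 1 / \<phi> / \<rho>\<^sup>2"
    using \<phi> by (simp_all add: hk power_divide power_mult_distrib)
  have hk3: "h ^ 3 \<le> \<kappa> ^ 3 / \<rho> ^ 3" "k ^ 3 \<le> \<kappa> ^ 3 / \<rho> ^ 3"
    using power_mono[of h "\<kappa> / \<rho>" 3] power_mono[of k "\<kappa> / \<rho>" 3] step_size hk0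
    by (simp_all add: hk power_divide)
  define H V where HV: "H = ln2 (1 + y\<^sup>2) x" "V = ln2 (1 + x\<^sup>2) y"
  define dH dV where d: "dH = hdiff (potential \<phi> \<rho> c) (snd s)" "dV = vdiff (potential \<phi> \<rho> c) (snd s)"
  have "2 * dH = ln (1 + y\<^sup>2 + (x + h)\<^sup>2) + ln (1 + y\<^sup>2 + (x - h)\<^sup>2) - 2 * ln (1 + y\<^sup>2 + x\<^sup>2)"
    unfolding d hdiff_def potential_def xc_shift xy[symmetric] by (simp add: hk algebra_simps)
  then have "dH \<le> h\<^sup>2 * H / 2 + 8 * \<kappa> ^ 3 / \<rho> ^ 3"
    using ln_second_difference[of "1 + y\<^sup>2" h x] hk0 hk3 unfolding HV by (simp add: abs_le_iff)
  moreover have "2 * dV = ln (1 + x\<^sup>2 + (y + k)\<^sup>2) + ln (1 + x\<^sup>2 + (y - k)\<^sup>2) - 2 * ln (1 + x\<^sup>2 + y\<^sup>2)"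
    unfolding d vdiff_def potential_def xc_shift xy[symmetric] by (simp add: hk algebra_simps)
  then have "dV \<le> k\<^sup>2 * V / 2 + 8 * \<kappa> ^ 3 / \<rho> ^ 3"
    using ln_second_difference[of "1 + x\<^sup>2" k y] hk0 hk3 unfolding HV by (simp add: abs_le_iff)
  ultimately have "new s * dV + (1 - new s) * dH \<le>
      new s * (k\<^sup>2 * V / 2) + (1 - new s) * (h\<^sup>2 * H / 2) + 8 * \<kappa> ^ 3 / \<rho> ^ 3"
    by (simp add: new_def)
  also have "new s * (k\<^sup>2 * V / 2) + (1 - new s) * (h\<^sup>2 * H / 2) =
      (V + H) / (2 * \<rho>\<^sup>2) + (new s - \<phi>) * ((V / \<phi> - H / (1 - \<phi>)) / (2 * \<rho>\<^sup>2))"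
    unfolding hk2 using \<phi> \<rho> by (simp add: divide_simps) (simp add: algebra_simps)
  also have "(V / \<phi> - H / (1 - \<phi>)) / (2 * \<rho>\<^sup>2) = anisotropy \<phi> \<rho> c (snd s)"
    unfolding anisotropy_def HV xy ..
  also have "V + H = 2 * bump \<phi> \<rho> c (snd s)"
  proof -
    have "V = 2 * (1 + x\<^sup>2 - y\<^sup>2) / (1 + x\<^sup>2 + y\<^sup>2)\<^sup>2" "H = 2 * (1 + y\<^sup>2 - x\<^sup>2) / (1 + x\<^sup>2 + y\<^sup>2)\<^sup>2"
      by (simp_all add: HV ln2_def add_ac)
    then show ?thesis
      unfolding bump_def xy[symmetric] by (simp add: add_divide_distrib[symmetric])
  qed
  finally show ?thesis
    unfolding gen_position d by simp
qed

lemma sqdist_le_coords: "sqdist c z / \<rho>\<^sup>2 \<le> (xc \<phi> \<rho> c z)\<^sup>2 + (yc \<phi> \<rho> c z)\<^sup>2"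
proof -
  have "a\<^sup>2 / \<rho>\<^sup>2 \<le> (a / (sqrt t * \<rho>))\<^sup>2" if "0 < t" "t < 1" for a t
  proof -
    have "a\<^sup>2 * t \<le> a\<^sup>2 * 1" using that by (intro mult_left_mono) auto
    then show ?thesis using that \<rho> by (simp add: power_divide power_mult_distrib field_simps)
  qed
  from this[of "1 - \<phi>"] this[of \<phi>] \<phi> show ?thesis
    unfolding sqdist_def xc_def yc_def by (simp add: add_divide_distrib add_mono)
qed

text \<open>The potential vanishes at its centre, so its mean at time \<open>m\<close>, which is at
  least logarithmic in \<open>m / \<rho>\<^sup>2\<close>, equals the summed generator. There the
  anisotropy term is controlled by the deficits of the blocks. Hence the bump is occupied for
  logarithmically long unless the start has a large deficit. The factor 24 is 16 from freezing the
  anisotropy plus 8 from the Taylor error.\<close>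

theorem occ_bump_ge:
  assumes "b \<ge> 1" "q \<ge> 1" and \<delta>: "0 \<le> \<delta>" and b: "new_max b \<le> (\<phi> + \<delta>) * b"
  defines "m \<equiv> q * b"
  shows "ln (1 + m / \<rho>\<^sup>2) / 4 \<le> occ (\<lambda>s'. bump \<phi> \<rho> (snd s) (snd s')) m s / \<rho>\<^sup>2
    + 2 * \<kappa>\<^sup>2 / \<rho>\<^sup>2 * ((\<phi> + \<delta>) * m - occ new m s + \<delta> * m) + 24 * \<kappa> ^ 3 / \<rho> ^ 3 * (b * m)"
proof -
  define c where "c = snd s"
  have m: "m \<ge> 1" using assms by (simp add: m_def)
  have "ln (1 + m / \<rho>\<^sup>2) / 4 \<le> trans_op m (\<lambda>s'. ln (1 + sqdist c (snd s') / \<rho>\<^sup>2)) s"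
    unfolding c_def using \<rho> m by (intro trans_op_ln_sqdist) auto
  also have "\<dots> \<le> trans_op m (\<lambda>s'. potential \<phi> \<rho> c (snd s')) s"
  proof (rule trans_op_mono)
    fix s' :: "state"
    have "0 \<le> sqdist c (snd s') / \<rho>\<^sup>2" by (simp add: sqdist_nonneg)
    then show "ln (1 + sqdist c (snd s') / \<rho>\<^sup>2) \<le> potential \<phi> \<rho> c (snd s')"
      unfolding potential_def using sqdist_le_coords[of c "snd s'"]
      by (subst ln_le_cancel_iff) (auto intro: add_pos_nonneg)
  qed
  also have "\<dots> = occ (gen (\<lambda>s. potential \<phi> \<rho> c (snd s))) m s"
    by (subst occ_dynkin) (simp add: c_def potential_def xc_def yc_def)
  also have "\<dots> \<le> occ (\<lambda>s'. bump \<phi> \<rho> c (snd s') / \<rho>\<^sup>2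
      + (new s' - \<phi>) * anisotropy \<phi> \<rho> c (snd s') + 8 * \<kappa> ^ 3 / \<rho> ^ 3) m s"
    by (rule occ_mono) (rule gen_potential)
  also have "\<dots> = occ (\<lambda>s'. bump \<phi> \<rho> c (snd s')) m s / \<rho>\<^sup>2
      + occ (\<lambda>s'. (new s' - \<phi>) * anisotropy \<phi> \<rho> c (snd s')) m s + 8 * \<kappa> ^ 3 / \<rho> ^ 3 * m"
    using occ_lin(3)[of "1 / \<rho>\<^sup>2" "\<lambda>s'. bump \<phi> \<rho> c (snd s')" m s] by (simp add: occ_lin)
  also have "occ (\<lambda>s'. (new s' - \<phi>) * anisotropy \<phi> \<rho> c (snd s')) m s \<le>
      2 * \<kappa>\<^sup>2 / \<rho>\<^sup>2 * ((\<phi> + \<delta>) * real (q * b) - occ new (q * b) s + \<delta> * real (q * b))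
      + 16 * \<kappa> ^ 3 / \<rho> ^ 3 * (q * (real b)\<^sup>2)"
    unfolding m_def using \<phi> \<delta> b
    by (intro order_trans[OF abs_ge_self occ_blocks] anisotropy_bound anisotropy_lipschitz) auto
  also have "real (q * b) = m" by (simp add: m_def)
  also have "q * (real b)\<^sup>2 = b * m" by (simp add: m_def power2_eq_square)
  also have "8 * \<kappa> ^ 3 / \<rho> ^ 3 * m \<le> 8 * \<kappa> ^ 3 / \<rho> ^ 3 * (b * m)"
    using mult_right_mono[of 1 "real b" "real m"] assms(1) ellipticity_ge(5) \<rho>
    by (intro mult_left_mono) auto
  finally show ?thesis unfolding c_def m_def by (simp add: algebra_simps)
qed

end

section \<open>Counting new sites by visited cells\<close>

lemma bij_betw_first_occurrences:
  "bij_betw f {i. i < J \<and> f i \<notin> f ` {..<i}} (f ` {..<J::nat})"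
proof (rule bij_betw_imageI)
  show "inj_on f {i. i < J \<and> f i \<notin> f ` {..<i}}"
  proof (rule inj_onI)
    fix i j assume ij: "i \<in> {i. i < J \<and> f i \<notin> f ` {..<i}}" "j \<in> {i. i < J \<and> f i \<notin> f ` {..<i}}" "f i = f j"
    have "\<not> i < j" using ij(2,3) by (metis (no_types, lifting) imageI lessThan_iff mem_Collect_eq)
    moreover have "\<not> j < i" using ij(1,3) by (metis (no_types, lifting) imageI lessThan_iff mem_Collect_eq)
    ultimately show "i = j" by simp
  qed
  show "f ` {i. i < J \<and> f i \<notin> f ` {..<i}} = f ` {..<J}"
  proof safe
    fix i assume "i < J"
    define j where "j = (LEAST j. f j = f i)"
    have "f j = f i" unfolding j_def by (rule LeastI) simp
    moreover have "j \<le> i" unfolding j_def by (rule Least_le) simp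
    moreover have "f k \<noteq> f j" if "k < j" for k
      using not_less_Least[OF that[unfolded j_def]] \<open>f j = f i\<close> by metis
    then have "f j \<notin> f ` {..<j}" by (metis imageE lessThan_iff)
    ultimately show "f i \<in> f ` {i. i < J \<and> f i \<notin> f ` {..<i}}"
      using \<open>i < J\<close> by (intro image_eqI[of _ _ j]) auto
  qed auto
qed

lemma run_mono: "fst s \<subseteq> fst (run s w)"
proof (induction w arbitrary: s)
  case (Cons b w)
  have "fst s \<subseteq> fst (step s b)" by (auto simp: step_def)
  then show ?case using Cons[of "step s b"] by auto
qed simp

lemma visited_if_earlier:
  assumes "j < k" "k \<le> length w"
  shows "snd (run s (take j w)) \<in> fst (run s (take k w))"
proof -
  have "take k w = take j w @ w ! j # drop (Suc j) (take k w)"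
    using id_take_nth_drop[of j "take k w"] assms by (simp add: min_absorb1)
  then have "run s (take k w) = run (step (run s (take j w)) (w ! j)) (drop (Suc j) (take k w))"
    by (metis foldl_Cons foldl_append)
  moreover have "snd (run s (take j w)) \<in> fst (step (run s (take j w)) (w ! j))"
    by (simp add: step_def)
  ultimately show ?thesis
    using run_mono[of "step (run s (take j w)) (w ! j)" "drop (Suc j) (take k w)"] by auto
qed

section \<open>Cells of side r and markers at multiples of r^2 steps\<close>

definition cell :: "nat \<Rightarrow> site \<Rightarrow> site" where
  "cell r z = (fst z div int r, snd z div int r)"

text \<open>The walk moves a distance of order \<open>r\<close>, the side of a cell, between
  consecutive markers, so the markers trace out the cells it visits up to a bounded number of
  neighbours.\<close>

definition marker :: "state \<Rightarrow> nat \<Rightarrow> bool list \<Rightarrow> nat \<Rightarrow> site" where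
  "marker s r w i = snd (run s (take (i * r\<^sup>2) w))"

definition marked_cells :: "state \<Rightarrow> nat \<Rightarrow> nat \<Rightarrow> bool list \<Rightarrow> site set" where
  "marked_cells s r J w = (\<lambda>i. cell r (marker s r w i)) ` {..<J}"

definition first_mark :: "state \<Rightarrow> nat \<Rightarrow> bool list \<Rightarrow> nat \<Rightarrow> bool" where
  "first_mark s r w i \<longleftrightarrow> cell r (marker s r w i) \<notin> (\<lambda>i. cell r (marker s r w i)) ` {..<i}"

lemma card_marked_cells:
  "real (card (marked_cells s r J w)) = (\<Sum>i<J. of_bool (first_mark s r w i))"
proof -
  have "card (marked_cells s r J w) = card {i. i < J \<and> first_mark s r w i}"
    unfolding marked_cells_def first_mark_def
    using bij_betw_same_card[OF bij_betw_first_occurrences] by metis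
  also have "{i. i < J \<and> first_mark s r w i} = {..<J} \<inter> {i. first_mark s r w i}" by auto
  finally show ?thesis by (simp add: of_bool_def sum.If_cases)
qed

text \<open>Adaptedness: both quantities are determined by the first \<open>i * r\<^sup>2\<close>
  coins, which permits conditioning at that time.\<close>

lemma first_mark_take:
  assumes "i * r\<^sup>2 \<le> k"
  shows "first_mark s r (take k w) i = first_mark s r w i" "marker s r (take k w) i = marker s r w i"
proof -
  have *: "marker s r (take k w) j = marker s r w j" if "j \<le> i" for j
  proof -
    have "j * r\<^sup>2 \<le> k" using mult_le_mono1[OF that, of "r\<^sup>2"] assms by linarith
    then show ?thesis by (simp add: marker_def min_absorb1)
  qed
  then show "marker s r (take k w) i = marker s r w i" by simp
  have "(\<lambda>i. cell r (marker s r (take k w) i)) ` {..<i} = (\<lambda>i. cell r (marker s r w i)) ` {..<i}"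
    using * by (intro image_cong) auto
  then show "first_mark s r (take k w) i = first_mark s r w i"
    using * by (simp add: first_mark_def)
qed

definition far :: "state \<Rightarrow> nat \<Rightarrow> nat \<Rightarrow> bool list \<Rightarrow> nat \<Rightarrow> bool" where
  "far s r C w k \<longleftrightarrow>
    sqdist (marker s r w (k div r\<^sup>2)) (snd (run s (take k w))) > (real C * r)\<^sup>2"

lemma div_near:
  fixes x y r C :: int
  assumes "r > 0" "\<bar>x - y\<bar> \<le> C * r"
  shows "\<bar>x div r - y div r\<bar> \<le> C"
proof -
  have "x div r \<le> (y + C * r) div r" "y div r \<le> (x + C * r) div r"
    using assms by (intro zdiv_mono1; linarith)+
  then show ?thesis using assms by simp
qed

text \<open>Times spent on new sites have distinct positions. Such a position, if not far from the
  latest marker, lies at most \<open>C\<close> cells from the marker's cell in either coordinate, so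
  one marked cell accounts for at most (2 C + 1)^2 r^2 of them.\<close>

lemma new_sum_le:
  assumes r: "r \<ge> 1" and m: "m = J * r\<^sup>2" and w: "m \<le> length w"
  shows "(\<Sum>k<m. new (run s (take k w))) \<le> (\<Sum>k<m. of_bool (far s r C w k))
    + (2 * real C + 1)\<^sup>2 * r\<^sup>2 * card (marked_cells s r J w)"
proof -
  define Z where "Z = (\<lambda>k. snd (run s (take k w)))"
  define K where "K = {k. k < m \<and> Z k \<notin> fst (run s (take k w))}"
  have fin: "finite K" by (simp add: K_def)
  define N where "N = {k \<in> K. \<not> far s r C w k}"
  have inj: "inj_on Z K"
  proof (rule inj_onI)
    fix j k assume "j \<in> K" "k \<in> K" "Z j = Z k"
    then show "j = k"
      using visited_if_earlier[of j k w s] visited_if_earlier[of k j w s] w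
      by (cases j k rule: linorder_cases) (auto simp: K_def Z_def)
  qed
  \<comment> \<open>Recovers a site from the marker's cell, the offset between cells and the
    residues modulo \<open>r\<close>; the count only needs that the images cover the
    positions.\<close>
  define g :: "site \<times> site \<times> site \<Rightarrow> site" where
    "g = (\<lambda>(c, d, e). ((fst c + fst d) * int r + fst e, (snd c + snd d) * int r + snd e))"
  define S where "S = marked_cells s r J w \<times> ({- int C..int C} \<times> {- int C..int C}) \<times> ({0..<int r} \<times> {0..<int r})"
  have finS: "finite S" by (simp add: S_def marked_cells_def)
  have "Z ` N \<subseteq> g ` S"
  proof
    fix z assume "z \<in> Z ` N"
    then obtain k where k: "k < m" "\<not> far s r C w k" "z = Z k" by (auto simp: N_def K_def)
    define p where "p = marker s r w (k div r\<^sup>2)"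
    have "k div r\<^sup>2 < J" using k(1) r unfolding m by (simp add: div_less_iff_less_mult)
    then have p: "cell r p \<in> marked_cells s r J w" by (auto simp: marked_cells_def p_def)
    have sq: "sqdist p z \<le> (real C * r)\<^sup>2" using k by (simp add: far_def p_def Z_def)
    have near: "\<bar>a - b\<bar> \<le> int C * int r" if "(real_of_int (a - b))\<^sup>2 \<le> (real C * r)\<^sup>2" for a b
    proof -
      have "\<bar>real_of_int (a - b)\<bar> \<le> real C * r"
        using that by (subst (asm) abs_le_square_iff[symmetric]) simp
      then have "real_of_int \<bar>a - b\<bar> \<le> real_of_int (int C * int r)" by simp
      then show ?thesis by (simp only: of_int_le_iff)
    qed
    have sqs: "(real_of_int (fst z - fst p))\<^sup>2 \<le> (real C * r)\<^sup>2"
      "(real_of_int (snd z - snd p))\<^sup>2 \<le> (real C * r)\<^sup>2"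
      using sq zero_le_power2[of "real_of_int (fst z - fst p)"] zero_le_power2[of "real_of_int (snd z - snd p)"]
      unfolding sqdist_def by linarith+
    then have "\<bar>fst z - fst p\<bar> \<le> int C * int r" "\<bar>snd z - snd p\<bar> \<le> int C * int r"
      using near[OF sqs(1)] near[OF sqs(2)] by simp_all
    then have "\<bar>fst z div int r - fst p div int r\<bar> \<le> int C" "\<bar>snd z div int r - snd p div int r\<bar> \<le> int C"
      using r by (intro div_near; simp)+
    moreover have "z = g (cell r p, (fst z div int r - fst p div int r, snd z div int r - snd p div int r),
        (fst z mod int r, snd z mod int r))"
      by (simp add: g_def cell_def)
    ultimately show "z \<in> g ` S"
      using p r by (intro image_eqI) (auto simp: S_def)
  qed
  then have "card (Z ` N) \<le> card S"
    using finS by (rule surj_card_le[rotated])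
  also have "card (Z ` N) = card N"
    by (intro card_image inj_on_subset[OF inj]) (auto simp: N_def)
  also have "real (card S) = (2 * real C + 1)\<^sup>2 * r\<^sup>2 * card (marked_cells s r J w)"
    by (simp add: S_def card_cartesian_product power2_eq_square)
  finally have N: "real (card N) \<le> (2 * real C + 1)\<^sup>2 * r\<^sup>2 * card (marked_cells s r J w)" by simp
  have "(\<Sum>k<m. new (run s (take k w))) = real (card K)"
    by (simp add: new_def of_bool_def sum.If_cases K_def Z_def Int_def)
  also have "K = N \<union> {k \<in> K. far s r C w k}" by (auto simp: N_def)
  also have "real (card (N \<union> {k \<in> K. far s r C w k})) \<le> real (card N) + real (card {k \<in> K. far s r C w k})"
    by (metis card_Un_le of_nat_add of_nat_mono)
  also have "card {k \<in> K. far s r C w k} \<le> card {k. k < m \<and> far s r C w k}"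
    by (intro card_mono) (auto simp: K_def)
  also have "real \<dots> = (\<Sum>k<m. of_bool (far s r C w k))"
    by (simp add: of_bool_def sum.If_cases Int_def)
  finally show ?thesis using N by simp
qed

lemma coin_sqdist:
  assumes "j \<le> k" "k \<le> m"
  shows "coin m (\<lambda>w. sqdist (snd (run s (take j w))) (snd (run s (take k w)))) = real (k - j)"
proof -
  have "coin m (\<lambda>w. sqdist (snd (run s (take j w))) (snd (run s (take k w)))) =
      coin m (\<lambda>w. (\<lambda>w. sqdist (snd (run s (take j w))) (snd (run s w))) (take k w))"
    using assms(1) by (simp add: min_absorb1)
  also have "\<dots> = coin k (\<lambda>w. sqdist (snd (run s (take j w))) (snd (run s w)))"
    by (rule coin_take) (rule assms)
  also have "\<dots> = coin j (\<lambda>u. coin (k - j) (\<lambda>v. sqdist (snd (run s (take j (u @ v)))) (snd (run s (u @ v)))))"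
    by (rule coin_split) (rule assms)
  also have "\<dots> = coin j (\<lambda>u. trans_op (k - j) (\<lambda>t. sqdist (snd (run s u)) (snd t)) (run s u))"
    by (rule coin_cong) (simp add: trans_op_def)
  also have "\<dots> = real (k - j)"
    by (simp add: trans_op_sqdist) (simp add: sqdist_def)
  finally show ?thesis .
qed

text \<open>Chebyshev's inequality: at most r^2 steps have passed since the latest marker, and the
  mean squared displacement equals the number of steps.\<close>

lemma coin_far:
  assumes "k < m" "r \<ge> 1" "C \<ge> 1"
  shows "coin m (\<lambda>w. of_bool (far s r C w k)) \<le> 1 / (real C)\<^sup>2"
proof -
  define j where "j = k div r\<^sup>2 * r\<^sup>2"
  have j: "j \<le> k" "k - j \<le> r\<^sup>2"
    using assms(2) mod_less_divisor[of "r\<^sup>2" k] by (auto simp: j_def minus_div_mult_eq_mod intro: less_imp_le)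
  have "coin m (\<lambda>w. of_bool (far s r C w k)) \<le>
      coin m (\<lambda>w. sqdist (snd (run s (take j w))) (snd (run s (take k w))) / (real C * r)\<^sup>2)"
  proof (rule coin_mono)
    fix w show "of_bool (far s r C w k)
        \<le> sqdist (snd (run s (take j w))) (snd (run s (take k w))) / (real C * r)\<^sup>2"
      using assms by (auto simp: far_def marker_def j_def sqdist_nonneg of_bool_def)
  qed
  also have "\<dots> = real (k - j) / (real C * r)\<^sup>2"
    using assms j by (simp add: coin_divide coin_sqdist)
  also have "\<dots> \<le> real (r\<^sup>2) / (real C * r)\<^sup>2"
    using j(2) by (intro divide_right_mono of_nat_mono) auto
  also have "\<dots> = 1 / (real C)\<^sup>2" using assms by (simp add: power_mult_distrib)
  finally show ?thesis .
qed

lemma occ_new_le_cells: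
  assumes r: "r \<ge> 1" and m: "m = J * r\<^sup>2" and C: "C \<ge> 1"
  shows "occ new m s \<le> m / (real C)\<^sup>2 + (2 * real C + 1)\<^sup>2 * r\<^sup>2 * coin m (\<lambda>w. card (marked_cells s r J w))"
proof -
  have "occ new m s \<le> coin m (\<lambda>w. (\<Sum>k<m. of_bool (far s r C w k))
      + (2 * real C + 1)\<^sup>2 * r\<^sup>2 * card (marked_cells s r J w))"
    unfolding occ_path using r m by (intro coin_mono new_sum_le) auto
  also have "\<dots> = (\<Sum>k<m. coin m (\<lambda>w. of_bool (far s r C w k)))
      + (2 * real C + 1)\<^sup>2 * r\<^sup>2 * coin m (\<lambda>w. card (marked_cells s r J w))"
    by (simp only: coin_add coin_sum coin_cmult)
  also have "(\<Sum>k<m. coin m (\<lambda>w. of_bool (far s r C w k))) \<le> (\<Sum>k<m. 1 / (real C)\<^sup>2)"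
    using r C by (intro sum_mono coin_far) auto
  finally show ?thesis by simp
qed

section \<open>The number of new sites is sublinear\<close>

lemma sum_inverse_sq_ints_bounded:
  obtains D :: real where "D \<ge> 0" "\<And>F :: int set. finite F \<Longrightarrow> (\<Sum>c\<in>F. 1 / (1 + (real_of_int c)\<^sup>2)) \<le> D"
proof -
  define g where "g = (\<lambda>n::nat. inverse ((real (Suc n))\<^sup>2))"
  have summ: "summable g"
    unfolding g_def summable_Suc_iff[of "\<lambda>n. inverse ((real n)\<^sup>2)"]
    by (rule inverse_power_summable) simp
  have pos: "0 \<le> g n" for n by (simp add: g_def)
  have le: "1 / (1 + (real_of_int c)\<^sup>2) \<le> 4 * g (nat \<bar>c\<bar>)" for c
  proof -
    have "(1 + \<bar>real_of_int c\<bar>)\<^sup>2 \<le> 4 * (1 + (real_of_int c)\<^sup>2)"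
      using zero_le_power2[of "1 - \<bar>real_of_int c\<bar>"] by (simp add: power2_eq_square algebra_simps)
    then have "1 / (1 + (real_of_int c)\<^sup>2) \<le> 4 / (1 + \<bar>real_of_int c\<bar>)\<^sup>2"
      by (simp add: divide_simps add_pos_nonneg)
    then show ?thesis by (simp add: g_def inverse_eq_divide)
  qed
  have "(\<Sum>c\<in>F. 1 / (1 + (real_of_int c)\<^sup>2)) \<le> 8 * suminf g" if F: "finite F" for F
  proof -
    have inj: "inj_on (\<lambda>c. nat \<bar>c\<bar>) {c \<in> F. 0 \<le> c}" "inj_on (\<lambda>c. nat \<bar>c\<bar>) {c \<in> F. c < 0}"
      by (auto simp: inj_on_def)
    have half: "(\<Sum>c\<in>G. g (nat \<bar>c\<bar>)) \<le> suminf g" if "inj_on (\<lambda>c. nat \<bar>c\<bar>) G" "finite G" for G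
    proof -
      have "(\<Sum>c\<in>G. g (nat \<bar>c\<bar>)) = sum g ((\<lambda>c. nat \<bar>c\<bar>) ` G)"
        using that by (simp add: sum.reindex)
      also have "\<dots> \<le> suminf g"
        using that pos by (intro sum_le_suminf summ) auto
      finally show ?thesis .
    qed
    have "(\<Sum>c\<in>F. 1 / (1 + (real_of_int c)\<^sup>2)) \<le> (\<Sum>c\<in>F. 4 * g (nat \<bar>c\<bar>))"
      by (intro sum_mono le)
    also have "(\<Sum>c\<in>F. 4 * g (nat \<bar>c\<bar>)) =
        4 * ((\<Sum>c\<in>{c \<in> F. 0 \<le> c}. g (nat \<bar>c\<bar>)) + (\<Sum>c\<in>{c \<in> F. c < 0}. g (nat \<bar>c\<bar>)))"
    proof -
      define h where "h = (\<lambda>c. g (nat \<bar>c\<bar>))"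
      have eq: "{c \<in> F. 0 \<le> c} \<union> {c \<in> F. c < 0} = F" by auto
      have "sum h F = sum h {c \<in> F. 0 \<le> c} + sum h {c \<in> F. c < 0}"
        by (subst sum.union_disjoint[symmetric]) (use F eq in auto)
      then show ?thesis by (simp add: h_def flip: sum_distrib_left)
    qed
    also have "\<dots> \<le> 4 * (suminf g + suminf g)"
      using F inj by (intro mult_left_mono add_mono half) auto
    finally show ?thesis by simp
  qed
  moreover have "0 \<le> 8 * suminf g" using suminf_nonneg[OF summ pos] by simp
  ultimately show ?thesis using that by blast
qed

lemma bump_nonneg: "0 \<le> bump \<phi> \<rho> c z"
  by (simp add: bump_def)

text \<open>Rounding down changes a difference by less than 1, so the difference of the cells is at
  most d + 1 with d the unrounded one, and (d + 1)^2 \<le> 2 + 3 d^2. Dividing by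
  \<open>sqrt t\<close> can only enlarge the right side.\<close>

lemma coord_cell_bound:
  fixes x y :: int
  assumes "r \<ge> 1" "0 < t" "t \<le> 1"
  shows "1 + (real_of_int (x div int r - y div int r))\<^sup>2 \<le> 3 * (1 + (real_of_int (x - y) / (sqrt t * r))\<^sup>2)"
proof -
  define c where "c = \<bar>real_of_int (x div int r - y div int r)\<bar>"
  define d where "d = \<bar>real_of_int (x - y) / r\<bar>"
  have xy: "real_of_int (x div int r) = real_of_int \<lfloor>real_of_int x / r\<rfloor>"
    "real_of_int (y div int r) = real_of_int \<lfloor>real_of_int y / r\<rfloor>"
    using floor_divide_of_int_eq[of x "int r", where 'a = real]
      floor_divide_of_int_eq[of y "int r", where 'a = real] by simp_all
  have "real_of_int \<lfloor>a\<rfloor> \<le> a \<and> a < real_of_int \<lfloor>a\<rfloor> + 1" for a :: real by linarith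
  from this[of "real_of_int x / r"] this[of "real_of_int y / r"]
  have "c \<le> d + 1" unfolding c_def d_def of_int_diff xy diff_divide_distrib by linarith
  then have "c\<^sup>2 \<le> (d + 1)\<^sup>2" by (intro power_mono) (auto simp: c_def)
  also have "\<dots> \<le> 2 + 3 * d\<^sup>2"
    using zero_le_power2[of "d - 1/2"] zero_le_power2[of d] by (simp add: power2_eq_square algebra_simps)
  also have "d\<^sup>2 \<le> (real_of_int (x - y) / (sqrt t * r))\<^sup>2"
  proof -
    have "(real_of_int (x - y))\<^sup>2 * t \<le> (real_of_int (x - y))\<^sup>2 * 1"
      using assms by (intro mult_left_mono) auto
    then show ?thesis
      using assms unfolding d_def by (simp add: power_divide power_mult_distrib field_simps)
  qed
  finally show ?thesis by (simp add: c_def)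
qed

text \<open>The fourth power decay dominates a product of two quadratic decays, because (1 + u) (1 +
  v) \<le> (1 + u + v)^2; the product form is what can be summed over the plane. The factor 18 is 2
  times 3 for each coordinate.\<close>

lemma bump_cell_bound:
  assumes "r \<ge> 1" "0 < \<phi>" "\<phi> < 1"
  shows "bump \<phi> r c z \<le> 18 * (1 / (1 + (real_of_int (fst (cell r c) - fst (cell r z)))\<^sup>2)
    * (1 / (1 + (real_of_int (snd (cell r c) - snd (cell r z)))\<^sup>2)))"
proof -
  define u v where uv: "u = (xc \<phi> r c z)\<^sup>2" "v = (yc \<phi> r c z)\<^sup>2"
  define p q where pq: "p = 1 + (real_of_int (fst (cell r c) - fst (cell r z)))\<^sup>2"
    "q = 1 + (real_of_int (snd (cell r c) - snd (cell r z)))\<^sup>2"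
  have p1: "p \<ge> 1" "q \<ge> 1" by (auto simp: pq)
  have "p \<le> 3 * (1 + u)"
    using coord_cell_bound[of r "1 - \<phi>" "fst z" "fst c"] assms
    by (simp add: pq uv xc_def cell_def power2_commute)
  moreover have "q \<le> 3 * (1 + v)"
    using coord_cell_bound[of r "\<phi>" "snd z" "snd c"] assms
    by (simp add: pq uv yc_def cell_def power2_commute)
  moreover have uv0: "u \<ge> 0" "v \<ge> 0" by (auto simp: uv)
  ultimately have "p * q \<le> (3 * (1 + u)) * (3 * (1 + v))" using p1 by (intro mult_mono) auto
  also have "\<dots> \<le> 9 * (1 + u + v)\<^sup>2"
    using uv0 by (simp add: power2_eq_square algebra_simps)
  finally have "p * q \<le> 9 * (1 + u + v)\<^sup>2" .
  then have "2 / (1 + u + v)\<^sup>2 \<le> 18 / (p * q)"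
    using p1 uv0 by (simp add: divide_simps zero_less_mult_iff)
  then show ?thesis by (simp add: bump_def uv pq)
qed

text \<open>Distinct cells have distinct offsets from the cell of \<open>z\<close>, so the sum is at
  most a product of two one-dimensional sums. The constant does not depend on \<open>r\<close>,
  which will be chosen after it.\<close>

lemma bump_sum_bounded:
  obtains D :: real where "D \<ge> 0" "\<And>\<phi> r z (p :: nat \<Rightarrow> site) I. 0 < \<phi> \<Longrightarrow> \<phi> < 1 \<Longrightarrow> r \<ge> 1 \<Longrightarrow> finite I \<Longrightarrow>
    inj_on (\<lambda>i. cell r (p i)) I \<Longrightarrow> (\<Sum>i\<in>I. bump \<phi> (real r) (p i) z) \<le> D"
proof -
  obtain D :: real where D: "D \<ge> 0" "\<And>F :: int set. finite F \<Longrightarrow> (\<Sum>c\<in>F. 1 / (1 + (real_of_int c)\<^sup>2)) \<le> D"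
    using sum_inverse_sq_ints_bounded by blast
  show ?thesis
  proof (rule that[of "18 * D\<^sup>2"])
    fix \<phi> :: real and r z and p :: "nat \<Rightarrow> site" and I
    assume a: "0 < \<phi>" "\<phi> < 1" "r \<ge> 1" "finite I" and inj: "inj_on (\<lambda>i. cell r (p i)) I"
    define e where "e = (\<lambda>i. cell r (p i) - cell r z)"
    define h where "h = (\<lambda>c::int. 1 / (1 + (real_of_int c)\<^sup>2))"
    have h0: "0 \<le> h c" for c by (simp add: h_def)
    have "(\<Sum>i\<in>I. bump \<phi> r (p i) z) \<le> (\<Sum>i\<in>I. 18 * (h (fst (e i)) * h (snd (e i))))"
      using bump_cell_bound[OF a(3,1,2)] by (intro sum_mono) (simp add: e_def h_def)
    also have "\<dots> = 18 * (\<Sum>d\<in>e ` I. h (fst d) * h (snd d))"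
      using inj by (subst sum.reindex) (auto simp: sum_distrib_left e_def inj_on_def)
    also have "(\<Sum>d\<in>e ` I. h (fst d) * h (snd d)) \<le> (\<Sum>d\<in>fst ` e ` I \<times> snd ` e ` I. h (fst d) * h (snd d))"
      using a h0 by (intro sum_mono2 subset_fst_snd) auto
    also have "\<dots> = sum h (fst ` e ` I) * sum h (snd ` e ` I)"
      by (simp add: sum_product sum.cartesian_product split_beta)
    also have "\<dots> \<le> D * D"
      using D a h0 by (intro mult_mono) (auto simp: h_def intro!: sum_nonneg)
    finally show "(\<Sum>i\<in>I. bump \<phi> r (p i) z) \<le> 18 * D\<^sup>2" by (simp add: power2_eq_square)
  qed simp
qed

text \<open>Conditioning at time i r^2: the event and the marker depend on the earlier coins, and
  the sum is an occupation sum of the walk restarted from the state reached there.\<close>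

lemma marked_occupation:
  assumes "i * r\<^sup>2 + m \<le> n"
  shows "coin n (\<lambda>w. of_bool (first_mark s r w i) *
      (\<Sum>k<m. g (marker s r w i) (snd (run s (take (i * r\<^sup>2 + k) w))))) =
    coin (i * r\<^sup>2) (\<lambda>u. of_bool (first_mark s r u i) * occ (\<lambda>t. g (snd (run s u)) (snd t)) m (run s u))"
proof -
  define j where "j = i * r\<^sup>2"
  define H where "H = (\<lambda>w. of_bool (first_mark s r w i) *
      (\<Sum>k<m. g (marker s r w i) (snd (run s (take (i * r\<^sup>2 + k) w)))))"
  have "coin n H = coin n (\<lambda>w. H (take (j + m) w))"
  proof (rule coin_cong)
    fix w
    show "H w = H (take (j + m) w)"
      unfolding H_def using first_mark_take[of i r "j + m" s w]
      by (intro arg_cong2[where f = times] sum.cong) (auto simp: j_def min_absorb1)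
  qed
  also have "\<dots> = coin (j + m) H" using assms by (intro coin_take) (simp add: j_def)
  also have "\<dots> = coin j (\<lambda>u. coin m (\<lambda>v. H (u @ v)))" by (rule coin_append)
  also have "\<dots> = coin j (\<lambda>u. of_bool (first_mark s r u i) * occ (\<lambda>t. g (snd (run s u)) (snd t)) m (run s u))"
  proof (rule coin_cong)
    fix u :: "bool list" assume u: "length u = j"
    have "H (u @ v) = of_bool (first_mark s r u i) * (\<Sum>k<m. g (snd (run s u)) (snd (run (run s u) (take k v))))" for v
      using first_mark_take[of i r j s "u @ v"] u by (simp add: H_def j_def marker_def)
    then show "coin m (\<lambda>v. H (u @ v)) = of_bool (first_mark s r u i) * occ (\<lambda>t. g (snd (run s u)) (snd t)) m (run s u)"
      by (simp add: occ_path coin_cmult)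
  qed
  finally show ?thesis by (simp add: H_def j_def)
qed

text \<open>The double count. Summed over \<open>i\<close> is the occupation of the bump around the
  i-th marker during the next \<open>m\<close> steps, counted for first marks. From above, the bumps
  add up to at most \<open>D\<close> at each of \<open>n\<close> times. From below, a first mark
  yields r^2 times ln (1 + J) / 4 up to an error. Since \<open>b\<close> divides \<open>r\<close>,
  all times that occur are multiples of \<open>b\<close>, where deficits are nonnegative.\<close>

lemma marked_cells_bound:
  assumes \<phi>: "0 < \<phi>" "\<phi> < 1" and \<delta>: "0 \<le> \<delta>"
    and b: "b \<ge> 1" "new_max b \<le> (\<phi> + \<delta>) * b" and r: "r \<ge> 1" "b dvd r" and J: "J \<ge> 1"
    and m: "m = J * r\<^sup>2" and n: "n = 2 * m" and s: "(\<phi> - \<delta>) * n \<le> occ new n s"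
    and D: "\<And>z p I. finite (I :: nat set) \<Longrightarrow> inj_on (\<lambda>i. cell r (p i)) I \<Longrightarrow>
      (\<Sum>i\<in>I. bump \<phi> (real r) (p i) z) \<le> D"
  shows "ln (1 + real J) / 4 * coin m (\<lambda>w. card (marked_cells s r J w))
    \<le> J * (2 * D + 10 * (ellipticity \<phi>)\<^sup>2 * \<delta> * J + 24 * (ellipticity \<phi>) ^ 3 * b * J / r)"
proof -
  define \<kappa> where "\<kappa> = ellipticity \<phi>"
  define l where "l = ln (1 + real J) / 4"
  define \<tau> where "\<tau> = r\<^sup>2"
  have m\<tau>: "m = J * \<tau>" by (simp add: m \<tau>_def)
  have m1: "m \<ge> 1" using J r by (simp add: m)
  have \<tau>0: "\<tau> \<ge> 1" using r by (simp add: \<tau>_def)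
  have bd: "b dvd \<tau>" using r(2) by (simp add: \<tau>_def power2_eq_square)
  have nm: "new_max k \<le> (\<phi> + \<delta>) * k" if bk: "b dvd k" for k
  proof -
    obtain q where k: "k = q * b" using bk by (metis dvdE mult.commute)
    have "new_max k \<le> q * new_max b" unfolding k by (rule new_max_mult)
    also have "\<dots> \<le> q * ((\<phi> + \<delta>) * b)" using b by (intro mult_left_mono) auto
    finally show ?thesis by (simp add: k algebra_simps)
  qed
  define def where "def = (\<lambda>k t. (\<phi> + \<delta>) * real k - occ new k t)"
  have def0: "0 \<le> def k t" if "b dvd k" for k t
    using nm[OF that] occ_new_le_new_max[of k t] by (simp add: def_def)
  define err where "err = (\<lambda>t. 2 * \<kappa>\<^sup>2 / r\<^sup>2 * (def m t + \<delta> * m) + 24 * \<kappa> ^ 3 / r ^ 3 * (b * m))"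
  have \<kappa>0: "\<kappa> > 0" unfolding \<kappa>_def using ellipticity_ge(5)[of \<phi> 1] \<phi> by simp
  have bm: "b dvd m" using bd by (simp add: m\<tau>)
  have err0: "0 \<le> err t" for t
    unfolding err_def using \<kappa>0 def0[OF bm, of t] \<delta> by (intro add_nonneg_nonneg mult_nonneg_nonneg) auto
  have lower: "l - err t \<le> occ (\<lambda>t'. bump \<phi> r (snd t) (snd t')) m t / r\<^sup>2" for t
  proof -
    obtain q where q: "m = q * b" using bm by (metis dvdE mult.commute)
    have "q \<ge> 1" using q m1 by (cases q) auto
    from occ_bump_ge[OF \<phi> _ b(1) this \<delta> b(2), of "real r" t] r
    have "ln (1 + m / (real r)\<^sup>2) / 4 \<le> occ (\<lambda>t'. bump \<phi> r (snd t) (snd t')) m t / r\<^sup>2 + err t"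
      by (simp add: q[symmetric] err_def def_def \<kappa>_def)
    moreover have "m / (real r)\<^sup>2 = J" using r by (simp add: m)
    ultimately have "ln (1 + real J) / 4 \<le> occ (\<lambda>t'. bump \<phi> r (snd t) (snd t')) m t / r\<^sup>2 + err t"
      by (simp only:)
    then show ?thesis unfolding l_def by linarith
  qed
  define H where "H = (\<lambda>i w. of_bool (first_mark s r w i) *
      (\<Sum>k<m. bump \<phi> r (marker s r w i) (snd (run s (take (i * \<tau> + k) w)))))"
  \<comment> \<open>A window starts before time \<open>m\<close> and has length \<open>m\<close>;
    this is why the horizon is \<open>2 * m\<close>.\<close>
  have le_n: "i * \<tau> + m \<le> n" if "i < J" for i
    using that mult_le_mono1[of i J \<tau>] by (simp add: n m\<tau>)
  have "(\<Sum>i<J. coin n (H i)) \<le> n * D"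
  proof -
    have "(\<Sum>i<J. H i w) \<le> n * D" for w
    proof -
      define I where "I = {i. i < J \<and> first_mark s r w i}"
      define B where "B = (\<lambda>i k. bump \<phi> r (marker s r w i) (snd (run s (take k w))))"
      have "(\<Sum>i<J. H i w) = (\<Sum>i\<in>I. \<Sum>k<m. B i (i * \<tau> + k))"
        unfolding H_def I_def B_def
        by (intro sum.mono_neutral_cong_right) auto
      also have "\<dots> \<le> (\<Sum>i\<in>I. \<Sum>k<n. B i k)"
      proof (rule sum_mono)
        fix i assume "i \<in> I"
        have "(\<Sum>k<m. B i (i * \<tau> + k)) = sum (B i) ((+) (i * \<tau>) ` {..<m})"
          by (simp add: sum.reindex)
        also have "\<dots> \<le> sum (B i) {..<n}"
          using le_n[of i] \<open>i \<in> I\<close> by (intro sum_mono2) (auto simp: B_def I_def bump_nonneg)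
        finally show "(\<Sum>k<m. B i (i * \<tau> + k)) \<le> sum (B i) {..<n}" .
      qed
      also have "\<dots> = (\<Sum>k<n. \<Sum>i\<in>I. B i k)" by (rule sum.swap)
      also have "\<dots> \<le> (\<Sum>k<n. D)"
      proof (rule sum_mono)
        fix k
        have "inj_on (\<lambda>i. cell r (marker s r w i)) I"
          unfolding I_def first_mark_def
          using bij_betw_first_occurrences[of "\<lambda>i. cell r (marker s r w i)" J]
          by (rule bij_betw_imp_inj_on)
        then show "(\<Sum>i\<in>I. B i k) \<le> D" unfolding B_def by (intro D) (auto simp: I_def)
      qed
      finally show ?thesis by simp
    qed
    then have "coin n (\<lambda>w. \<Sum>i<J. H i w) \<le> coin n (\<lambda>w. n * D)" by (intro coin_mono)
    then show ?thesis by (simp add: coin_sum)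
  qed
  moreover have "r\<^sup>2 * (l * coin (i * \<tau>) (\<lambda>u. of_bool (first_mark s r u i))
      - (2 * \<kappa>\<^sup>2 / r\<^sup>2 * (def n s + \<delta> * m) + 24 * \<kappa> ^ 3 / r ^ 3 * (b * m))) \<le> coin n (H i)"
    if i: "i < J" for i
  proof -
    define j where "j = i * \<tau>"
    have jn: "j + m \<le> n" using le_n[OF i] by (simp add: j_def)
    \<comment> \<open>The horizon splits into \<open>j\<close>, \<open>m\<close> and
      \<open>n - (j + m)\<close> steps. Deficits add and the outer two are nonnegative, so the mean
      deficit of the window is at most that of the whole horizon.\<close>
    have "coin j (\<lambda>u. def m (run s u)) \<le> def n s"
    proof -
      have bj: "b dvd j" "b dvd n - (j + m)" using bd by (auto simp: j_def n m\<tau>)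
      have "trans_op j (def m) s = (\<phi> + \<delta>) * m - trans_op j (occ new m) s"
        unfolding def_def by (simp add: trans_op_lin)
      moreover have "occ new n s = occ new j s + (trans_op j (occ new m) s
          + trans_op (j + m) (occ new (n - (j + m))) s)"
        using occ_add[of new "j + m" "n - (j + m)" s] occ_add[of new j m s] jn by simp
      moreover have "occ new j s \<le> (\<phi> + \<delta>) * j" using def0[OF bj(1), of s] by (simp add: def_def)
      moreover have "trans_op (j + m) (occ new (n - (j + m))) s \<le> trans_op (j + m) (\<lambda>t. (\<phi> + \<delta>) * real (n - (j + m))) s"
        using def0[OF bj(2)] by (intro trans_op_mono) (simp add: def_def)
      then have "trans_op (j + m) (occ new (n - (j + m))) s \<le> (\<phi> + \<delta>) * real (n - (j + m))" by simp
      moreover have "real n = real j + real m + real (n - (j + m))" using jn by simp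
      then have "(\<phi> + \<delta>) * n = (\<phi> + \<delta>) * j + (\<phi> + \<delta>) * m + (\<phi> + \<delta>) * real (n - (j + m))"
        by (simp only: distrib_left)
      ultimately show ?thesis by (simp add: trans_op_def def_def)
    qed
    then have E: "coin j (\<lambda>u. err (run s u)) \<le> 2 * \<kappa>\<^sup>2 / r\<^sup>2 * (def n s + \<delta> * m) + 24 * \<kappa> ^ 3 / r ^ 3 * (b * m)"
      unfolding err_def coin_add coin_cmult coin_const
      using \<kappa>0 \<delta> by (intro add_mono mult_left_mono) auto
    have "r\<^sup>2 * (l * coin j (\<lambda>u. of_bool (first_mark s r u i)) - coin j (\<lambda>u. err (run s u)))
       = coin j (\<lambda>u. r\<^sup>2 * (l * of_bool (first_mark s r u i) - err (run s u)))"
      by (simp only: coin_diff coin_cmult)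
    also have "\<dots> \<le> coin j (\<lambda>u. of_bool (first_mark s r u i) * occ (\<lambda>t. bump \<phi> r (snd (run s u)) (snd t)) m (run s u))"
    proof (rule coin_mono)
      fix u
      have "r\<^sup>2 * (l - err (run s u)) \<le> occ (\<lambda>t. bump \<phi> r (snd (run s u)) (snd t)) m (run s u)"
        using lower[of "run s u"] r by (simp add: pos_le_divide_eq mult.commute)
      \<comment> \<open>If there is no first mark the left side is at most 0. Subtracting the error
        in this case as well lets its mean be taken over all coins.\<close>
      moreover have "0 \<le> r\<^sup>2 * err (run s u)" using err0 by simp
      ultimately show "r\<^sup>2 * (l * of_bool (first_mark s r u i) - err (run s u)) \<le>
          of_bool (first_mark s r u i) * occ (\<lambda>t. bump \<phi> r (snd (run s u)) (snd t)) m (run s u)"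
        by (cases "first_mark s r u i") auto
    qed
    also have "\<dots> = coin n (H i)"
      unfolding H_def j_def using marked_occupation[of i r m n s "bump \<phi> r"] le_n[OF i] by (simp add: \<tau>_def)
    finally have "r\<^sup>2 * (l * coin j (\<lambda>u. of_bool (first_mark s r u i)) - coin j (\<lambda>u. err (run s u))) \<le> coin n (H i)" .
    moreover have "real (r\<^sup>2) * coin j (\<lambda>u. err (run s u)) \<le> r\<^sup>2 * (2 * \<kappa>\<^sup>2 / r\<^sup>2 * (def n s + \<delta> * m) + 24 * \<kappa> ^ 3 / r ^ 3 * (b * m))"
      using E by (intro mult_left_mono) auto
    ultimately show ?thesis by (simp add: j_def right_diff_distrib)
  qed
  then have "(\<Sum>i<J. r\<^sup>2 * (l * coin (i * \<tau>) (\<lambda>u. of_bool (first_mark s r u i))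
      - (2 * \<kappa>\<^sup>2 / r\<^sup>2 * (def n s + \<delta> * m) + 24 * \<kappa> ^ 3 / r ^ 3 * (b * m)))) \<le> (\<Sum>i<J. coin n (H i))"
    by (intro sum_mono) auto
  moreover have "(\<Sum>i<J. coin (i * \<tau>) (\<lambda>u. of_bool (first_mark s r u i))) = coin m (\<lambda>w. card (marked_cells s r J w))"
  proof -
    have "coin (i * \<tau>) (\<lambda>u. of_bool (first_mark s r u i)) = coin m (\<lambda>w. of_bool (first_mark s r w i))" if "i < J" for i
    proof -
      have "i * \<tau> \<le> m" using that by (simp add: m\<tau>)
      from coin_take[OF this, of "\<lambda>u. of_bool (first_mark s r u i)"]
      show ?thesis using first_mark_take[of i r "i * \<tau>" s] by (simp add: \<tau>_def)
    qed
    then show ?thesis unfolding card_marked_cells coin_sum by (intro sum.cong) auto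
  qed
  ultimately have "r\<^sup>2 * (l * coin m (\<lambda>w. card (marked_cells s r J w))
      - J * (2 * \<kappa>\<^sup>2 / r\<^sup>2 * (def n s + \<delta> * m) + 24 * \<kappa> ^ 3 / r ^ 3 * (b * m))) \<le> n * D"
    by (simp add: sum_distrib_left[symmetric] sum_subtractf)
  then have "l * coin m (\<lambda>w. card (marked_cells s r J w))
      - J * (2 * \<kappa>\<^sup>2 / r\<^sup>2 * (def n s + \<delta> * m) + 24 * \<kappa> ^ 3 / r ^ 3 * (b * m)) \<le> n * D / r\<^sup>2"
    using r by (simp add: pos_le_divide_eq mult.commute)
  also have "n * D / r\<^sup>2 = J * (2 * D)" using r by (simp add: n m)
  finally have 1: "l * coin m (\<lambda>w. card (marked_cells s r J w)) \<le> J * (2 * D) +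
      J * (2 * \<kappa>\<^sup>2 / r\<^sup>2 * (def n s + \<delta> * m) + 24 * \<kappa> ^ 3 / r ^ 3 * (b * m))" by simp
  \<comment> \<open>Near optimality gives \<open>def n s\<close> at most 2 \<delta> n = 4 \<delta>
    m, and the extra \<delta> m makes 5.\<close>
  have "def n s + \<delta> * m \<le> 5 * \<delta> * m"
    using s by (simp add: def_def n algebra_simps)
  then have "2 * \<kappa>\<^sup>2 / r\<^sup>2 * (def n s + \<delta> * m) \<le> 2 * \<kappa>\<^sup>2 / r\<^sup>2 * (5 * \<delta> * m)"
    by (intro mult_left_mono) auto
  also have "\<dots> = 10 * \<kappa>\<^sup>2 * \<delta> * J" using r by (simp add: m)
  finally have 2: "2 * \<kappa>\<^sup>2 / r\<^sup>2 * (def n s + \<delta> * m) \<le> 10 * \<kappa>\<^sup>2 * \<delta> * J" .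
  have 3: "24 * \<kappa> ^ 3 / r ^ 3 * (b * m) = 24 * \<kappa> ^ 3 * b * J / r"
    using r by (simp add: m power2_eq_square power3_eq_cube)
  have "real J * (2 * \<kappa>\<^sup>2 / r\<^sup>2 * (def n s + \<delta> * m) + 24 * \<kappa> ^ 3 / r ^ 3 * (b * m)) \<le>
    J * (10 * \<kappa>\<^sup>2 * \<delta> * J + 24 * \<kappa> ^ 3 * b * J / r)"
    using 2 3 by (intro mult_left_mono) auto
  with 1 have "l * coin m (\<lambda>w. card (marked_cells s r J w))
      \<le> J * (2 * D) + J * (10 * \<kappa>\<^sup>2 * \<delta> * J + 24 * \<kappa> ^ 3 * b * J / r)"
    by linarith
  also have "\<dots> = J * (2 * D + 10 * \<kappa>\<^sup>2 * \<delta> * J + 24 * \<kappa> ^ 3 * b * J / r)"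
    by (simp only: distrib_left add.assoc)
  finally show ?thesis unfolding l_def \<kappa>_def .
qed

lemma near_maximizer:
  assumes "0 < e"
  obtains s where "new_max n - e \<le> occ new n s"
proof -
  have "\<exists>s. new_max n - e \<le> occ new n s"
  proof (rule ccontr)
    assume "\<nexists>s. new_max n - e \<le> occ new n s"
    then have "occ new n s \<le> new_max n - e" for s by (meson linear)
    then have "new_max n \<le> new_max n - e" by (rule new_max_least)
    then show False using assms by simp
  qed
  then show ?thesis using that by blast
qed

text \<open>The choices are ordered by dependence. \<open>C\<close> makes the far times negligible
  and \<open>J\<close> makes the logarithm exceed \<open>8 * A / \<phi>\<close>. Then
  \<open>\<delta>\<close>, the block length \<open>b\<close> belonging to it, and finally the cell
  side \<open>r\<close> bring the two error terms of the double count, both proportional to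
  \<open>J\<close>, below 1.\<close>

theorem growth_eq_0: "growth = 0"
proof (rule ccontr)
  assume "growth \<noteq> 0"
  define \<phi> where "\<phi> = growth"
  have \<phi>: "0 < \<phi>" "\<phi> < 1"
    using \<open>growth \<noteq> 0\<close> growth_nonneg growth_less_1 by (auto simp: \<phi>_def)
  obtain D :: real where D: "D \<ge> 0" "\<And>\<phi> r z (p :: nat \<Rightarrow> site) I. 0 < \<phi> \<Longrightarrow> \<phi> < 1 \<Longrightarrow> r \<ge> 1 \<Longrightarrow> finite I \<Longrightarrow>
    inj_on (\<lambda>i. cell r (p i)) I \<Longrightarrow> (\<Sum>i\<in>I. bump \<phi> (real r) (p i) z) \<le> D"
    using bump_sum_bounded by blast
  define \<kappa> where "\<kappa> = ellipticity \<phi>"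
  have \<kappa>0: "\<kappa> > 0" unfolding \<kappa>_def using ellipticity_ge(5)[of \<phi> 1] \<phi> by simp
  obtain C :: nat where C: "C \<ge> 1" "8 / \<phi> \<le> C"
    using real_arch_simple[of "max 1 (8 / \<phi>)"] by auto
  have C2: "1 / (real C)\<^sup>2 \<le> \<phi> / 8"
  proof -
    have "8 / \<phi> * 1 \<le> real C * real C" using C \<phi> by (intro mult_mono) auto
    then show ?thesis using C \<phi> by (simp add: power2_eq_square field_simps)
  qed
  \<comment> \<open>The bracket \<open>2 * D + 2\<close> is that of
    \<open>marked_cells_bound\<close> with each error replaced by 1; the 4 undoes the division of
    the logarithm by 4.\<close>
  define A where "A = (2 * real C + 1)\<^sup>2 * 4 * (2 * D + 2)"
  have A0: "A > 0" using D(1) by (simp add: A_def)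
  obtain J :: nat where J: "J \<ge> 1" "exp (8 * A / \<phi>) \<le> J"
    using real_arch_simple[of "max 1 (exp (8 * A / \<phi>))"] by auto
  define l where "l = ln (1 + real J)"
  have "exp (8 * A / \<phi>) \<le> 1 + real J" using J by simp
  then have l: "8 * A / \<phi> \<le> l" unfolding l_def using J by (subst ln_ge_iff) auto
  have l0: "l > 0" using J by (simp add: l_def)
  define \<delta> where "\<delta> = min (\<phi> / 12) (1 / (10 * \<kappa>\<^sup>2 * J))"
  have \<delta>: "\<delta> > 0" "\<delta> \<le> \<phi> / 12" "10 * \<kappa>\<^sup>2 * \<delta> * J \<le> 1"
  proof -
    show "\<delta> > 0" "\<delta> \<le> \<phi> / 12" using \<phi> \<kappa>0 J by (auto simp: \<delta>_def)
    have "\<delta> \<le> 1 / (10 * \<kappa>\<^sup>2 * J)" by (simp add: \<delta>_def)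
    then show "10 * \<kappa>\<^sup>2 * \<delta> * J \<le> 1" using \<kappa>0 J by (simp add: field_simps)
  qed
  obtain b where b: "b \<ge> 1" "new_max b \<le> (\<phi> + \<delta>) * b"
    using growth_approx[OF \<delta>(1)] by (auto simp: \<phi>_def)
  obtain t :: nat where t: "t \<ge> 1" "24 * \<kappa> ^ 3 * b * J \<le> t"
    using real_arch_simple[of "max 1 (24 * \<kappa> ^ 3 * b * J)"] by auto
  \<comment> \<open>A multiple of \<open>b\<close>, so that blocks fit between markers, and large
    enough to absorb the error of order b J / r.\<close>
  define r where "r = b * t"
  have r: "r \<ge> 1" "b dvd r" using b t by (auto simp: r_def)
  have rt: "24 * \<kappa> ^ 3 * b * J / r \<le> 1"
  proof -
    have "t \<le> r" using b by (simp add: r_def)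
    then have "24 * \<kappa> ^ 3 * b * J \<le> r" using t by linarith
    then show ?thesis using r by (simp add: divide_le_eq)
  qed
  define m where "m = J * r\<^sup>2"
  define n where "n = 2 * m"
  have m0: "m \<ge> 1" using J r by (simp add: m_def)
  obtain s where "new_max n - \<delta> * n \<le> occ new n s"
    using near_maximizer[of "\<delta> * n" n] \<delta> m0 by (auto simp: n_def)
  moreover have "\<phi> * n \<le> new_max n" unfolding \<phi>_def using m0 by (intro growth_le) (simp add: n_def)
  ultimately have s: "(\<phi> - \<delta>) * n \<le> occ new n s" by (simp add: algebra_simps)
  define Q where "Q = coin m (\<lambda>w. card (marked_cells s r J w))"
  have "l / 4 * Q \<le> J * (2 * D + 10 * \<kappa>\<^sup>2 * \<delta> * J + 24 * \<kappa> ^ 3 * b * J / r)"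
    unfolding l_def Q_def \<kappa>_def
    using \<phi> \<delta>(1) b r J(1) m_def n_def s by (intro marked_cells_bound D(2)) auto
  also have "\<dots> \<le> J * (2 * D + 2)"
    using \<delta>(3) rt by (intro mult_left_mono) auto
  finally have Q: "Q \<le> J * (2 * D + 2) * 4 / l" using l0 by (simp add: field_simps)
  have "occ new m s \<le> m / (real C)\<^sup>2 + (2 * real C + 1)\<^sup>2 * r\<^sup>2 * Q"
    unfolding Q_def using occ_new_le_cells[OF r(1) m_def C(1), of s] by simp
  also have "\<dots> \<le> m * (\<phi> / 8) + (2 * real C + 1)\<^sup>2 * r\<^sup>2 * (J * (2 * D + 2) * 4 / l)"
    using C2 mult_left_mono[OF C2, of "real m"] by (intro add_mono mult_left_mono Q) auto
  also have "(2 * real C + 1)\<^sup>2 * r\<^sup>2 * (J * (2 * D + 2) * 4 / l) = m * (A / l)"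
    by (simp add: A_def m_def)
  also have "m * (A / l) \<le> m * (\<phi> / 8)"
    using l l0 \<phi> by (intro mult_left_mono) (simp_all add: field_simps)
  finally have upper: "occ new m s \<le> m * (\<phi> / 4)" by (simp add: field_simps)
  have "occ new n s = occ new m s + trans_op m (occ new m) s"
    using occ_add[of new m m s] by (simp add: n_def mult_2)
  moreover have "trans_op m (occ new m) s \<le> (\<phi> + \<delta>) * m"
  proof -
    have "b dvd m" using r(2) by (simp add: m_def power2_eq_square)
    then obtain q where q: "m = q * b" by (metis dvdE mult.commute)
    have "new_max m \<le> q * new_max b" unfolding q by (rule new_max_mult)
    also have "\<dots> \<le> q * ((\<phi> + \<delta>) * b)" using b by (intro mult_left_mono) auto
    finally have "new_max m \<le> (\<phi> + \<delta>) * m" by (simp add: q algebra_simps)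
    then have "occ new m t \<le> (\<phi> + \<delta>) * m" for t using occ_new_le_new_max[of m t] by linarith
    then have "trans_op m (occ new m) s \<le> trans_op m (\<lambda>t. (\<phi> + \<delta>) * m) s" by (intro trans_op_mono)
    then show ?thesis by simp
  qed
  \<comment> \<open>The first half of the horizon has at most \<phi> m / 4 expected new sites and
    the second at most (\<phi> + \<delta>) m. So 2 (\<phi> - \<delta>) \<le> 5 \<phi> / 4 +
    \<delta>, that is \<phi> \<le> 4 \<delta>, against \<delta> \<le> \<phi> / 12.\<close>
  ultimately have "(\<phi> - \<delta>) * n \<le> m * (\<phi> / 4) + (\<phi> + \<delta>) * m" using s upper by linarith
  then have "m * ((\<phi> - \<delta>) * 2) \<le> m * (\<phi> / 4 + (\<phi> + \<delta>))" by (simp add: n_def algebra_simps)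
  then have "(\<phi> - \<delta>) * 2 \<le> \<phi> / 4 + (\<phi> + \<delta>)" using m0 by (subst (asm) mult_le_cancel_left_pos) auto
  then show False using \<delta>(2) \<phi>(1) by argo
qed

theorem new_max_sublinear: "(\<lambda>n. new_max n / n) \<longlonglongrightarrow> 0"
proof (rule LIMSEQ_I)
  fix e :: real assume e: "0 < e"
  obtain b where b: "b \<ge> 1" "new_max b \<le> e / 2 * b"
    using growth_approx[of "e / 2"] e by (auto simp: growth_eq_0)
  obtain n0 :: nat where n0: "2 * b / e < n0" using reals_Archimedean2 by blast
  show "\<exists>n0. \<forall>n\<ge>n0. norm (new_max n / n - 0) < e"
  proof (intro exI[of _ n0] allI impI)
    fix n assume "n \<ge> n0"
    then have "2 * b / e < n" using n0 by linarith
    then have n: "real b < e / 2 * n" "n > 0" using e b by (auto simp: field_simps intro: Nat.gr0I)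
    have "new_max n \<le> new_max (n div b * b) + new_max (n mod b)"
      using new_max_add[of "n div b * b" "n mod b"] by simp
    also have "new_max (n div b * b) \<le> (n div b) * new_max b" by (rule new_max_mult)
    also have "\<dots> \<le> (n div b) * (e / 2 * b)" using b by (intro mult_left_mono) auto
    also have "\<dots> = e / 2 * real (n div b * b)" by simp
    also have "\<dots> \<le> e / 2 * n" using e by (intro mult_left_mono of_nat_mono) auto
    also have "new_max (n mod b) \<le> b"
      using new_max_le[of "n mod b"] mod_less_divisor[of b n] b by linarith
    finally have "new_max n < e * n" using n by (simp add: field_simps)
    then show "norm (new_max n / n - 0) < e" using n new_max_nonneg[of n] by (simp add: field_simps)
  qed
qed

section \<open>Weak convergence from Lipschitz functionals\<close>

text \<open>The Pasch-Hausdorff envelope: for bounded \<open>F\<close> it is the largest minorant on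
  \<open>S\<close> that is Lipschitz with constant \<open>j\<close>.\<close>

definition lipschitz_envelope :: "'c set \<Rightarrow> ('c \<Rightarrow> 'c \<Rightarrow> real) \<Rightarrow> ('c \<Rightarrow> real) \<Rightarrow> nat \<Rightarrow> 'c \<Rightarrow> real" where
  "lipschitz_envelope S d F j x = (INF y\<in>S. F y + real j * d x y)"

context Metric_space
begin

context
  fixes F :: "'a \<Rightarrow> real" and c :: real
  assumes F: "\<And>x. x \<in> M \<Longrightarrow> \<bar>F x\<bar> \<le> c"
begin

lemma envelope_bdd_below: "bdd_below ((\<lambda>y. F y + real j * d x y) ` M)"
proof (rule bdd_belowI2[of _ "- c"])
  fix y assume "y \<in> M"
  moreover have "0 \<le> real j * d x y" by simp
  ultimately show "- c \<le> F y + real j * d x y" using F[of y] by linarith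
qed

lemma envelope_le: "x \<in> M \<Longrightarrow> lipschitz_envelope M d F j x \<le> F x"
  unfolding lipschitz_envelope_def
  using cINF_lower[OF envelope_bdd_below, of x j x] by simp

lemma envelope_ge: "x \<in> M \<Longrightarrow> - c \<le> lipschitz_envelope M d F j x"
  unfolding lipschitz_envelope_def
proof (rule cINF_greatest)
  fix y assume "x \<in> M" "y \<in> M"
  moreover have "0 \<le> real j * d x y" by simp
  ultimately show "- c \<le> F y + real j * d x y" using F[of y] by linarith
qed auto

lemma envelope_abs_le: "x \<in> M \<Longrightarrow> \<bar>lipschitz_envelope M d F j x\<bar> \<le> c"
  using envelope_le[of x j] envelope_ge[of x j] F[of x] by linarith

lemma envelope_lipschitz:
  assumes "x \<in> M" "x' \<in> M"
  shows "\<bar>lipschitz_envelope M d F j x - lipschitz_envelope M d F j x'\<bar> \<le> real j * d x x'"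
proof -
  have "lipschitz_envelope M d F j x - real j * d x x' \<le> lipschitz_envelope M d F j x'"
    if "x \<in> M" "x' \<in> M" for x x'
  proof -
    have "lipschitz_envelope M d F j x - real j * d x x' \<le> F y + real j * d x' y" if y: "y \<in> M" for y
    proof -
      have "lipschitz_envelope M d F j x \<le> F y + real j * d x y"
        unfolding lipschitz_envelope_def by (rule cINF_lower[OF envelope_bdd_below y])
      also have "\<dots> \<le> F y + real j * (d x x' + d x' y)"
        using triangle[of x x' y] \<open>x \<in> M\<close> \<open>x' \<in> M\<close> y by (intro add_left_mono mult_left_mono) auto
      finally show ?thesis by (simp add: algebra_simps)
    qed
    then show ?thesis
      unfolding lipschitz_envelope_def[of M d F j x'] using \<open>x' \<in> M\<close> by (intro cINF_greatest) auto
  qed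
  from this[OF assms] this[OF assms(2,1)] show ?thesis by (simp add: commute abs_le_iff)
qed

text \<open>Lower semicontinuity at \<open>x\<close> suffices: points at distance at least
  \<open>r\<close> pay \<open>j * r\<close>, which eventually exceeds the oscillation
  \<open>2 * c\<close>, and at nearer points \<open>F\<close> cannot drop far below
  \<open>F x\<close>.\<close>

lemma envelope_tendsto:
  assumes x: "x \<in> M" and lsc: "\<And>e. e > 0 \<Longrightarrow> \<exists>r>0. \<forall>y\<in>M. d x y < r \<longrightarrow> F x - e \<le> F y"
  shows "(\<lambda>j. lipschitz_envelope M d F j x) \<longlonglongrightarrow> F x"
proof (rule LIMSEQ_I)
  fix e :: real assume "e > 0"
  then obtain r where r: "r > 0" "\<And>y. y \<in> M \<Longrightarrow> d x y < r \<Longrightarrow> F x - e / 2 \<le> F y"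
    using lsc[of "e / 2"] by auto
  obtain j0 :: nat where j0: "2 * c / r \<le> j0" using real_arch_simple by blast
  show "\<exists>j0. \<forall>j\<ge>j0. norm (lipschitz_envelope M d F j x - F x) < e"
  proof (intro exI[of _ j0] allI impI)
    fix j assume "j \<ge> j0"
    then have "2 * c / r \<le> j" using j0 by linarith
    then have jr: "2 * c \<le> j * r" using r by (simp add: field_simps)
    have "F x - e / 2 \<le> lipschitz_envelope M d F j x"
      unfolding lipschitz_envelope_def
    proof (rule cINF_greatest)
      fix y assume y: "y \<in> M"
      show "F x - e / 2 \<le> F y + real j * d x y"
      proof (cases "d x y < r")
        case True
        then show ?thesis using r(2)[OF y] mult_nonneg_nonneg[OF of_nat_0_le_iff nonneg, of j x y] by linarith
      next
        case False
        then have "real j * r \<le> real j * d x y" by (intro mult_left_mono) auto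
        then show ?thesis using jr F[OF y] F[OF x] \<open>e > 0\<close> by linarith
      qed
    qed (use x in auto)
    then show "norm (lipschitz_envelope M d F j x - F x) < e"
      using envelope_le[OF x, of j] \<open>e > 0\<close> by simp
  qed
qed

end

text \<open>The indicator of an open set is lower semicontinuous, hence the pointwise limit of its
  envelopes; so bounded Lipschitz functions are enough to test measurability.\<close>

lemma borel_of_measurableI:
  assumes Y: "Y \<in> space N \<rightarrow> M"
    and meas: "\<And>f c L. (\<And>x. x \<in> M \<Longrightarrow> \<bar>f x\<bar> \<le> c) \<Longrightarrow> (\<And>x y. x \<in> M \<Longrightarrow> y \<in> M \<Longrightarrow> \<bar>f x - f y\<bar> \<le> L * d x y) \<Longrightarrow>
      (\<lambda>\<omega>. f (Y \<omega>)) \<in> borel_measurable N"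
  shows "Y \<in> N \<rightarrow>\<^sub>M borel_of mtopology"
  unfolding borel_of_def
proof (rule measurable_measure_of)
  show "{U. openin mtopology U} \<subseteq> Pow (topspace mtopology)"
    by (auto dest!: openin_subset)
  show "Y \<in> space N \<rightarrow> topspace mtopology" using Y by simp
  fix U assume "U \<in> {U. openin mtopology U}"
  then have U: "openin mtopology U" by simp
  define F where "F = (\<lambda>x. indicator U x :: real)"
  have F: "\<bar>F x\<bar> \<le> 1" for x by (simp add: F_def indicator_def)
  have lim: "(\<lambda>j. lipschitz_envelope M d F j x) \<longlonglongrightarrow> F x" if x: "x \<in> M" for x
  proof (rule envelope_tendsto[of F 1])
    fix e :: real assume e: "e > 0"
    show "\<exists>r>0. \<forall>y\<in>M. d x y < r \<longrightarrow> F x - e \<le> F y"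
    proof (cases "x \<in> U")
      case True
      then obtain r where "r > 0" "mball x r \<subseteq> U" using U by (auto simp: openin_mtopology)
      then show ?thesis using e x by (intro exI[of _ r]) (auto simp: F_def in_mball subset_iff)
    next
      case False
      then show ?thesis using e by (intro exI[of _ 1]) (auto simp: F_def indicator_def)
    qed
  qed (use x F in auto)
  have "(\<lambda>\<omega>. lipschitz_envelope M d F j (Y \<omega>)) \<in> borel_measurable N" for j
    by (rule meas[of _ 1 "real j"]) (auto intro: envelope_abs_le[OF F] envelope_lipschitz[OF F])
  moreover have "(\<lambda>j. lipschitz_envelope M d F j (Y \<omega>)) \<longlonglongrightarrow> F (Y \<omega>)" if "\<omega> \<in> space N" for \<omega>
    using Y that by (intro lim) auto
  ultimately have "(\<lambda>\<omega>. F (Y \<omega>)) \<in> borel_measurable N"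
    by (rule borel_measurable_LIMSEQ_real[rotated])
  then have "(\<lambda>\<omega>. F (Y \<omega>)) -` {1} \<inter> space N \<in> sets N" by (rule measurable_sets) simp
  also have "(\<lambda>\<omega>. F (Y \<omega>)) -` {1} \<inter> space N = Y -` U \<inter> space N"
    by (auto simp: F_def indicator_def)
  finally show "Y -` U \<inter> space N \<in> sets N" .
qed

text \<open>A Lipschitz minorant of \<open>F\<close> with nearly the same integral under the limit
  law bounds the limit inferior from below, and the same for \<open>- F\<close> bounds the limit
  superior from above. The condition \<open>measX\<close> on all functions fits paths that are
  determined by a discrete random variable.\<close>

lemma converges_weaklyI:
  assumes P: "prob_space P" and N: "prob_space N"
    and X: "\<And>n. X n \<in> space P \<rightarrow> M" and Y: "Y \<in> space N \<rightarrow> M"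
    and measX: "\<And>n f. (\<lambda>\<omega>. f (X n \<omega>) :: real) \<in> borel_measurable P"
    and measY: "\<And>f c L. (\<And>x. x \<in> M \<Longrightarrow> \<bar>f x\<bar> \<le> c) \<Longrightarrow> (\<And>x y. x \<in> M \<Longrightarrow> y \<in> M \<Longrightarrow> \<bar>f x - f y\<bar> \<le> L * d x y) \<Longrightarrow>
      (\<lambda>\<omega>. f (Y \<omega>)) \<in> borel_measurable N"
    and lim: "\<And>f c L. L \<ge> 0 \<Longrightarrow> (\<And>x. x \<in> M \<Longrightarrow> \<bar>f x\<bar> \<le> c) \<Longrightarrow> (\<And>x y. x \<in> M \<Longrightarrow> y \<in> M \<Longrightarrow> \<bar>f x - f y\<bar> \<le> L * d x y) \<Longrightarrow>
      (\<lambda>n. \<integral>\<omega>. f (X n \<omega>) \<partial>P) \<longlonglongrightarrow> (\<integral>\<omega>. f (Y \<omega>) \<partial>N)"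
  shows "converges_weakly mtopology P X N Y"
proof -
  interpret P: prob_space P by (rule P)
  interpret N: prob_space N by (rule N)
  have lower: "eventually (\<lambda>n. (\<integral>\<omega>. F (Y \<omega>) \<partial>N) - e < (\<integral>\<omega>. F (X n \<omega>) \<partial>P)) sequentially"
    if F: "continuous_map mtopology euclideanreal F" "\<And>x. x \<in> M \<Longrightarrow> \<bar>F x\<bar> \<le> c" and e: "e > 0" for F c e
  proof -
    define E where "E = lipschitz_envelope M d F"
    have E: "\<bar>E j x\<bar> \<le> c" "E j x \<le> F x" if "x \<in> M" for j x
      unfolding E_def using that F(2) by (auto intro: envelope_abs_le envelope_le)
    have Elip: "\<bar>E j x - E j y\<bar> \<le> real j * d x y" if "x \<in> M" "y \<in> M" for j x y
      unfolding E_def using that F(2) by (rule_tac envelope_lipschitz)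
    have limE: "(\<lambda>j. E j x) \<longlonglongrightarrow> F x" if x: "x \<in> M" for x
      unfolding E_def
    proof (rule envelope_tendsto[of F c])
      fix e :: real assume e: "e > 0"
      have "openin mtopology {y \<in> topspace mtopology. F y \<in> {F x - e<..}}"
        using F(1) by (rule openin_continuous_map_preimage) simp
      moreover have "x \<in> {y \<in> topspace mtopology. F y \<in> {F x - e<..}}" using e x by simp
      ultimately obtain r where "r > 0" "mball x r \<subseteq> {y \<in> topspace mtopology. F y \<in> {F x - e<..}}"
        unfolding openin_mtopology by meson
      then show "\<exists>r>0. \<forall>y\<in>M. d x y < r \<longrightarrow> F x - e \<le> F y"
        using x by (intro exI[of _ r]) (auto simp: in_mball subset_iff intro: less_imp_le)
    qed (use x F in auto)
    have mE: "(\<lambda>\<omega>. E j (Y \<omega>)) \<in> borel_measurable N" for j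
      using E Elip by (intro measY[of "E j" c "real j"]) auto
    have mF: "(\<lambda>\<omega>. F (Y \<omega>)) \<in> borel_measurable N"
    proof (rule borel_measurable_LIMSEQ_real[OF _ mE])
      show "(\<lambda>j. E j (Y \<omega>)) \<longlonglongrightarrow> F (Y \<omega>)" if "\<omega> \<in> space N" for \<omega>
        using Y that by (intro limE) auto
    qed
    have "(\<lambda>j. \<integral>\<omega>. E j (Y \<omega>) \<partial>N) \<longlonglongrightarrow> (\<integral>\<omega>. F (Y \<omega>) \<partial>N)"
    proof (rule integral_dominated_convergence[where w = "\<lambda>_. c"])
      show "AE \<omega> in N. (\<lambda>j. E j (Y \<omega>)) \<longlonglongrightarrow> F (Y \<omega>)" using Y limE by (intro AE_I2) auto
      show "AE \<omega> in N. norm (E j (Y \<omega>)) \<le> c" for j using Y E by (intro AE_I2) auto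
    qed (use mE mF in auto)
    then have "eventually (\<lambda>j. (\<integral>\<omega>. F (Y \<omega>) \<partial>N) - e < (\<integral>\<omega>. E j (Y \<omega>) \<partial>N)) sequentially"
      using e by (intro order_tendstoD) auto
    then obtain j where j: "(\<integral>\<omega>. F (Y \<omega>) \<partial>N) - e < (\<integral>\<omega>. E j (Y \<omega>) \<partial>N)"
      by (auto simp: eventually_sequentially)
    have "(\<lambda>n. \<integral>\<omega>. E j (X n \<omega>) \<partial>P) \<longlonglongrightarrow> (\<integral>\<omega>. E j (Y \<omega>) \<partial>N)"
      using E Elip by (intro lim[of "real j" "E j" c]) auto
    then have "eventually (\<lambda>n. (\<integral>\<omega>. F (Y \<omega>) \<partial>N) - e < (\<integral>\<omega>. E j (X n \<omega>) \<partial>P)) sequentially"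
      using j by (intro order_tendstoD)
    then show ?thesis
    proof (rule eventually_mono)
      fix n assume "(\<integral>\<omega>. F (Y \<omega>) \<partial>N) - e < (\<integral>\<omega>. E j (X n \<omega>) \<partial>P)"
      also have "(\<integral>\<omega>. E j (X n \<omega>) \<partial>P) \<le> (\<integral>\<omega>. F (X n \<omega>) \<partial>P)"
      proof (rule integral_mono)
        show "integrable P (\<lambda>\<omega>. E j (X n \<omega>))" "integrable P (\<lambda>\<omega>. F (X n \<omega>))"
          using E(1) F(2) X[of n] by (intro P.integrable_const_bound[where B = c] measX AE_I2; auto)+
        show "E j (X n \<omega>) \<le> F (X n \<omega>)" if "\<omega> \<in> space P" for \<omega>
          using that E(2) X[of n] by auto
      qed
      finally show "(\<integral>\<omega>. F (Y \<omega>) \<partial>N) - e < (\<integral>\<omega>. F (X n \<omega>) \<partial>P)" .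
    qed
  qed
  have "(\<lambda>n. \<integral>\<omega>. F (X n \<omega>) \<partial>P) \<longlonglongrightarrow> (\<integral>\<omega>. F (Y \<omega>) \<partial>N)"
    if F: "continuous_map mtopology euclideanreal F" "bounded (F ` topspace mtopology)" for F
  proof -
    obtain c where c: "\<And>x. x \<in> M \<Longrightarrow> \<bar>F x\<bar> \<le> c" using F(2) by (auto simp: bounded_iff)
    have mF: "continuous_map mtopology euclideanreal (\<lambda>x. - F x)"
      using F(1) by (rule continuous_map_minus)
    show ?thesis
    proof (rule order_tendstoI)
      fix a assume "a < (\<integral>\<omega>. F (Y \<omega>) \<partial>N)"
      then show "eventually (\<lambda>n. a < (\<integral>\<omega>. F (X n \<omega>) \<partial>P)) sequentially"
        using lower[OF F(1) c, of "(\<integral>\<omega>. F (Y \<omega>) \<partial>N) - a"] by simp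
    next
      fix a assume "(\<integral>\<omega>. F (Y \<omega>) \<partial>N) < a"
      then show "eventually (\<lambda>n. (\<integral>\<omega>. F (X n \<omega>) \<partial>P) < a) sequentially"
        using lower[OF mF, of c "a - (\<integral>\<omega>. F (Y \<omega>) \<partial>N)"] c by simp
    qed
  qed
  moreover have "X n \<in> P \<rightarrow>\<^sub>M borel_of mtopology" for n
    using X measX by (rule borel_of_measurableI)
  moreover have "Y \<in> N \<rightarrow>\<^sub>M borel_of mtopology"
    using Y measY by (rule borel_of_measurableI)
  ultimately show ?thesis unfolding converges_weakly_def by blast
qed

end

section \<open>Functionals of finitely many independent coordinates\<close>

definition lipschitz_coords :: "nat \<Rightarrow> ((nat \<Rightarrow> real) \<Rightarrow> real) \<Rightarrow> bool" where
  "lipschitz_coords k G \<longleftrightarrow> (\<exists>L\<ge>0. \<forall>x y. \<bar>G x - G y\<bar> \<le> L * (\<Sum>i<k. \<bar>x i - y i\<bar>))"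

lemma lipschitz_coords_tendsto:
  assumes "lipschitz_coords k G" "\<And>i. i < k \<Longrightarrow> ((\<lambda>n. x n i) \<longlongrightarrow> y i) A"
  shows "((\<lambda>n. G (x n)) \<longlongrightarrow> G y) A"
proof -
  obtain L where L: "L \<ge> 0" "\<And>x y. \<bar>G x - G y\<bar> \<le> L * (\<Sum>i<k. \<bar>x i - y i\<bar>)"
    using assms(1) by (auto simp: lipschitz_coords_def)
  have "((\<lambda>n. L * (\<Sum>i<k. \<bar>x n i - y i\<bar>)) \<longlongrightarrow> L * (\<Sum>i<k. \<bar>y i - y i\<bar>)) A"
    using assms(2) by (intro tendsto_intros) auto
  then have "((\<lambda>n. L * (\<Sum>i<k. \<bar>x n i - y i\<bar>)) \<longlongrightarrow> 0) A" by simp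
  then have "((\<lambda>n. G (x n) - G y) \<longlongrightarrow> 0) A"
    by (rule Lim_null_comparison[rotated]) (use L in auto)
  then show ?thesis by (simp add: LIM_zero_iff)
qed

lemma lipschitz_coords_cong:
  assumes "lipschitz_coords k G" "\<And>i. i < k \<Longrightarrow> x i = y i"
  shows "G x = G y"
proof -
  obtain L where "L \<ge> 0" "\<bar>G x - G y\<bar> \<le> L * (\<Sum>i<k. \<bar>x i - y i\<bar>)"
    using assms(1) by (auto simp: lipschitz_coords_def)
  then show ?thesis using assms(2) by simp
qed

lemma lipschitz_coords_measurable:
  assumes G: "lipschitz_coords k G" and X: "\<And>i. i < k \<Longrightarrow> X i \<in> borel_measurable M"
  shows "(\<lambda>\<omega>. G (\<lambda>i. X i \<omega>)) \<in> borel_measurable M"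
proof -
  have "continuous_on UNIV G"
    unfolding continuous_on_def
  proof
    fix x :: "nat \<Rightarrow> real"
    have "((\<lambda>y. y i) \<longlongrightarrow> x i) (at x within UNIV)" for i
      using continuous_on_product_coordinates[of i] unfolding continuous_on_def by blast
    then show "(G \<longlongrightarrow> G x) (at x within UNIV)" by (intro lipschitz_coords_tendsto[OF G])
  qed
  then have 1: "G \<in> borel_measurable borel" by (rule borel_measurable_continuous_onI)
  have 2: "(\<lambda>\<omega> i. if i < k then X i \<omega> else 0) \<in> borel_measurable M"
  proof (rule measurable_coordinatewise_then_product)
    show "(\<lambda>\<omega>. if i < k then X i \<omega> else 0) \<in> borel_measurable M" for i
      by (cases "i < k") (use X in auto)
  qed
  have "(\<lambda>\<omega>. G (\<lambda>i. if i < k then X i \<omega> else 0)) \<in> borel_measurable M"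
    by (rule measurable_compose[OF 2 1])
  also have "(\<lambda>\<omega>. G (\<lambda>i. if i < k then X i \<omega> else 0)) = (\<lambda>\<omega>. G (\<lambda>i. X i \<omega>))"
    by (intro ext lipschitz_coords_cong[OF G]) simp
  finally show ?thesis .
qed

lemma integral_indep_eq_PiM:
  assumes "prob_space P" "prob_space.indep_vars P (\<lambda>_. borel) X {..<k}" and k: "k > 0"
    and G: "lipschitz_coords k G"
  shows "(\<integral>\<omega>. G (\<lambda>i. X i \<omega>) \<partial>P) = (\<integral>x. G x \<partial>PiM {..<k} (\<lambda>i. distr P borel (X i)))"
proof -
  interpret prob_space P by fact
  have rv: "X i \<in> borel_measurable P" if "i < k" for i
    using assms(2) that unfolding indep_vars_def by auto
  have G': "G \<in> borel_measurable (PiM {..<k} (\<lambda>_. borel))"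
    by (rule lipschitz_coords_measurable[OF G]) (auto intro: measurable_component_singleton)
  have r: "(\<lambda>\<omega>. \<lambda>i\<in>{..<k}. X i \<omega>) \<in> P \<rightarrow>\<^sub>M PiM {..<k} (\<lambda>_. borel)"
    by (rule measurable_restrict) (use rv in auto)
  have "(\<integral>\<omega>. G (\<lambda>i. X i \<omega>) \<partial>P) = (\<integral>\<omega>. G (\<lambda>i\<in>{..<k}. X i \<omega>) \<partial>P)"
    by (intro Bochner_Integration.integral_cong refl lipschitz_coords_cong[OF G]) simp
  also have "\<dots> = (\<integral>x. G x \<partial>distr P (PiM {..<k} (\<lambda>_. borel)) (\<lambda>\<omega>. \<lambda>i\<in>{..<k}. X i \<omega>))"
    by (rule integral_distr[symmetric, OF r G'])
  also have "distr P (PiM {..<k} (\<lambda>_. borel)) (\<lambda>\<omega>. \<lambda>i\<in>{..<k}. X i \<omega>) = PiM {..<k} (\<lambda>i. distr P borel (X i))"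
    using assms(2) k rv by (subst (asm) indep_vars_iff_distr_eq_PiM') auto
  finally show ?thesis .
qed

text \<open>Skorohod's representation is applied to every coordinate by itself. On the product of
  the \<open>k\<close> probability spaces the representing variables are independent, so their joint
  laws are the original ones, and they converge at every point; dominated convergence
  finishes.\<close>

lemma indep_weak_conv_integral:
  assumes P: "prob_space P" and N: "prob_space N" and k: "k > 0"
    and X: "\<And>n. prob_space.indep_vars P (\<lambda>_. borel) (X n) {..<k}"
    and Y: "prob_space.indep_vars N (\<lambda>_. borel) Y {..<k}"
    and conv: "\<And>i. i < k \<Longrightarrow> weak_conv_m (\<lambda>n. distr P borel (X n i)) (distr N borel (Y i))"
    and G: "lipschitz_coords k G" "\<And>x. \<bar>G x\<bar> \<le> c"
  shows "(\<lambda>n. \<integral>\<omega>. G (\<lambda>i. X n i \<omega>) \<partial>P) \<longlonglongrightarrow> (\<integral>\<omega>. G (\<lambda>i. Y i \<omega>) \<partial>N)"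
proof -
  interpret P: prob_space P by fact
  interpret N: prob_space N by fact
  have rX: "X n i \<in> borel_measurable P" if "i < k" for n i
    using X[of n] that unfolding P.indep_vars_def by auto
  have rY: "Y i \<in> borel_measurable N" if "i < k" for i
    using Y that unfolding N.indep_vars_def by auto
  define R where "R = (\<lambda>i (\<Omega> :: real measure) S (S' :: real \<Rightarrow> real). prob_space \<Omega> \<and> (\<forall>n. S n \<in> measurable \<Omega> borel) \<and>
    (\<forall>n. distr \<Omega> borel (S n) = distr P borel (X n i)) \<and>
    S' \<in> measurable \<Omega> lborel \<and> distr \<Omega> borel S' = distr N borel (Y i) \<and>
    (\<forall>x\<in>space \<Omega>. (\<lambda>n. S n x) \<longlonglongrightarrow> S' x))"
  have "\<exists>\<Omega> S S'. R i \<Omega> S S'" if "i < k" for i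
    unfolding R_def using that conv[OF that] rX rY
    by (intro Skorohod) (auto intro!: P.real_distribution_distr N.real_distribution_distr)
  then obtain \<Omega> S S' where R: "\<And>i. i < k \<Longrightarrow> R i (\<Omega> i) (S i) (S' i)" by metis
  have S: "prob_space (\<Omega> i)" "S i n \<in> borel_measurable (\<Omega> i)"
    "distr (\<Omega> i) borel (S i n) = distr P borel (X n i)"
    "S' i \<in> borel_measurable (\<Omega> i)" "distr (\<Omega> i) borel (S' i) = distr N borel (Y i)"
    "x \<in> space (\<Omega> i) \<Longrightarrow> (\<lambda>n. S i n x) \<longlonglongrightarrow> S' i x" if "i < k" for i n x
    using R[OF that] unfolding R_def measurable_lborel1 by blast+
  define Q where "Q = PiM {..<k} \<Omega>"
  interpret Q: prob_space Q
    unfolding Q_def by (rule prob_space_PiM) (use S(1) in auto)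
  \<comment> \<open>Under the product measure the integral depends only on the marginal laws; this
    serves the approximating variables and the limit alike.\<close>
  have repr: "(\<integral>\<omega>. G (\<lambda>i. Z i (\<omega> i)) \<partial>Q) = (\<integral>x. G x \<partial>PiM {..<k} \<mu>)"
    if Z: "\<And>i. i < k \<Longrightarrow> Z i \<in> borel_measurable (\<Omega> i)" "\<And>i. i < k \<Longrightarrow> distr (\<Omega> i) borel (Z i) = \<mu> i" for Z \<mu>
  proof -
    have "Q.indep_vars (\<lambda>_. borel) (\<lambda>i \<omega>. Z i (\<omega> i)) {..<k}"
    proof (rule Q.indep_vars_compose2[where M' = \<Omega> and X = "\<lambda>i \<omega>. \<omega> i"])
      show "Q.indep_vars \<Omega> (\<lambda>i \<omega>. \<omega> i) {..<k}"
      proof (subst Q.indep_vars_iff_distr_eq_PiM')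
        have "distr Q (PiM {..<k} \<Omega>) (\<lambda>\<omega>. \<lambda>i\<in>{..<k}. \<omega> i) = distr Q Q (\<lambda>\<omega>. \<omega>)"
          by (rule distr_cong) (auto simp: Q_def space_PiM PiE_def extensional_restrict)
        also have "\<dots> = PiM {..<k} \<Omega>" by (simp add: Q_def distr_id2)
        also have "\<dots> = PiM {..<k} (\<lambda>i. distr Q (\<Omega> i) (\<lambda>\<omega>. \<omega> i))"
          unfolding Q_def by (intro PiM_cong distr_PiM_component[symmetric]) (use S(1) in auto)
        finally show "distr Q (PiM {..<k} \<Omega>) (\<lambda>\<omega>. \<lambda>i\<in>{..<k}. \<omega> i) =
            PiM {..<k} (\<lambda>i. distr Q (\<Omega> i) (\<lambda>\<omega>. \<omega> i))" .
      qed (use k in \<open>auto simp: Q_def\<close>)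
    qed (use Z in auto)
    from integral_indep_eq_PiM[OF Q.prob_space_axioms this k G(1)]
    have "(\<integral>\<omega>. G (\<lambda>i. Z i (\<omega> i)) \<partial>Q) = (\<integral>x. G x \<partial>PiM {..<k} (\<lambda>i. distr Q borel (\<lambda>\<omega>. Z i (\<omega> i))))" .
    also have "PiM {..<k} (\<lambda>i. distr Q borel (\<lambda>\<omega>. Z i (\<omega> i))) = PiM {..<k} \<mu>"
    proof (rule PiM_cong)
      fix i assume i: "i \<in> {..<k}"
      have c: "(\<lambda>\<omega>. \<omega> i) \<in> Q \<rightarrow>\<^sub>M \<Omega> i" unfolding Q_def using i by (rule measurable_component_singleton)
      have "distr Q borel (\<lambda>\<omega>. Z i (\<omega> i)) = distr (distr Q (\<Omega> i) (\<lambda>\<omega>. \<omega> i)) borel (Z i)"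
        using Z(1) i by (subst distr_distr[OF _ c]) (auto simp: comp_def)
      also have "distr Q (\<Omega> i) (\<lambda>\<omega>. \<omega> i) = \<Omega> i"
        unfolding Q_def using i S(1) by (intro distr_PiM_component) auto
      finally show "distr Q borel (\<lambda>\<omega>. Z i (\<omega> i)) = \<mu> i" using Z(2) i by simp
    qed simp
    finally show ?thesis .
  qed
  have "(\<lambda>n. \<integral>\<omega>. G (\<lambda>i. S i n (\<omega> i)) \<partial>Q) \<longlonglongrightarrow> (\<integral>\<omega>. G (\<lambda>i. S' i (\<omega> i)) \<partial>Q)"
  proof (rule integral_dominated_convergence[where w = "\<lambda>_. c"])
    have mc: "(\<lambda>\<omega>. Z (\<omega> i)) \<in> borel_measurable Q" if "i < k" "Z \<in> borel_measurable (\<Omega> i)" for i and Z :: "real \<Rightarrow> real"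
      unfolding Q_def using that by (intro measurable_compose[OF measurable_component_singleton]) auto
    show "(\<lambda>\<omega>. G (\<lambda>i. S i n (\<omega> i))) \<in> borel_measurable Q" for n
      by (rule lipschitz_coords_measurable[OF G(1), where X = "\<lambda>i \<omega>. S i n (\<omega> i)"]) (rule mc[OF _ S(2)])
    show "(\<lambda>\<omega>. G (\<lambda>i. S' i (\<omega> i))) \<in> borel_measurable Q"
      by (rule lipschitz_coords_measurable[OF G(1), where X = "\<lambda>i \<omega>. S' i (\<omega> i)"]) (rule mc[OF _ S(4)])
    show "AE \<omega> in Q. (\<lambda>n. G (\<lambda>i. S i n (\<omega> i))) \<longlonglongrightarrow> G (\<lambda>i. S' i (\<omega> i))"
    proof (rule AE_I2)
      fix \<omega> assume "\<omega> \<in> space Q"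
      then have "\<omega> i \<in> space (\<Omega> i)" if "i < k" for i using that by (auto simp: Q_def space_PiM)
      then show "(\<lambda>n. G (\<lambda>i. S i n (\<omega> i))) \<longlonglongrightarrow> G (\<lambda>i. S' i (\<omega> i))"
        by (intro lipschitz_coords_tendsto[OF G(1)] S(6))
    qed
  qed (use G(2) in auto)
  moreover have "(\<integral>\<omega>. G (\<lambda>i. S i n (\<omega> i)) \<partial>Q) = (\<integral>\<omega>. G (\<lambda>i. X n i \<omega>) \<partial>P)" for n
    using repr[of "\<lambda>i. S i n" "\<lambda>i. distr P borel (X n i)", OF S(2,3)] integral_indep_eq_PiM[OF P X k G(1), of n]
    by metis
  moreover have "(\<integral>\<omega>. G (\<lambda>i. S' i (\<omega> i)) \<partial>Q) = (\<integral>\<omega>. G (\<lambda>i. Y i \<omega>) \<partial>N)"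
    using repr[of S' "\<lambda>i. distr N borel (Y i)", OF S(4,5)] integral_indep_eq_PiM[OF N Y k G(1)]
    by metis
  ultimately show ?thesis by simp
qed

section \<open>Step functions and Brownian motion\<close>

lemma skorokhod_dist_le_sup:
  assumes f: "f \<in> cadlag T" "g \<in> cadlag T" and e: "0 \<le> e"
    and d: "\<And>t. t \<in> {0..T} \<Longrightarrow> dist (f t) (g t) \<le> e"
  shows "skorokhod_dist T f g \<le> e"
proof (rule field_le_epsilon)
  fix r :: real assume r: "0 < r"
  have "e + r \<in> skorokhod_bounds T f g"
    unfolding skorokhod_bounds_def using id_time_changes e r d by (force intro!: bexI[of _ "\<lambda>t. t"])
  then show "skorokhod_dist T f g \<le> e + r" by (rule skorokhod_dist_le[OF f])
qed

text \<open>Covers the rescaled walk, with \<open>a = n\<close>, and step functions on a grid, with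
  \<open>a = k / T\<close>.\<close>

lemma floor_step_cadlag:
  fixes v :: "nat \<Rightarrow> 'b::metric_space"
  assumes a: "0 \<le> a"
  shows "(\<lambda>t\<in>{0..T}. v (nat \<lfloor>a * t\<rfloor>)) \<in> cadlag T"
proof -
  define f where "f = (\<lambda>t\<in>{0..T}. v (nat \<lfloor>a * t\<rfloor>))"
  have lin: "((\<lambda>s. a * s) \<longlongrightarrow> a * t) (at t within S)" for t S
    by (intro tendsto_intros)
  have "(f \<longlongrightarrow> f t) (at_right t)" if t: "t \<in> {0..<T}" for t
  proof (rule tendsto_eventually)
    have "eventually (\<lambda>s. a * s < real_of_int \<lfloor>a * t\<rfloor> + 1) (at_right t)"
      by (rule order_tendstoD[OF lin]) linarith
    moreover have "eventually (\<lambda>s. t < s \<and> s < T) (at_right t)"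
      using t by (intro eventually_at_rightI[of t T]) auto
    ultimately show "eventually (\<lambda>s. f s = f t) (at_right t)"
    proof eventually_elim
      case (elim s)
      have "a * t \<le> a * s" using a elim by (intro mult_left_mono) auto
      then have "\<lfloor>a * s\<rfloor> = \<lfloor>a * t\<rfloor>" using elim(1) by (intro floor_unique) linarith+
      then show ?case using t elim by (simp add: f_def)
    qed
  qed
  moreover have "\<exists>l. (f \<longlongrightarrow> l) (at_left t)" if t: "t \<in> {0<..T}" for t
  proof (rule exI, rule tendsto_eventually)
    \<comment> \<open>Just to the left of \<open>t\<close> the floor of \<open>a * s\<close> is the
      ceiling of \<open>a * t\<close> minus 1, at a jump as well. For \<open>a = 0\<close>, which
      happens for \<open>n = 0\<close>, the floor is constantly 0.\<close>
    define c where "c = (if a = 0 then 0 else \<lceil>a * t\<rceil> - 1)"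
    have "eventually (\<lambda>s. \<lfloor>a * s\<rfloor> = c) (at_left t)"
    proof (cases "a = 0")
      case False
      then have a0: "a > 0" using a by simp
      have "eventually (\<lambda>s. real_of_int c < a * s) (at_left t)"
        by (rule order_tendstoD[OF lin]) (use False in \<open>simp add: c_def; linarith\<close>)
      moreover have "eventually (\<lambda>s. s < t) (at_left t)" by (simp add: eventually_at_filter)
      ultimately show ?thesis
      proof eventually_elim
        case (elim s)
        have "a * s < a * t" using a0 elim by simp
        also have "a * t \<le> real_of_int c + 1" using False unfolding c_def by simp
        finally show ?case using elim by (intro floor_unique) linarith+
      qed
    qed (simp add: c_def)
    moreover have "eventually (\<lambda>s. 0 < s \<and> s < t) (at_left t)"
      using t by (intro eventually_at_leftI[of 0]) auto
    ultimately show "eventually (\<lambda>s. f s = v (nat c)) (at_left t)"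
      by eventually_elim (use t in \<open>auto simp: f_def\<close>)
  qed
  ultimately show ?thesis unfolding f_def[symmetric] by (simp add: cadlag_def) (simp add: f_def)
qed

text \<open>For positive \<open>k\<close> and \<open>T\<close> the index \<open>k\<close> is reached
  exactly at t = T, so the values \<open>v 0\<close>, ..., \<open>v k\<close> enter.\<close>

definition step_path :: "real \<Rightarrow> nat \<Rightarrow> (nat \<Rightarrow> real) \<Rightarrow> real \<Rightarrow> real \<times> real" where
  "step_path T k v = (\<lambda>t\<in>{0..T}. (v (nat \<lfloor>real k / T * t\<rfloor>), 0))"

lemma step_path_cadlag: "T > 0 \<Longrightarrow> step_path T k v \<in> cadlag T"
  unfolding step_path_def using floor_step_cadlag[of "real k / T" "\<lambda>j. (v j, 0)" T] by simp

lemma grid_index_le: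
  assumes "T > 0" "t \<in> {0..T}"
  shows "nat \<lfloor>real k / T * t\<rfloor> \<le> k"
proof -
  have "real k / T * t \<le> real k / T * T" using assms by (intro mult_left_mono) auto
  then have "real k / T * t \<le> real k" using assms by simp
  then show ?thesis by (simp add: floor_le_iff nat_le_iff)
qed

definition skorokhod_lipschitz :: "real \<Rightarrow> real \<Rightarrow> ((real \<Rightarrow> real \<times> real) \<Rightarrow> real) \<Rightarrow> bool" where
  "skorokhod_lipschitz T L F \<longleftrightarrow> 0 \<le> L \<and>
    (\<forall>f\<in>cadlag T. \<forall>g\<in>cadlag T. \<bar>F f - F g\<bar> \<le> L * skorokhod_dist T f g)"

lemma skorokhod_lipschitz_sup:
  assumes "skorokhod_lipschitz T L F" "f \<in> cadlag T" "g \<in> cadlag T" "0 \<le> e"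
    "\<And>t. t \<in> {0..T} \<Longrightarrow> dist (f t) (g t) \<le> e"
  shows "\<bar>F f - F g\<bar> \<le> L * e"
proof -
  have "\<bar>F f - F g\<bar> \<le> L * skorokhod_dist T f g" "0 \<le> L"
    using assms by (auto simp: skorokhod_lipschitz_def)
  moreover have "L * skorokhod_dist T f g \<le> L * e"
    using assms \<open>0 \<le> L\<close> by (intro mult_left_mono skorokhod_dist_le_sup)
  ultimately show ?thesis by simp
qed

text \<open>A step path given by its values has \<open>k + 1\<close> of them because of the endpoint
  T; given by partial sums of increments it involves only \<open>k\<close> increments.\<close>

lemma lipschitz_coords_step_path:
  assumes "skorokhod_lipschitz T L F" "T > 0"
  shows "lipschitz_coords (Suc k) (\<lambda>v. F (step_path T k v))"
    "lipschitz_coords k (\<lambda>x. F (step_path T k (\<lambda>j. \<Sum>i<j. x i)))"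
proof -
  have L: "L \<ge> 0" using assms by (simp add: skorokhod_lipschitz_def)
  show "lipschitz_coords (Suc k) (\<lambda>v. F (step_path T k v))"
    unfolding lipschitz_coords_def
  proof (intro exI[of _ L] conjI allI L)
    fix x y :: "nat \<Rightarrow> real"
    show "\<bar>F (step_path T k x) - F (step_path T k y)\<bar> \<le> L * (\<Sum>i<Suc k. \<bar>x i - y i\<bar>)"
    proof (rule skorokhod_lipschitz_sup[OF assms(1) step_path_cadlag[OF assms(2)] step_path_cadlag[OF assms(2)]])
      fix t assume t: "t \<in> {0..T}"
      have "dist (step_path T k x t) (step_path T k y t) =
          \<bar>x (nat \<lfloor>real k / T * t\<rfloor>) - y (nat \<lfloor>real k / T * t\<rfloor>)\<bar>"
        using t by (simp add: step_path_def dist_Pair_Pair dist_real_def)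
      also have "\<dots> \<le> (\<Sum>i<Suc k. \<bar>x i - y i\<bar>)"
        using grid_index_le[OF assms(2) t, of k]
        by (intro member_le_sum[of _ _ "\<lambda>i. \<bar>x i - y i\<bar>"]) auto
      finally show "dist (step_path T k x t) (step_path T k y t) \<le> (\<Sum>i<Suc k. \<bar>x i - y i\<bar>)" .
    qed (auto intro: sum_nonneg)
  qed
  show "lipschitz_coords k (\<lambda>x. F (step_path T k (\<lambda>j. \<Sum>i<j. x i)))"
    unfolding lipschitz_coords_def
  proof (intro exI[of _ L] conjI allI L)
    fix x y :: "nat \<Rightarrow> real"
    show "\<bar>F (step_path T k (\<lambda>j. \<Sum>i<j. x i)) - F (step_path T k (\<lambda>j. \<Sum>i<j. y i))\<bar> \<le> L * (\<Sum>i<k. \<bar>x i - y i\<bar>)"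
    proof (rule skorokhod_lipschitz_sup[OF assms(1) step_path_cadlag[OF assms(2)] step_path_cadlag[OF assms(2)]])
      fix t assume t: "t \<in> {0..T}"
      define j where "j = nat \<lfloor>real k / T * t\<rfloor>"
      have "dist (step_path T k (\<lambda>j. \<Sum>i<j. x i) t) (step_path T k (\<lambda>j. \<Sum>i<j. y i) t) =
          \<bar>(\<Sum>i<j. x i - y i)\<bar>"
        using t by (simp add: step_path_def dist_Pair_Pair dist_real_def j_def sum_subtractf)
      also have "\<dots> \<le> (\<Sum>i<j. \<bar>x i - y i\<bar>)" by (rule sum_abs)
      also have "\<dots> \<le> (\<Sum>i<k. \<bar>x i - y i\<bar>)"
        using grid_index_le[OF assms(2) t, of k] by (intro sum_mono2) (auto simp: j_def)
      finally show "dist (step_path T k (\<lambda>j. \<Sum>i<j. x i) t) (step_path T k (\<lambda>j. \<Sum>i<j. y i) t)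
        \<le> (\<Sum>i<k. \<bar>x i - y i\<bar>)" .
    qed (auto intro: sum_nonneg)
  qed
qed

lemma continuous_path_cadlag:
  assumes "continuous_on {0..T} f"
  shows "(\<lambda>t\<in>{0..T}. (f t, 0 :: real)) \<in> cadlag T"
proof -
  have lim: "((\<lambda>t\<in>{0..T}. (f t, 0 :: real)) \<longlongrightarrow> (f t, 0)) (at t within {0..T})" if t: "t \<in> {0..T}" for t
  proof -
    have "((\<lambda>t. (f t, 0 :: real)) \<longlongrightarrow> (f t, 0)) (at t within {0..T})"
      using assms t by (intro tendsto_Pair tendsto_const) (simp add: continuous_on_def)
    then show ?thesis
      by (rule Lim_transform_eventually) (auto simp: eventually_at_filter)
  qed
  have "((\<lambda>t\<in>{0..T}. (f t, 0 :: real)) \<longlongrightarrow> (f t, 0)) (at_right t)" if "t \<in> {0..<T}" for t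
    using lim[of t] that at_within_Icc_at_right[of 0 T] at_within_interior[of t "{0..T}"]
    by (cases "t = 0") (auto intro: tendsto_within_subset[of _ _ t UNIV])
  moreover have "((\<lambda>t\<in>{0..T}. (f t, 0 :: real)) \<longlongrightarrow> (f t, 0)) (at_left t)" if "t \<in> {0<..T}" for t
    using lim[of t] that at_within_Icc_at_left[of 0 T] at_within_interior[of t "{0..T}"]
    by (cases "t = T") (auto intro: tendsto_within_subset[of _ _ t UNIV])
  ultimately show ?thesis unfolding cadlag_def by force
qed

lemma step_path_tendsto:
  assumes F: "skorokhod_lipschitz T L F" and T: "T > 0" and f: "continuous_on {0..T} f"
  shows "(\<lambda>k. F (step_path T (Suc k) (\<lambda>j. f (real j * T / Suc k)))) \<longlonglongrightarrow> F (\<lambda>t\<in>{0..T}. (f t, 0))"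
proof (rule LIMSEQ_I)
  fix e :: real assume e: "0 < e"
  have L: "L \<ge> 0" using F by (simp add: skorokhod_lipschitz_def)
  define r where "r = e / (2 * (L + 1))"
  have r: "r > 0" "L * r < e" using e L by (simp_all add: r_def field_simps add_nonneg_pos)
  have "uniformly_continuous_on {0..T} f" using f by (intro compact_uniformly_continuous) auto
  then obtain d where d: "d > 0" "\<And>s t. s \<in> {0..T} \<Longrightarrow> t \<in> {0..T} \<Longrightarrow> dist s t < d \<Longrightarrow> dist (f s) (f t) < r"
    unfolding uniformly_continuous_on_def using r(1) by metis
  obtain k0 :: nat where k0: "T / d < k0" using reals_Archimedean2 by blast
  show "\<exists>k0. \<forall>k\<ge>k0. norm (F (step_path T (Suc k) (\<lambda>j. f (real j * T / Suc k))) - F (\<lambda>t\<in>{0..T}. (f t, 0))) < e"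
  proof (intro exI[of _ k0] allI impI)
    fix k assume "k \<ge> k0"
    define K where "K = real (Suc k)"
    have K: "K > 0" "T / d < K" using k0 \<open>k \<ge> k0\<close> by (auto simp: K_def)
    then have Td: "T / K < d" using d by (simp add: field_simps)
    have "\<bar>F (step_path T (Suc k) (\<lambda>j. f (real j * T / K))) - F (\<lambda>t\<in>{0..T}. (f t, 0))\<bar> \<le> L * r"
    proof (rule skorokhod_lipschitz_sup[OF F step_path_cadlag[OF T] continuous_path_cadlag[OF f]])
      fix t assume t: "t \<in> {0..T}"
      define j where "j = nat \<lfloor>K / T * t\<rfloor>"
      have "0 \<le> K / T * t" using t K T by simp
      then have j: "real j \<le> K / T * t" "K / T * t < real j + 1" by (simp_all add: j_def)
      have "real j * T / K \<le> t" using j(1) K T by (simp add: field_simps)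
      moreover have "t < real j * T / K + T / K" using j(2) K T by (simp add: field_simps)
      ultimately have "dist (f (real j * T / K)) (f t) < r"
        using t T K Td by (intro d(2)) (auto simp: dist_real_def intro: order_trans)
      then show "dist (step_path T (Suc k) (\<lambda>j. f (real j * T / K)) t) ((\<lambda>t\<in>{0..T}. (f t, 0)) t) \<le> r"
        using t unfolding step_path_def by (simp add: dist_Pair_Pair j_def K_def)
    qed (use r in simp)
    then show "norm (F (step_path T (Suc k) (\<lambda>j. f (real j * T / Suc k))) - F (\<lambda>t\<in>{0..T}. (f t, 0))) < e"
      using r(2) by (simp add: K_def)
  qed
qed

section \<open>Functionals and increments of Brownian motion\<close>

context
  fixes N :: "'b measure" and B :: "real \<Rightarrow> 'b \<Rightarrow> real" and T :: real
  assumes B: "standard_brownian_motion N B" and T: "T > 0"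
begin

interpretation N: prob_space N
  using B by (simp add: standard_brownian_motion_def)

lemma brownian_random_variable: "0 \<le> t \<Longrightarrow> B t \<in> borel_measurable N"
  using B by (simp add: standard_brownian_motion_def)

lemma brownian_continuous:
  assumes "\<omega> \<in> space N"
  shows "continuous_on {0..T} (\<lambda>t. B t \<omega>)"
proof -
  have "continuous_on {0..} (\<lambda>t. B t \<omega>)" using B assms by (simp add: standard_brownian_motion_def)
  then show ?thesis by (rule continuous_on_subset) auto
qed

text \<open>The functional of a continuous path is the limit of functionals of its values on finer
  and finer grids, each of which involves finitely many random variables.\<close>

lemma brownian_functional_measurable:
  assumes F: "skorokhod_lipschitz T L F"
  shows "(\<lambda>\<omega>. F (\<lambda>t\<in>{0..T}. (B t \<omega>, 0))) \<in> borel_measurable N"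
proof (rule borel_measurable_LIMSEQ_real)
  show "(\<lambda>k. F (step_path T (Suc k) (\<lambda>j. B (real j * T / Suc k) \<omega>))) \<longlonglongrightarrow> F (\<lambda>t\<in>{0..T}. (B t \<omega>, 0))"
    if "\<omega> \<in> space N" for \<omega>
    using step_path_tendsto[OF F T brownian_continuous[OF that]] .
  show "(\<lambda>\<omega>. F (step_path T (Suc k) (\<lambda>j. B (real j * T / Suc k) \<omega>))) \<in> borel_measurable N" for k
    by (rule lipschitz_coords_measurable[OF lipschitz_coords_step_path(1)[OF F T],
          where X = "\<lambda>j. B (real j * T / Suc k)"])
       (use T in \<open>auto intro!: brownian_random_variable\<close>)
qed

definition brownian_increment :: "nat \<Rightarrow> nat \<Rightarrow> 'b \<Rightarrow> real" where
  "brownian_increment k i \<omega> = B (real (Suc i) * T / k) \<omega> - B (real i * T / k) \<omega>"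

text \<open>The partial sums of the increments are the values of \<open>B\<close> on the grid minus
  \<open>B 0\<close>, which vanishes almost surely; hence the convergence under the integral is
  almost sure.\<close>

lemma brownian_step_integral:
  assumes F: "skorokhod_lipschitz T L F" and c: "\<And>f. f \<in> cadlag T \<Longrightarrow> \<bar>F f\<bar> \<le> c"
  shows "(\<lambda>k. \<integral>\<omega>. F (step_path T (Suc k) (\<lambda>j. \<Sum>i<j. brownian_increment (Suc k) i \<omega>)) \<partial>N)
    \<longlonglongrightarrow> (\<integral>\<omega>. F (\<lambda>t\<in>{0..T}. (B t \<omega>, 0)) \<partial>N)"
proof (rule integral_dominated_convergence[where w = "\<lambda>_. c"])
  show "(\<lambda>\<omega>. F (\<lambda>t\<in>{0..T}. (B t \<omega>, 0))) \<in> borel_measurable N"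
    by (rule brownian_functional_measurable[OF F])
  show "(\<lambda>\<omega>. F (step_path T (Suc k) (\<lambda>j. \<Sum>i<j. brownian_increment (Suc k) i \<omega>))) \<in> borel_measurable N" for k
    by (rule lipschitz_coords_measurable[OF lipschitz_coords_step_path(2)[OF F T],
          where X = "brownian_increment (Suc k)"])
       (use T in \<open>auto simp: brownian_increment_def[abs_def] intro!: borel_measurable_diff brownian_random_variable\<close>)
  have "AE \<omega> in N. B 0 \<omega> = 0" using B by (simp add: standard_brownian_motion_def)
  then show "AE \<omega> in N. (\<lambda>k. F (step_path T (Suc k) (\<lambda>j. \<Sum>i<j. brownian_increment (Suc k) i \<omega>)))
      \<longlonglongrightarrow> F (\<lambda>t\<in>{0..T}. (B t \<omega>, 0))"
    using AE_space
  proof eventually_elim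
    case (elim \<omega>)
    have "(\<Sum>i<j. brownian_increment (Suc k) i \<omega>) = B (real j * T / Suc k) \<omega>" for j k
      unfolding brownian_increment_def
      using sum_lessThan_telescope[of "\<lambda>i. B (real i * T / Suc k) \<omega>" j] elim by simp
    then show ?case using step_path_tendsto[OF F T brownian_continuous[OF elim(2)]] by simp
  qed
qed (use c step_path_cadlag[OF T] in auto)

lemma brownian_increments_indep:
  assumes "k > 0"
  shows "N.indep_vars (\<lambda>_. borel) (brownian_increment k) {..<k}"
proof -
  define t where "t = (\<lambda>i::nat. real i * T / k)"
  have "0 \<le> t 0 \<and> (\<forall>i<k. t i \<le> t (Suc i))" using T assms by (simp add: t_def field_simps)
  then have "N.indep_vars (\<lambda>_. borel) (\<lambda>i \<omega>. B (t (Suc i)) \<omega> - B (t i) \<omega>) {..<k}"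
    using B unfolding standard_brownian_motion_def by blast
  then show ?thesis by (simp add: t_def brownian_increment_def[abs_def])
qed

lemma brownian_increment_char:
  assumes k: "k > 0"
  shows "char (distr N borel (brownian_increment k i)) \<xi> = complex_of_real (exp (- (T / k * \<xi>\<^sup>2) / 2))"
proof -
  define \<sigma> where "\<sigma> = sqrt (T / k)"
  have \<sigma>: "\<sigma> > 0" "\<sigma>\<^sup>2 = T / k" using T k by (auto simp: \<sigma>_def)
  have "0 \<le> real i * T / k \<and> real i * T / k < real (Suc i) * T / k"
    using T k by (simp add: divide_strict_right_mono)
  then have "distributed N lborel (\<lambda>\<omega>. B (real (Suc i) * T / k) \<omega> - B (real i * T / k) \<omega>)
      (normal_density 0 (sqrt (real (Suc i) * T / k - real i * T / k)))"
    using B unfolding standard_brownian_motion_def by blast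
  also have "real (Suc i) * T / k - real i * T / k = T / k" by (simp add: add_divide_distrib algebra_simps)
  finally have d: "distributed N lborel (brownian_increment k i) (normal_density 0 \<sigma>)"
    by (simp add: \<sigma>_def brownian_increment_def[abs_def])
  then have d': "distributed N lborel (\<lambda>\<omega>. (brownian_increment k i \<omega> - 0) / \<sigma>) std_normal_density"
    using N.normal_standard_normal_convert[of \<sigma> "brownian_increment k i" 0] \<sigma>(1) by blast
  have rv: "brownian_increment k i \<in> borel_measurable N"
    using d by (auto simp: distributed_def)
  have "distr N lborel (\<lambda>\<omega>. brownian_increment k i \<omega> / \<sigma>) = std_normal_distribution"
    using d' by (simp add: distributed_def)
  moreover have "distr N lborel (\<lambda>\<omega>. brownian_increment k i \<omega> / \<sigma>) = distr N borel (\<lambda>\<omega>. brownian_increment k i \<omega> / \<sigma>)"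
    by (rule distr_cong) auto
  ultimately have std: "distr N borel (\<lambda>\<omega>. brownian_increment k i \<omega> / \<sigma>) = std_normal_distribution" by simp
  have "char (distr N borel (brownian_increment k i)) \<xi> = (CLINT \<omega>|N. iexp (\<xi> * brownian_increment k i \<omega>))"
    unfolding char_def using rv by (subst integral_distr) auto
  also have "\<dots> = (CLINT \<omega>|N. iexp ((\<sigma> * \<xi>) * (brownian_increment k i \<omega> / \<sigma>)))"
    using \<sigma>(1) by simp
  also have "\<dots> = char (distr N borel (\<lambda>\<omega>. brownian_increment k i \<omega> / \<sigma>)) (\<sigma> * \<xi>)"
    unfolding char_def using rv by (subst integral_distr) auto
  also have "\<dots> = complex_of_real (exp (- (\<sigma> * \<xi>)\<^sup>2 / 2))"
    unfolding std char_std_normal_distribution by simp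
  finally show ?thesis using \<sigma>(2) by (simp add: power_mult_distrib)
qed

end

text \<open>The characteristic function of a sum of \<open>m n\<close> fair signs divided by sqrt n,
  so this is the central limit theorem for the coins. It follows from n ln cos (\<xi> / sqrt n)
  tending to - \<xi>^2 / 2, valid once the cosine is positive.\<close>

lemma cos_power_tendsto:
  fixes \<xi> s :: real and m :: "nat \<Rightarrow> nat"
  assumes "(\<lambda>n. m n / n) \<longlonglongrightarrow> s"
  shows "(\<lambda>n. cos (\<xi> / sqrt n) ^ m n) \<longlonglongrightarrow> exp (- (s * \<xi>\<^sup>2) / 2)"
proof -
  have 1: "(\<lambda>n::nat. n * ln (cos (\<xi> / sqrt n))) \<longlonglongrightarrow> - (\<xi>\<^sup>2 / 2)"
    unfolding power2_eq_square by real_asymp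
  have "(\<lambda>n. exp ((m n / n) * (n * ln (cos (\<xi> / sqrt n))))) \<longlonglongrightarrow> exp (s * (- (\<xi>\<^sup>2 / 2)))"
    by (intro tendsto_intros assms 1)
  moreover have "eventually (\<lambda>n. exp ((m n / n) * (n * ln (cos (\<xi> / sqrt n)))) = cos (\<xi> / sqrt n) ^ m n) sequentially"
  proof -
    have "(\<lambda>n::nat. cos (\<xi> / sqrt n)) \<longlonglongrightarrow> 1" by real_asymp
    then have "eventually (\<lambda>n::nat. 0 < cos (\<xi> / sqrt n)) sequentially" by (rule order_tendstoD) simp
    then show ?thesis using eventually_gt_at_top[of 0]
    proof eventually_elim
      case (elim n)
      then show ?case by (simp add: exp_of_nat_mult)
    qed
  qed
  ultimately have "(\<lambda>n. cos (\<xi> / sqrt n) ^ m n) \<longlonglongrightarrow> exp (s * (- (\<xi>\<^sup>2 / 2)))"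
    by (rule Lim_transform_eventually)
  then show ?thesis by simp
qed

section \<open>The law of the walk\<close>

abbreviation origin :: "state" where
  "origin \<equiv> ({}, (0, 0))"

definition walk_path :: "bool list \<Rightarrow> site list" where
  "walk_path w = map (\<lambda>j. snd (run origin (take j w))) [0..<Suc (length w)]"

lemma length_walk_path [simp]: "length (walk_path w) = Suc (length w)"
  by (simp add: walk_path_def)

lemma nth_walk_path: "j \<le> length w \<Longrightarrow> walk_path w ! j = snd (run origin (take j w))"
  unfolding walk_path_def by (subst nth_map) (simp_all del: upt_Suc)

lemma walk_path_snoc: "walk_path (u @ [b]) = walk_path u @ [snd (step (run origin u) b)]"
proof -
  have "map (\<lambda>j. snd (run origin (take j (u @ [b])))) [0..<Suc (length u)] = walk_path u"
    unfolding walk_path_def by (intro map_cong refl) auto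
  then show ?thesis by (simp add: walk_path_def)
qed

text \<open>The old sites of the chain are the positions at earlier times, which is the criterion
  used in \<open>berw_steps\<close>.\<close>

lemma fst_run_origin: "fst (run origin u) = (\<lambda>j. walk_path u ! j) ` {..<length u}"
proof (induction u rule: rev_induct)
  case (snoc b u)
  have "fst (run origin (u @ [b])) = insert (snd (run origin u)) (fst (run origin u))"
    by (simp add: step_def)
  also have "snd (run origin u) = walk_path (u @ [b]) ! length u"
    by (subst nth_walk_path) auto
  also have "fst (run origin u) = (\<lambda>j. walk_path (u @ [b]) ! j) ` {..<length u}"
    unfolding snoc by (intro image_cong) (auto simp: walk_path_snoc nth_append)
  finally show ?case by (simp add: lessThan_Suc)
qed simp

lemma pmf_berw_kernel:
  assumes "length u = m" "walk_path u = zs"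
  shows "pmf (berw_kernel (\<lambda>k. zs ! k) m) y =
    (of_bool (snd (step (run origin u) True) = y) + of_bool (snd (step (run origin u) False) = y)) / 2"
proof -
  define p where "p = zs ! m"
  have p: "p = snd (run origin u)" unfolding p_def using assms nth_walk_path[of m u] by simp
  have old: "p \<in> fst (run origin u) \<longleftrightarrow> p \<in> (\<lambda>k. zs ! k) ` {..<m}"
    using assms fst_run_origin[of u] by simp
  define a b where "a = snd (step (run origin u) True)" and "b = snd (step (run origin u) False)"
  have "(\<lambda>s. p + s) ` berw_steps (\<lambda>k. zs ! k) m = {a, b}"
    using old by (auto simp: berw_steps_def a_def b_def step_def sgn_of_def p_def[symmetric] p)
  moreover have "a \<noteq> b" by (simp add: a_def b_def step_def sgn_of_def prod_eq_iff)
  moreover have "finite (berw_steps (\<lambda>k. zs ! k) m)" "berw_steps (\<lambda>k. zs ! k) m \<noteq> {}"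
    by (auto simp: berw_steps_def)
  ultimately have "berw_kernel (\<lambda>k. zs ! k) m = pmf_of_set {a, b}"
    unfolding berw_kernel_def p_def[symmetric] by (subst map_pmf_of_set_inj) auto
  then show ?thesis using \<open>a \<noteq> b\<close> by (auto simp: a_def[symmetric] b_def[symmetric] indicator_def)
qed

definition coord_sum :: "site \<Rightarrow> real" where
  "coord_sum z = real_of_int (fst z + snd z)"

lemma coord_sum_step: "coord_sum (snd (step s b)) = coord_sum (snd s) + sgn_of b"
  by (simp add: coord_sum_def step_def)

lemma coord_sum_walk_path:
  assumes "j < length w"
  shows "coord_sum (walk_path w ! Suc j) - coord_sum (walk_path w ! j) = sgn_of (w ! j)"
  using assms by (simp add: nth_walk_path take_Suc_conv_app_nth coord_sum_step)

section \<open>Product formula and maximal inequalities for coins\<close>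

lemma coin_snoc: "coin (Suc m) F = coin m (\<lambda>u. (F (u @ [True]) + F (u @ [False])) / 2)"
  using coin_append[of m 1 F] by simp

lemma coin_prod:
  "coin m (\<lambda>w. \<Prod>j<m. g j (w ! j)) = (\<Prod>j<m. (g j True + g j False) / 2)"
proof (induction m)
  case (Suc m)
  have "coin (Suc m) (\<lambda>w. \<Prod>j<Suc m. g j (w ! j)) =
      coin m (\<lambda>u. (g m True + g m False) / 2 * (\<Prod>j<m. g j (u ! j)))"
    unfolding coin_snoc by (rule coin_cong) (simp add: nth_append algebra_simps add_divide_distrib)
  also have "\<dots> = (g m True + g m False) / 2 * coin m (\<lambda>u. \<Prod>j<m. g j (u ! j))"
    by (rule coin_cmult)
  finally show ?case unfolding Suc prod.lessThan_Suc by (simp only: mult.commute)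
qed simp

text \<open>Doob's maximal inequality for a nonnegative submartingale, by induction over the first
  step. If the level is already reached, the growth of the mean suffices; otherwise time 0 drops out
  of the event and the two successors are averaged.\<close>

lemma coin_maximal:
  assumes g: "\<And>t. 0 \<le> g t" "\<And>t. 0 \<le> gen g t" and a: "0 < a"
  shows "a * coin m (\<lambda>w. of_bool (\<exists>j\<le>m. a \<le> g (run s (take j w)))) \<le> trans_op m g s"
proof (induction m arbitrary: s)
  case 0
  then show ?case using g(1)[of s] by simp
next
  case (Suc m)
  show ?case
  proof (cases "a \<le> g s")
    case True
    have "coin (Suc m) (\<lambda>w. of_bool (\<exists>j\<le>Suc m. a \<le> g (run s (take j w)))) \<le> coin (Suc m) (\<lambda>w. 1)"
      by (rule coin_mono) simp
    then have "a * coin (Suc m) (\<lambda>w. of_bool (\<exists>j\<le>Suc m. a \<le> g (run s (take j w)))) \<le> a * 1"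
      using a by (intro mult_left_mono) auto
    also have "\<dots> \<le> g s" using True by simp
    also have "g s \<le> trans_op (Suc m) g s"
      using occ_mono[of "\<lambda>_. 0" "gen g" "Suc m" s] g(2) by (simp add: occ_dynkin)
    finally show ?thesis .
  next
    case False
    have ex: "(\<exists>j\<le>Suc m. a \<le> g (run s (take j (b # w)))) \<longleftrightarrow> (\<exists>j\<le>m. a \<le> g (run (step s b) (take j w)))" for b w
    proof -
      have "(\<exists>j\<le>Suc m. P j) \<longleftrightarrow> P 0 \<or> (\<exists>j\<le>m. P (Suc j))" for P
        by (metis Suc_le_mono le0 not0_implies_Suc)
      from this[of "\<lambda>j. a \<le> g (run s (take j (b # w)))"] False show ?thesis by simp
    qed
    have "a * coin (Suc m) (\<lambda>w. of_bool (\<exists>j\<le>Suc m. a \<le> g (run s (take j w)))) =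
      (a * coin m (\<lambda>w. of_bool (\<exists>j\<le>m. a \<le> g (run (step s True) (take j w)))) +
       a * coin m (\<lambda>w. of_bool (\<exists>j\<le>m. a \<le> g (run (step s False) (take j w))))) / 2"
      unfolding coin.simps ex by (simp add: algebra_simps)
    also have "\<dots> \<le> (trans_op m g (step s True) + trans_op m g (step s False)) / 2"
      using Suc[of "step s True"] Suc[of "step s False"] by simp
    also have "\<dots> = trans_op (Suc m) g s" by (simp add: trans_op_def)
    finally show ?thesis .
  qed
qed

text \<open>The generator of the squared height is \<open>new\<close>, so the second moment of the
  height is the expected number of new sites. Through this bound the sublinearity of
  \<open>new_max\<close> enters the limit theorem.\<close>

lemma height_maximal:
  assumes a: "0 < a"
  shows "coin m (\<lambda>w. of_bool (\<exists>j\<le>m. a \<le> \<bar>real_of_int (snd (walk_path w ! j))\<bar>)) \<le> new_max m / a\<^sup>2"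
proof -
  define h where "h = (\<lambda>z :: site. (real_of_int (snd z))\<^sup>2)"
  have "vdiff h z = 1" "hdiff h z = 0" for z
    by (simp_all add: vdiff_def hdiff_def h_def power2_eq_square field_simps)
  then have gen: "gen (\<lambda>t. h (snd t)) = new" by (simp add: gen_position fun_eq_iff)
  have "a\<^sup>2 * coin m (\<lambda>w. of_bool (\<exists>j\<le>m. a\<^sup>2 \<le> h (snd (run origin (take j w)))))
      \<le> trans_op m (\<lambda>t. h (snd t)) origin"
  proof (rule coin_maximal)
    show "0 \<le> gen (\<lambda>t. h (snd t)) t" for t by (simp add: gen new_bounds)
  qed (use a in \<open>auto simp: h_def\<close>)
  also have "\<dots> = occ new m origin" by (simp add: occ_dynkin gen) (simp add: h_def)
  also have "\<dots> \<le> new_max m" by (rule occ_new_le_new_max)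
  also have "coin m (\<lambda>w. of_bool (\<exists>j\<le>m. a\<^sup>2 \<le> h (snd (run origin (take j w))))) =
      coin m (\<lambda>w. of_bool (\<exists>j\<le>m. a \<le> \<bar>real_of_int (snd (walk_path w ! j))\<bar>))"
  proof (rule coin_cong)
    fix w :: "bool list" assume w: "length w = m"
    have "a\<^sup>2 \<le> h z \<longleftrightarrow> a \<le> \<bar>real_of_int (snd z)\<bar>" for z
      using abs_le_square_iff[of a "real_of_int (snd z)"] a by (simp add: h_def)
    then show "of_bool (\<exists>j\<le>m. a\<^sup>2 \<le> h (snd (run origin (take j w)))) =
        (of_bool (\<exists>j\<le>m. a \<le> \<bar>real_of_int (snd (walk_path w ! j))\<bar>) :: real)"
      using w by (intro arg_cong[where f = of_bool]) (auto simp: nth_walk_path)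
  qed
  finally show ?thesis using a by (simp add: pos_le_divide_eq mult.commute)
qed

text \<open>Fourth moments, because the bound will be summed over \<open>k\<close> blocks of about n
  T / k steps at a level of order sqrt n: the total is of order 1 / k, whereas second moments would
  leave order 1.\<close>

lemma coord_sum_maximal:
  assumes a: "0 < a"
  shows "coin m (\<lambda>w. of_bool (\<exists>j\<le>m. a \<le> \<bar>coord_sum (snd (run s (take j w))) - coord_sum (snd s)\<bar>))
    \<le> 3 * (real m)\<^sup>2 / a ^ 4"
proof -
  define x where "x = (\<lambda>t :: state. coord_sum (snd t) - coord_sum (snd s))"
  have step: "x (step t b) = x t + sgn_of b" for t b by (simp add: x_def coord_sum_step)
  have gen2: "gen (\<lambda>t. (x t)\<^sup>2) = (\<lambda>t. 1)"
    by (simp add: gen_def step sgn_of_def fun_eq_iff power2_eq_square field_simps)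
  have gen4: "gen (\<lambda>t. (x t) ^ 4) = (\<lambda>t. 6 * (x t)\<^sup>2 + 1)"
    by (simp add: gen_def step sgn_of_def fun_eq_iff power2_eq_square power4_eq_xxxx field_simps)
  have x0: "x s = 0" by (simp add: x_def)
  have "a ^ 4 * coin m (\<lambda>w. of_bool (\<exists>j\<le>m. a ^ 4 \<le> x (run s (take j w)) ^ 4))
      \<le> trans_op m (\<lambda>t. x t ^ 4) s"
    using a by (intro coin_maximal) (auto simp: gen4 intro!: add_nonneg_nonneg)
  also have "\<dots> = occ (\<lambda>t. 6 * (x t)\<^sup>2 + 1) m s" by (simp add: occ_dynkin gen4 x0)
  also have "\<dots> = (\<Sum>k<m. 6 * real k + 1)"
    unfolding occ_def by (simp add: trans_op_lin occ_dynkin[of _ "\<lambda>t. (x t)\<^sup>2"] gen2 x0)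
  also have "\<dots> \<le> 3 * (real m)\<^sup>2"
    by (induction m) (auto simp: power2_eq_square algebra_simps)
  also have "coin m (\<lambda>w. of_bool (\<exists>j\<le>m. a ^ 4 \<le> x (run s (take j w)) ^ 4)) =
      coin m (\<lambda>w. of_bool (\<exists>j\<le>m. a \<le> \<bar>coord_sum (snd (run s (take j w))) - coord_sum (snd s)\<bar>))"
  proof -
    have "a ^ 4 \<le> y ^ 4 \<longleftrightarrow> a \<le> \<bar>y\<bar>" for y :: real
      using power_mono_iff[of a "\<bar>y\<bar>" 4] a by (simp add: power_even_abs)
    then show ?thesis by (simp add: x_def)
  qed
  finally show ?thesis using a by (simp add: pos_le_divide_eq mult.commute)
qed

section \<open>From the transition law to coin sequences\<close>

context
  fixes M :: "'a measure" and Z :: "nat \<Rightarrow> 'a \<Rightarrow> site"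
  assumes berw: "balanced_excited_random_walk M Z"
begin

interpretation prob_space M
  using berw by (simp add: balanced_excited_random_walk_def)

definition history :: "nat \<Rightarrow> 'a \<Rightarrow> site list" where
  "history m \<omega> = map (\<lambda>k. Z k \<omega>) [0..<Suc m]"

lemma length_history [simp]: "length (history m \<omega>) = Suc m"
  by (simp add: history_def)

lemma nth_history: "j \<le> m \<Longrightarrow> history m \<omega> ! j = Z j \<omega>"
  unfolding history_def by (subst nth_map) (simp_all del: upt_Suc)

lemma history_eq_iff:
  assumes "length zs = Suc m"
  shows "history m \<omega> = zs \<longleftrightarrow> (\<forall>k\<le>m. Z k \<omega> = zs ! k)"
  unfolding list_eq_iff_nth_eq using assms by (auto simp: nth_history less_Suc_eq_le)

lemma Z_measurable [measurable]: "Z k \<in> M \<rightarrow>\<^sub>M count_space UNIV"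
  using berw by (simp add: balanced_excited_random_walk_def)

text \<open>The range is countable with the discrete structure, so every function of the history is
  measurable, functionals on path space included.\<close>

lemma history_measurable: "history m \<in> M \<rightarrow>\<^sub>M count_space UNIV"
proof (subst measurable_count_space_eq_countable)
  show "countable (UNIV :: site list set)" by simp
  have "history m -` {zs} \<inter> space M \<in> sets M" for zs
  proof (cases "length zs = Suc m")
    case True
    have "{\<omega> \<in> space M. \<forall>k\<in>{..m}. Z k \<omega> = zs ! k} \<in> sets M" by measurable
    also have "{\<omega> \<in> space M. \<forall>k\<in>{..m}. Z k \<omega> = zs ! k} = history m -` {zs} \<inter> space M"
      using history_eq_iff[OF True] by auto
    finally show ?thesis .
  next
    case False
    then have "history m -` {zs} \<inter> space M = {}" by (auto simp: history_def)
    then show ?thesis by (simp only: sets.empty_sets)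
  qed
  then show "history m \<in> space M \<rightarrow> UNIV \<and> (\<forall>zs\<in>UNIV. history m -` {zs} \<inter> space M \<in> sets M)" by simp
qed

lemma history_event [measurable]: "{\<omega> \<in> space M. P (history m \<omega>)} \<in> sets M"
  using measurable_sets[OF history_measurable, of "Collect P" m]
  by (simp add: vimage_def Int_def conj_commute)

lemma transition_law:
  "\<P>(\<omega> in M. \<forall>k\<le>n. Z k \<omega> = z k) > 0 \<Longrightarrow>
    \<P>(\<omega> in M. Z (Suc n) \<omega> = y \<bar> \<forall>k\<le>n. Z k \<omega> = z k) = pmf (berw_kernel z n) y"
  using berw unfolding balanced_excited_random_walk_def by (elim conjE allE impE)

text \<open>Induction along the path. The law of the next step is prescribed only after histories of
  positive probability; after the others both sides vanish.\<close>

lemma prob_history: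
  "length zs = Suc m \<Longrightarrow> prob {\<omega> \<in> space M. history m \<omega> = zs} = coin m (\<lambda>w. of_bool (walk_path w = zs))"
proof (induction m arbitrary: zs)
  case 0
  then obtain z where zs: "zs = [z]" by (auto simp: length_Suc_conv)
  have AE0: "AE \<omega> in M. Z 0 \<omega> = (0, 0)" using berw by (simp add: balanced_excited_random_walk_def)
  have "prob {\<omega> \<in> space M. history 0 \<omega> = zs} = of_bool (z = (0, 0))"
  proof (cases "z = (0, 0)")
    case True
    have "prob {\<omega> \<in> space M. history 0 \<omega> = zs} = 1"
      using AE0 by (subst prob_Collect_eq_1) (auto simp: zs True history_def)
    then show ?thesis using True by simp
  next
    case False
    have "prob {\<omega> \<in> space M. history 0 \<omega> = zs} = 0"
      using AE0 False by (subst prob_Collect_eq_0) (auto simp: zs history_def)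
    then show ?thesis using False by simp
  qed
  moreover have "walk_path [] = [(0, 0)]" by (simp add: walk_path_def)
  ultimately show ?case by (auto simp: zs)
next
  case (Suc m)
  obtain ys y where zs: "zs = ys @ [y]" and ys: "length ys = Suc m"
    using Suc.prems by (metis length_Suc_conv_rev)
  define z where "z = (\<lambda>k. ys ! k)"
  define p where "p = prob {\<omega> \<in> space M. history m \<omega> = ys}"
  have p: "p = \<P>(\<omega> in M. \<forall>k\<le>m. Z k \<omega> = z k)"
    unfolding p_def z_def using history_eq_iff[OF ys] by simp
  have ev: "history (Suc m) \<omega> = zs \<longleftrightarrow> Z (Suc m) \<omega> = y \<and> (\<forall>k\<le>m. Z k \<omega> = z k)" for \<omega>
    using history_eq_iff[of zs "Suc m" \<omega>] ys
    by (auto simp: zs z_def nth_append le_Suc_eq)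
  have "prob {\<omega> \<in> space M. history (Suc m) \<omega> = zs} = p * pmf (berw_kernel z m) y"
  proof (cases "p > 0")
    case True
    then have "\<P>(\<omega> in M. Z (Suc m) \<omega> = y \<bar> \<forall>k\<le>m. Z k \<omega> = z k) = pmf (berw_kernel z m) y"
      unfolding p by (rule transition_law)
    then show ?thesis using True unfolding cond_prob_def p[symmetric] ev by (simp add: field_simps)
  next
    case False
    then have "p = 0" using measure_nonneg[of M "{\<omega> \<in> space M. history m \<omega> = ys}"] by (simp add: p_def)
    moreover have "prob {\<omega> \<in> space M. history (Suc m) \<omega> = zs} \<le> p"
      unfolding p_def using history_eq_iff[OF ys] ev
      by (intro finite_measure_mono) (auto simp: z_def)
    ultimately show ?thesis using measure_nonneg[of M "{\<omega> \<in> space M. history (Suc m) \<omega> = zs}"] by simp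
  qed
  also have "\<dots> = coin m (\<lambda>u. pmf (berw_kernel z m) y * of_bool (walk_path u = ys))"
    unfolding coin_cmult p_def Suc.IH[OF ys] by simp
  also have "\<dots> = coin m (\<lambda>u. (of_bool (walk_path (u @ [True]) = zs) + of_bool (walk_path (u @ [False]) = zs)) / 2)"
  proof (rule coin_cong)
    fix u :: "bool list" assume "length u = m"
    then show "pmf (berw_kernel z m) y * of_bool (walk_path u = ys) =
        (of_bool (walk_path (u @ [True]) = zs) + of_bool (walk_path (u @ [False]) = zs)) / 2"
      using pmf_berw_kernel[of u m ys y]
      by (cases "walk_path u = ys") (simp_all add: walk_path_snoc zs z_def)
  qed
  also have "\<dots> = coin (Suc m) (\<lambda>w. of_bool (walk_path w = zs))"
    by (rule coin_snoc[symmetric])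
  finally show ?case .
qed

text \<open>Almost surely the history is one of the finitely many coin paths, so the expectation is
  a finite sum. This transfers the coin estimates to the walk.\<close>

lemma expectation_history:
  fixes f :: "site list \<Rightarrow> real"
  shows "expectation (\<lambda>\<omega>. f (history m \<omega>)) = coin m (\<lambda>w. f (walk_path w))"
proof -
  define S where "S = walk_path ` {w. length w = m}"
  have fin: "finite S" unfolding S_def
    using finite_lists_length_eq[of "UNIV :: bool set" m] by simp
  have len: "length zs = Suc m" if "zs \<in> S" for zs using that by (auto simp: S_def)
  have one: "(\<Sum>zs\<in>S. g zs * of_bool (walk_path w = zs)) = g (walk_path w)" if "length w = m" for g :: "site list \<Rightarrow> real" and w
  proof -
    have "walk_path w \<in> S" using that by (auto simp: S_def)
    then show ?thesis using fin by (simp add: of_bool_def if_distrib sum.delta' cong: if_cong)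
  qed
  have "prob {\<omega> \<in> space M. history m \<omega> \<in> S} = (\<Sum>zs\<in>S. prob {\<omega> \<in> space M. history m \<omega> = zs})"
  proof -
    have "{\<omega> \<in> space M. history m \<omega> \<in> S} = (\<Union>zs\<in>S. {\<omega> \<in> space M. history m \<omega> = zs})" by auto
    then show ?thesis
      using fin by (simp only:) (intro finite_measure_finite_Union, auto simp: disjoint_family_on_def)
  qed
  also have "\<dots> = coin m (\<lambda>w. \<Sum>zs\<in>S. 1 * of_bool (walk_path w = zs))"
    by (simp add: prob_history len coin_sum)
  also have "\<dots> = coin m (\<lambda>w. 1)" by (intro coin_cong one)
  finally have AE: "AE \<omega> in M. history m \<omega> \<in> S"
    using prob_Collect_eq_1[of "\<lambda>\<omega>. history m \<omega> \<in> S"] by simp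
  have "expectation (\<lambda>\<omega>. f (history m \<omega>)) =
      expectation (\<lambda>\<omega>. \<Sum>zs\<in>S. f zs * indicator {\<omega> \<in> space M. history m \<omega> = zs} \<omega>)"
  proof (rule integral_cong_AE)
    show "(\<lambda>\<omega>. f (history m \<omega>)) \<in> borel_measurable M"
      by (rule measurable_compose[OF history_measurable]) simp
    show "AE \<omega> in M. f (history m \<omega>) = (\<Sum>zs\<in>S. f zs * indicator {\<omega> \<in> space M. history m \<omega> = zs} \<omega>)"
      using AE AE_space
    proof eventually_elim
      case (elim \<omega>)
      then show ?case using fin by (simp add: indicator_def if_distrib sum.delta' cong: if_cong)
    qed
  qed measurable
  also have "\<dots> = (\<Sum>zs\<in>S. f zs * prob {\<omega> \<in> space M. history m \<omega> = zs})"
    by (subst Bochner_Integration.integral_sum) (auto intro!: integrable_mult_right integrable_real_indicator simp: less_top[symmetric])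
  also have "\<dots> = coin m (\<lambda>w. \<Sum>zs\<in>S. f zs * of_bool (walk_path w = zs))"
    by (simp add: prob_history len coin_sum coin_cmult)
  also have "\<dots> = coin m (\<lambda>w. f (walk_path w))" by (intro coin_cong one)
  finally show ?thesis .
qed

section \<open>The increments of the coordinate sum are independent signs\<close>

definition increment :: "nat \<Rightarrow> 'a \<Rightarrow> real" where
  "increment j \<omega> = coord_sum (Z (Suc j) \<omega>) - coord_sum (Z j \<omega>)"

lemma increment_measurable [measurable]: "increment j \<in> borel_measurable M"
proof -
  have "(\<lambda>\<omega>. coord_sum (Z k \<omega>)) \<in> borel_measurable M" for k
    by (rule measurable_compose[OF Z_measurable]) simp
  then show ?thesis unfolding increment_def[abs_def] by (intro borel_measurable_diff)
qed

lemma expectation_increments: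
  fixes g :: "nat \<Rightarrow> real \<Rightarrow> real"
  shows "expectation (\<lambda>\<omega>. \<Prod>j<m. g j (increment j \<omega>)) = (\<Prod>j<m. (g j 1 + g j (- 1)) / 2)"
proof -
  define f where "f = (\<lambda>zs. \<Prod>j<m. g j (coord_sum (zs ! Suc j) - coord_sum (zs ! j)))"
  have "(\<Prod>j<m. g j (increment j \<omega>)) = f (history m \<omega>)" for \<omega>
    unfolding f_def increment_def by (intro prod.cong refl) (simp add: nth_history)
  then have "expectation (\<lambda>\<omega>. \<Prod>j<m. g j (increment j \<omega>)) = coin m (\<lambda>w. f (walk_path w))"
    by (simp add: expectation_history)
  also have "\<dots> = coin m (\<lambda>w. \<Prod>j<m. g j (real_of_int (sgn_of (w ! j))))"
    unfolding f_def by (intro coin_cong prod.cong) (auto simp: coord_sum_walk_path)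
  also have "\<dots> = (\<Prod>j<m. (g j 1 + g j (- 1)) / 2)"
    by (subst coin_prod) (simp add: sgn_of_def)
  finally show ?thesis .
qed

lemma expectation_increment:
  fixes h :: "real \<Rightarrow> real"
  shows "expectation (\<lambda>\<omega>. h (increment j \<omega>)) = (h 1 + h (- 1)) / 2"
proof -
  have 1: "(\<Prod>i<Suc j. if i = j then f i else 1) = f j" for f :: "nat \<Rightarrow> real"
    by (simp add: prod.delta del: prod.lessThan_Suc)
  define g where "g = (\<lambda>i x. if i = j then h x else 1)"
  have "expectation (\<lambda>\<omega>. h (increment j \<omega>)) = expectation (\<lambda>\<omega>. \<Prod>i<Suc j. g i (increment i \<omega>))"
    unfolding g_def 1[of "\<lambda>i. h (increment i _)"] ..
  also have "\<dots> = (\<Prod>i<Suc j. (g i 1 + g i (- 1)) / 2)" by (rule expectation_increments)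
  also have "\<dots> = (\<Prod>i<Suc j. if i = j then (h 1 + h (- 1)) / 2 else 1)"
    by (intro prod.cong) (auto simp: g_def)
  finally show ?thesis unfolding 1 .
qed

text \<open>The product formula \<open>expectation_increments\<close> is applied to indicators of
  the given events, with the constant 1 at all other indices.\<close>

lemma increments_indep: "indep_vars (\<lambda>_. borel) increment UNIV"
  unfolding indep_vars_def2
proof (intro conjI ballI indep_setsI)
  fix A :: "nat \<Rightarrow> 'a set" and J :: "nat set"
  assume J: "finite J" and A: "\<forall>j\<in>J. A j \<in> {increment j -` A \<inter> space M |A. A \<in> sets borel}" and "J \<noteq> {}"
  then obtain S where S: "\<And>j. j \<in> J \<Longrightarrow> S j \<in> sets borel" "\<And>j. j \<in> J \<Longrightarrow> A j = increment j -` S j \<inter> space M"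
    by (simp add: Bex_def) metis
  obtain m where m: "J \<subseteq> {..<m}" using finite_nat_bounded[OF J] by auto
  define g where "g = (\<lambda>j x. if j \<in> J then indicator (S j) x else (1 :: real))"
  have "prob (\<Inter>j\<in>J. A j) = expectation (indicator (\<Inter>j\<in>J. A j))"
    by (subst Bochner_Integration.integral_indicator) (use S \<open>J \<noteq> {}\<close> in \<open>auto simp: Int_absorb2\<close>)
  also have "\<dots> = expectation (\<lambda>\<omega>. \<Prod>j<m. g j (increment j \<omega>))"
  proof (rule Bochner_Integration.integral_cong[OF refl])
    fix \<omega> assume \<omega>: "\<omega> \<in> space M"
    have "(\<Prod>j<m. g j (increment j \<omega>)) = (\<Prod>j\<in>J. g j (increment j \<omega>))"
      using m by (intro prod.mono_neutral_right) (auto simp: g_def)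
    also have "\<dots> = (\<Prod>j\<in>J. indicator (A j) \<omega>)"
      using S \<omega> by (intro prod.cong) (auto simp: g_def indicator_def)
    also have "\<dots> = indicator (\<Inter>j\<in>J. A j) \<omega>"
      using J by (induction J rule: finite_induct) (auto simp: indicator_def)
    finally show "indicator (\<Inter>j\<in>J. A j) \<omega> = (\<Prod>j<m. g j (increment j \<omega>))" ..
  qed
  also have "\<dots> = (\<Prod>j<m. (g j 1 + g j (- 1)) / 2)" by (rule expectation_increments)
  also have "\<dots> = (\<Prod>j\<in>J. (indicator (S j) 1 + indicator (S j) (- 1)) / 2)"
    using m by (intro prod.mono_neutral_cong_right) (auto simp: g_def)
  also have "\<dots> = (\<Prod>j\<in>J. prob (A j))"
  proof (rule prod.cong[OF refl])
    fix j assume j: "j \<in> J"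
    have "prob (A j) = expectation (indicator (A j))"
      by (subst Bochner_Integration.integral_indicator) (use S j in \<open>auto simp: Int_absorb2\<close>)
    also have "\<dots> = expectation (\<lambda>\<omega>. indicator (S j) (increment j \<omega>))"
      using S(2)[OF j] by (intro Bochner_Integration.integral_cong) (auto simp: indicator_def)
    finally show "(indicator (S j) 1 + indicator (S j) (- 1)) / 2 = prob (A j)"
      by (simp add: expectation_increment)
  qed
  finally show "prob (\<Inter>j\<in>J. A j) = (\<Prod>j\<in>J. prob (A j))" .
qed auto

lemma increment_sums_indep:
  assumes "mono c"
  shows "indep_vars (\<lambda>_. borel) (\<lambda>i \<omega>. (\<Sum>j\<in>{c i..<c (Suc i)}. increment j \<omega>) * a) {..<k}"
proof -
  have disj: "disjoint_family_on (\<lambda>i. {c i..<c (Suc i)}) {..<k}"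
    unfolding disjoint_family_on_def
  proof (intro ballI impI)
    fix i j :: nat assume "i \<noteq> j"
    then consider "Suc i \<le> j" | "Suc j \<le> i" by linarith
    then show "{c i..<c (Suc i)} \<inter> {c j..<c (Suc j)} = {}"
      by cases (use monoD[OF assms, of "Suc i" j] monoD[OF assms, of "Suc j" i] in auto)
  qed
  have "indep_vars (\<lambda>_. borel) (\<lambda>i \<omega>. (\<Sum>j\<in>{c i..<c (Suc i)}. (\<lambda>j\<in>{c i..<c (Suc i)}. increment j \<omega>) j) * a) {..<k}"
    by (rule indep_vars_compose2[OF indep_vars_restrict[OF increments_indep _ disj],
          where Y = "\<lambda>i x. (\<Sum>j\<in>{c i..<c (Suc i)}. x j) * a"])
       (auto intro!: borel_measurable_times borel_measurable_sum measurable_component_singleton)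
  then show ?thesis by simp
qed

text \<open>The sines of the two signs cancel, each summand contributes the cosine, and independence
  multiplies them.\<close>

lemma increment_sum_char:
  assumes I: "finite I"
  shows "char (distr M borel (\<lambda>\<omega>. (\<Sum>j\<in>I. increment j \<omega>) * a)) \<xi> = complex_of_real (cos (\<xi> * a) ^ card I)"
proof -
  have one: "char (distr M borel (\<lambda>\<omega>. increment j \<omega> * a)) \<xi> = complex_of_real (cos (\<xi> * a))" for j
  proof -
    have int: "integrable M (\<lambda>\<omega>. cos (\<xi> * (increment j \<omega> * a)))"
      "integrable M (\<lambda>\<omega>. sin (\<xi> * (increment j \<omega> * a)))"
      by (rule integrable_const_bound[where B = 1]; simp)+
    have "char (distr M borel (\<lambda>\<omega>. increment j \<omega> * a)) \<xi> = (CLINT \<omega>|M. iexp (\<xi> * (increment j \<omega> * a)))"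
      unfolding char_def by (subst integral_distr) auto
    also have "\<dots> = (CLINT \<omega>|M. complex_of_real (cos (\<xi> * (increment j \<omega> * a))) + \<i> * complex_of_real (sin (\<xi> * (increment j \<omega> * a))))"
    proof -
      have "iexp x = complex_of_real (cos x) + \<i> * complex_of_real (sin x)" for x
        by (simp add: exp_Euler cos_of_real sin_of_real)
      then show ?thesis by (simp only:)
    qed
    also have "\<dots> = complex_of_real (expectation (\<lambda>\<omega>. cos (\<xi> * (increment j \<omega> * a))))
        + \<i> * complex_of_real (expectation (\<lambda>\<omega>. sin (\<xi> * (increment j \<omega> * a))))"
      using int by (subst Bochner_Integration.integral_add) (auto simp: integral_complex_of_real)
    also have "\<dots> = complex_of_real (cos (\<xi> * a))"
      using expectation_increment[of "\<lambda>x. cos (\<xi> * (x * a))" j] expectation_increment[of "\<lambda>x. sin (\<xi> * (x * a))" j]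
      by simp
    finally show ?thesis .
  qed
  have "indep_vars (\<lambda>_. borel) (\<lambda>j \<omega>. increment j \<omega> * a) I"
    by (rule indep_vars_compose2[OF indep_vars_subset[OF increments_indep], where Y = "\<lambda>_ x. x * a"]) auto
  from char_distr_sum[OF this, of \<xi>] show ?thesis
    by (simp add: one sum_distrib_right)
qed

end

section \<open>Convergence to Brownian motion\<close>

definition grid :: "real \<Rightarrow> nat \<Rightarrow> nat \<Rightarrow> nat \<Rightarrow> nat" where
  "grid T k n i = nat \<lfloor>real n * (real i * T / k)\<rfloor>"

text \<open>A function of the list of positions, so that functionals of the path can be averaged
  over coins. For \<open>n = 0\<close> the factor is \<open>1 / 0 = 0\<close> and the path is zero
  on the interval.\<close>

definition scaled_path :: "real \<Rightarrow> nat \<Rightarrow> site list \<Rightarrow> real \<Rightarrow> real \<times> real" where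
  "scaled_path T n zs = (\<lambda>t\<in>{0..T}. (1 / sqrt (real n)) *\<^sub>R
     map_prod real_of_int real_of_int (zs ! nat \<lfloor>real n * t\<rfloor>))"

definition block_increment :: "real \<Rightarrow> nat \<Rightarrow> nat \<Rightarrow> site list \<Rightarrow> nat \<Rightarrow> real" where
  "block_increment T k n zs i =
     (coord_sum (zs ! grid T k n (Suc i)) - coord_sum (zs ! grid T k n i)) / sqrt n"

definition block_path :: "real \<Rightarrow> nat \<Rightarrow> nat \<Rightarrow> site list \<Rightarrow> real \<Rightarrow> real \<times> real" where
  "block_path T k n zs = step_path T k (\<lambda>j. \<Sum>i<j. block_increment T k n zs i)"

lemma grid_0 [simp]: "grid T k n 0 = 0"
  by (simp add: grid_def)

lemma grid_last: "k > 0 \<Longrightarrow> grid T k n k = nat \<lfloor>real n * T\<rfloor>"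
  by (simp add: grid_def)

lemma grid_mono: "T > 0 \<Longrightarrow> i \<le> j \<Longrightarrow> grid T k n i \<le> grid T k n j"
  unfolding grid_def by (intro nat_mono floor_mono mult_left_mono divide_right_mono mult_right_mono) auto

lemma grid_diff_le:
  assumes "T > 0" "k > 0"
  shows "real (grid T k n (Suc i) - grid T k n i) \<le> real n * T / k + 1"
proof -
  define x where "x = real n * (real i * T / k)"
  have "0 \<le> x" using assms by (simp add: x_def)
  have s: "real n * (real (Suc i) * T / k) = x + real n * T / k"
    by (simp add: x_def field_simps add_divide_distrib)
  have "0 \<le> x + real n * T / k" using \<open>0 \<le> x\<close> assms by simp
  then have "real (grid T k n (Suc i)) \<le> x + real n * T / k"
    unfolding grid_def s by simp
  moreover have "x - 1 \<le> real (grid T k n i)"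
    unfolding grid_def x_def[symmetric] using \<open>0 \<le> x\<close> by simp
  ultimately show ?thesis
    using grid_mono[OF assms(1), of i "Suc i" k n] by (simp add: of_nat_diff)
qed

lemma scaled_path_cadlag: "scaled_path T n zs \<in> cadlag T"
  unfolding scaled_path_def
  using floor_step_cadlag[of "real n" "\<lambda>j. (1 / sqrt (real n)) *\<^sub>R map_prod real_of_int real_of_int (zs ! j)" T]
  by simp

lemma block_path_cadlag: "T > 0 \<Longrightarrow> block_path T k n zs \<in> cadlag T"
  unfolding block_path_def by (rule step_path_cadlag)

text \<open>H is (H + V) - V, so the horizontal error is at most the change of the coordinate sum
  since the block boundary plus one height; the vertical coordinate contributes a second height,
  whence \<open>2 * e1\<close>.\<close>

lemma scaled_path_near_block_path:
  assumes T: "T > 0" and k: "k > 0" and n: "n > 0" and zs0: "zs ! 0 = (0, 0)"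
    and V: "\<And>j. j \<le> grid T k n k \<Longrightarrow> \<bar>real_of_int (snd (zs ! j))\<bar> \<le> sqrt n * e1"
    and W: "\<And>i j. i < k \<Longrightarrow> grid T k n i \<le> j \<Longrightarrow> j \<le> grid T k n (Suc i) \<Longrightarrow>
      \<bar>coord_sum (zs ! j) - coord_sum (zs ! grid T k n i)\<bar> \<le> sqrt n * e2"
    and t: "t \<in> {0..T}"
  shows "dist (scaled_path T n zs t) (block_path T k n zs t) \<le> 2 * e1 + e2"
proof -
  define j where "j = nat \<lfloor>real n * t\<rfloor>"
  define i where "i = nat \<lfloor>real k / T * t\<rfloor>"
  have sn: "sqrt n > 0" using n by simp
  have ik: "i \<le> k" unfolding i_def by (rule grid_index_le[OF T t])
  have "0 \<le> real k / T * t" using t T by simp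
  then have i: "real i \<le> real k / T * t" "real k / T * t < real i + 1" by (simp_all add: i_def)
  have it: "real i * T / k \<le> t" using i(1) T k by (simp add: field_simps)
  have gj: "grid T k n i \<le> j"
    unfolding grid_def j_def using it by (intro nat_mono floor_mono mult_left_mono) auto
  have jm: "j \<le> grid T k n k"
    unfolding grid_last[OF k] j_def using t by (intro nat_mono floor_mono mult_left_mono) auto
  have Wj: "\<bar>coord_sum (zs ! j) - coord_sum (zs ! grid T k n i)\<bar> \<le> sqrt n * e2"
  proof (cases "i < k")
    case True
    have "t \<le> real (Suc i) * T / k" using i(2) T k by (simp add: field_simps)
    then have "j \<le> grid T k n (Suc i)"
      unfolding grid_def j_def by (intro nat_mono floor_mono mult_left_mono) auto
    then show ?thesis using W True gj by blast
  next
    \<comment> \<open>Now \<open>i = k\<close>: the block boundary is the last time considered, and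
      \<open>j\<close> coincides with it.\<close>
    case False
    then have "j = grid T k n i" using gj jm ik by simp
    moreover have "0 \<le> sqrt n * e2" using order_trans[OF abs_ge_zero W[of 0 0]] k by simp
    ultimately show ?thesis by simp
  qed
  define x y where "x = real_of_int (fst (zs ! j))" and "y = real_of_int (snd (zs ! j))"
  have sum: "(\<Sum>i<i. block_increment T k n zs i) = coord_sum (zs ! grid T k n i) / sqrt n"
  proof -
    have "(\<Sum>i<i. block_increment T k n zs i) =
        (\<Sum>i<i. coord_sum (zs ! grid T k n (Suc i)) - coord_sum (zs ! grid T k n i)) / sqrt n"
      unfolding block_increment_def by (rule sum_divide_distrib[symmetric])
    then show ?thesis
      using sum_lessThan_telescope[of "\<lambda>i. coord_sum (zs ! grid T k n i)" i] zs0
      by (simp add: coord_sum_def)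
  qed
  have "dist (scaled_path T n zs t) (block_path T k n zs t) =
      dist (x / sqrt n, y / sqrt n) (coord_sum (zs ! grid T k n i) / sqrt n, 0)"
  proof -
    have "block_path T k n zs t = (coord_sum (zs ! grid T k n i) / sqrt n, 0)"
      using t unfolding block_path_def step_path_def by (simp only: restrict_apply' i_def[symmetric] sum)
    moreover have "scaled_path T n zs t = (x / sqrt n, y / sqrt n)"
      using t by (simp add: scaled_path_def x_def y_def j_def map_prod_def split_beta)
    ultimately show ?thesis by simp
  qed
  also have "\<dots> \<le> \<bar>x / sqrt n - coord_sum (zs ! grid T k n i) / sqrt n\<bar> + \<bar>y / sqrt n\<bar>"
    unfolding dist_Pair_Pair dist_real_def by (rule order_trans[OF sqrt_sum_squares_le_sum_abs]) simp
  also have "\<dots> = (\<bar>x - coord_sum (zs ! grid T k n i)\<bar> + \<bar>y\<bar>) / sqrt n"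
    using sn by (simp add: diff_divide_distrib[symmetric] add_divide_distrib)
  also have "\<dots> \<le> (2 * (sqrt n * e1) + sqrt n * e2) / sqrt n"
  proof (rule divide_right_mono)
    have "coord_sum (zs ! j) = x + y" by (simp add: coord_sum_def x_def y_def)
    then show "\<bar>x - coord_sum (zs ! grid T k n i)\<bar> + \<bar>y\<bar> \<le> 2 * (sqrt n * e1) + sqrt n * e2"
      using Wj V[OF jm] unfolding y_def[symmetric] by linarith
  qed simp
  also have "\<dots> = 2 * e1 + e2" using sn by (simp add: add_divide_distrib)
  finally show ?thesis .
qed

text \<open>Conditioning on the first \<open>c\<close> coins reduces the block to a fresh start, and
  \<open>coord_sum_maximal\<close> holds whatever the old sites are.\<close>

lemma coin_block_maximal:
  assumes "a > 0" "c \<le> d" "d \<le> m"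
  shows "coin m (\<lambda>w. of_bool (\<exists>j. c \<le> j \<and> j \<le> d \<and> a \<le> \<bar>coord_sum (walk_path w ! j) - coord_sum (walk_path w ! c)\<bar>))
    \<le> 3 * (real (d - c))\<^sup>2 / a ^ 4"
proof -
  define R where "R = (\<lambda>w. \<exists>j. c \<le> j \<and> j \<le> d \<and> a \<le> \<bar>coord_sum (walk_path w ! j) - coord_sum (walk_path w ! c)\<bar>)"
  define P where "P = (\<lambda>w. \<exists>j. c \<le> j \<and> j \<le> d \<and> a \<le> \<bar>coord_sum (snd (run origin (take j w))) - coord_sum (snd (run origin (take c w)))\<bar>)"
  have "coin m (\<lambda>w. of_bool (R w))
      = coin m (\<lambda>w. of_bool (P (take d w)))"
  proof (rule coin_cong)
    fix w :: "bool list" assume "length w = m"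
    then have "R w \<longleftrightarrow> P (take d w)"
      using assms(2,3) unfolding P_def R_def
      by (intro arg_cong[where f = Ex] ext conj_cong refl) (simp add: nth_walk_path min_absorb1)
    then show "of_bool (R w)
        = (of_bool (P (take d w)) :: real)" by simp
  qed
  also have "\<dots> = coin d (\<lambda>w. of_bool (P w))" by (rule coin_take[OF assms(3), where F = "\<lambda>w. of_bool (P w)"])
  also have "\<dots> = coin c (\<lambda>u. coin (d - c) (\<lambda>v. of_bool (P (u @ v))))" by (rule coin_split[OF assms(2)])
  also have "\<dots> \<le> coin c (\<lambda>u. 3 * (real (d - c))\<^sup>2 / a ^ 4)"
  proof (rule coin_mono)
    fix u :: "bool list" assume u: "length u = c"
    have "P (u @ v) \<longleftrightarrow> (\<exists>j\<le>d - c. a \<le> \<bar>coord_sum (snd (run (run origin u) (take j v))) - coord_sum (snd (run origin u))\<bar>)" for v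
    proof
      assume "P (u @ v)"
      then obtain j where "c \<le> j" "j \<le> d"
        "a \<le> \<bar>coord_sum (snd (run origin (take j (u @ v)))) - coord_sum (snd (run origin (take c (u @ v))))\<bar>"
        by (auto simp: P_def)
      then show "\<exists>j\<le>d - c. a \<le> \<bar>coord_sum (snd (run (run origin u) (take j v))) - coord_sum (snd (run origin u))\<bar>"
        using u by (intro exI[of _ "j - c"]) auto
    next
      assume "\<exists>j\<le>d - c. a \<le> \<bar>coord_sum (snd (run (run origin u) (take j v))) - coord_sum (snd (run origin u))\<bar>"
      then obtain j where "j \<le> d - c" "a \<le> \<bar>coord_sum (snd (run (run origin u) (take j v))) - coord_sum (snd (run origin u))\<bar>"
        by blast
      then show "P (u @ v)"
        unfolding P_def using u assms(2) by (intro exI[of _ "c + j"]) auto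
    qed
    then show "coin (d - c) (\<lambda>v. of_bool (P (u @ v))) \<le> 3 * (real (d - c))\<^sup>2 / a ^ 4"
      using coord_sum_maximal[OF assms(1), of "d - c" "run origin u"] by simp
  qed
  finally show ?thesis by (simp add: R_def)
qed

text \<open>Off the bad events the two paths differ by at most \<open>e\<close>; on them the
  functional changes by at most \<open>2 * c\<close>. The height is tested at level sqrt n * e / 4
  and each block at sqrt n * e / 2, because 2 (e / 4) + e / 2 = e. This produces the factors 4^2 =
  16 and 3 * 2^4 = 48.\<close>

definition approx_error :: "real \<Rightarrow> real \<Rightarrow> real \<Rightarrow> real \<Rightarrow> nat \<Rightarrow> nat \<Rightarrow> real" where
  "approx_error T L c e k n = L * e + 2 * c * (16 * new_max (nat \<lfloor>real n * T\<rfloor>) / (n * e\<^sup>2)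
     + k * (48 * (real n * T / k + 1)\<^sup>2 / ((real n)\<^sup>2 * e ^ 4)))"

lemma coin_approx:
  assumes F: "skorokhod_lipschitz T L F" and c: "\<And>f. f \<in> cadlag T \<Longrightarrow> \<bar>F f\<bar> \<le> c"
    and T: "T > 0" and k: "k > 0" and n: "n > 0" and e: "e > 0"
  defines "m \<equiv> nat \<lfloor>real n * T\<rfloor>"
  shows "coin m (\<lambda>w. \<bar>F (scaled_path T n (walk_path w)) - F (block_path T k n (walk_path w))\<bar>)
    \<le> approx_error T L c e k n"
proof -
  define C where "C = grid T k n"
  have m: "m = C k" unfolding m_def C_def by (rule grid_last[OF k, symmetric])
  define a1 a2 where "a1 = sqrt n * (e / 4)" and "a2 = sqrt n * (e / 2)"
  have a: "a1 > 0" "a2 > 0" using n e by (auto simp: a1_def a2_def)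
  define bad where "bad = (\<lambda>w. \<exists>j\<le>m. a1 \<le> \<bar>real_of_int (snd (walk_path w ! j))\<bar>)"
  define bad' where "bad' = (\<lambda>i w. \<exists>j. C i \<le> j \<and> j \<le> C (Suc i) \<and>
    a2 \<le> \<bar>coord_sum (walk_path w ! j) - coord_sum (walk_path w ! C i)\<bar>)"
  have c0: "0 \<le> c" using order_trans[OF abs_ge_zero c[OF block_path_cadlag[OF T]]] .
  have L: "0 \<le> L" using F by (simp add: skorokhod_lipschitz_def)
  have "coin m (\<lambda>w. \<bar>F (scaled_path T n (walk_path w)) - F (block_path T k n (walk_path w))\<bar>) \<le>
      coin m (\<lambda>w. L * e + 2 * c * (of_bool (bad w) + (\<Sum>i<k. of_bool (bad' i w))))"
  proof (rule coin_mono)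
    fix w :: "bool list"
    define zs where "zs = walk_path w"
    show "\<bar>F (scaled_path T n (walk_path w)) - F (block_path T k n (walk_path w))\<bar>
        \<le> L * e + 2 * c * (of_bool (bad w) + (\<Sum>i<k. of_bool (bad' i w)))"
    proof (cases "bad w \<or> (\<exists>i<k. bad' i w)")
      case True
      have "(1 :: real) \<le> of_bool (bad w) + (\<Sum>i<k. of_bool (bad' i w))"
      proof (cases "bad w")
        case False
        then obtain i where "i < k" "bad' i w" using True by blast
        then have "(1 :: real) \<le> (\<Sum>i<k. of_bool (bad' i w))"
          using member_le_sum[of i "{..<k}" "\<lambda>i. of_bool (bad' i w) :: real"] by simp
        then show ?thesis by simp
      qed (simp add: sum_nonneg)
      then have "2 * c * 1 \<le> 2 * c * (of_bool (bad w) + (\<Sum>i<k. of_bool (bad' i w)))"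
        using c0 by (intro mult_left_mono) auto
      moreover have "\<bar>F (scaled_path T n zs) - F (block_path T k n zs)\<bar> \<le> 2 * c"
        using c[OF scaled_path_cadlag[of T n zs]] c[OF block_path_cadlag[OF T, of k n zs]] by linarith
      moreover have "0 \<le> L * e" using L e by simp
      ultimately show ?thesis unfolding zs_def by linarith
    next
      case False
      have "dist (scaled_path T n zs t) (block_path T k n zs t) \<le> 2 * (e / 4) + e / 2" if "t \<in> {0..T}" for t
      proof (rule scaled_path_near_block_path[OF T k n _ _ _ that])
        show "zs ! 0 = (0, 0)" by (simp add: zs_def nth_walk_path)
        show "\<bar>real_of_int (snd (zs ! j))\<bar> \<le> sqrt n * (e / 4)" if "j \<le> grid T k n k" for j
          using False that unfolding bad_def zs_def a1_def m C_def by (meson linear)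
        show "\<bar>coord_sum (zs ! j) - coord_sum (zs ! grid T k n i)\<bar> \<le> sqrt n * (e / 2)"
          if "i < k" "grid T k n i \<le> j" "j \<le> grid T k n (Suc i)" for i j
          using False that unfolding bad'_def zs_def a2_def C_def by (meson linear)
      qed
      then have "\<bar>F (scaled_path T n zs) - F (block_path T k n zs)\<bar> \<le> L * e"
        using e by (intro skorokhod_lipschitz_sup[OF F scaled_path_cadlag block_path_cadlag[OF T]]) auto
      then show ?thesis using False by (simp add: zs_def)
    qed
  qed
  also have "\<dots> = L * e + 2 * c * (coin m (\<lambda>w. of_bool (bad w)) + (\<Sum>i<k. coin m (\<lambda>w. of_bool (bad' i w))))"
    by (simp only: coin_add coin_cmult coin_const coin_sum)
  also have "\<dots> \<le> L * e + 2 * c * (16 * new_max m / (n * e\<^sup>2)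
     + k * (48 * (real n * T / k + 1)\<^sup>2 / ((real n)\<^sup>2 * e ^ 4)))"
  proof (intro add_left_mono mult_left_mono add_mono)
    have "coin m (\<lambda>w. of_bool (bad w)) \<le> new_max m / a1\<^sup>2"
      unfolding bad_def by (rule height_maximal[OF a(1)])
    then show "coin m (\<lambda>w. of_bool (bad w)) \<le> 16 * new_max m / (n * e\<^sup>2)"
      by (simp add: a1_def power_mult_distrib power_divide mult.commute)
    have "coin m (\<lambda>w. of_bool (bad' i w)) \<le> 48 * (real n * T / k + 1)\<^sup>2 / ((real n)\<^sup>2 * e ^ 4)" if "i < k" for i
    proof -
      have "coin m (\<lambda>w. of_bool (bad' i w)) \<le> 3 * (real (C (Suc i) - C i))\<^sup>2 / a2 ^ 4"
        unfolding bad'_def using that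
        by (intro coin_block_maximal a) (auto simp: m C_def intro!: grid_mono[OF T])
      also have "\<dots> \<le> 3 * (real n * T / k + 1)\<^sup>2 / a2 ^ 4"
        unfolding C_def by (intro divide_right_mono mult_left_mono power_mono grid_diff_le[OF T k]) auto
      also have "a2 ^ 4 = (real n)\<^sup>2 * e ^ 4 / 16"
      proof -
        have "sqrt n ^ 4 = (real n)\<^sup>2"
          by (metis mult_2 numeral_Bit0 of_nat_0_le_iff power_add power2_eq_square real_sqrt_pow2)
        then show ?thesis by (simp add: a2_def power_mult_distrib power_divide)
      qed
      finally show ?thesis by simp
    qed
    then have "(\<Sum>i<k. coin m (\<lambda>w. of_bool (bad' i w))) \<le> (\<Sum>i<k. 48 * (real n * T / k + 1)\<^sup>2 / ((real n)\<^sup>2 * e ^ 4))"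
      by (intro sum_mono) auto
    then show "(\<Sum>i<k. coin m (\<lambda>w. of_bool (bad' i w))) \<le> k * (48 * (real n * T / k + 1)\<^sup>2 / ((real n)\<^sup>2 * e ^ 4))"
      by simp
  qed (use c0 in simp)
  finally show ?thesis by (simp add: approx_error_def m_def)
qed

lemma floor_multiple_limit:
  assumes "x \<ge> 0"
  shows "(\<lambda>n. real (nat \<lfloor>real n * x\<rfloor>) / n) \<longlonglongrightarrow> x"
proof (rule tendsto_sandwich[of "\<lambda>n. x - 1 / real n" _ _ "\<lambda>n. x"])
  have b: "real n * x - 1 \<le> real (nat \<lfloor>real n * x\<rfloor>)" "real (nat \<lfloor>real n * x\<rfloor>) \<le> real n * x" for n
    using assms by (simp_all add: of_nat_nat zero_le_mult_iff)
  show "eventually (\<lambda>n. x - 1 / real n \<le> real (nat \<lfloor>real n * x\<rfloor>) / n) sequentially"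
    using eventually_gt_at_top[of 0]
  proof eventually_elim
    case (elim n)
    then have "x - 1 / real n = (real n * x - 1) / n" by (simp add: field_simps)
    also have "\<dots> \<le> real (nat \<lfloor>real n * x\<rfloor>) / n" by (intro divide_right_mono b) auto
    finally show ?case .
  qed
  show "eventually (\<lambda>n. real (nat \<lfloor>real n * x\<rfloor>) / n \<le> x) sequentially"
    using eventually_gt_at_top[of 0]
  proof eventually_elim
    case (elim n)
    then show ?case using b(2)[of n] by (simp add: divide_le_eq mult.commute)
  qed
  show "(\<lambda>n. x - 1 / real n) \<longlonglongrightarrow> x" by real_asymp
qed simp

text \<open>The height term vanishes by \<open>new_max_sublinear\<close>. The block term keeps a
  multiple of T^2 / (e^4 k), which becomes small only when \<open>k\<close> is chosen large after
  \<open>e\<close>.\<close>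

lemma approx_error_limit:
  assumes T: "T > 0" and k: "k > 0" and e: "e > 0"
  shows "(\<lambda>n. approx_error T L c e k n) \<longlonglongrightarrow> L * e + 96 * c * T\<^sup>2 / (e ^ 4 * k)"
proof -
  define m where "m = (\<lambda>n::nat. nat \<lfloor>real n * T\<rfloor>)"
  have mn: "(\<lambda>n. real (m n) / n) \<longlonglongrightarrow> T"
    unfolding m_def using T by (intro floor_multiple_limit) auto
  have "filterlim (\<lambda>n. real (m n)) at_top sequentially"
  proof -
    have "filterlim (\<lambda>n. real (m n) / n * n) at_top sequentially"
      by (rule filterlim_tendsto_pos_mult_at_top[OF mn T filterlim_real_sequentially])
    moreover have "eventually (\<lambda>n. real (m n) / n * n = real (m n)) sequentially"
      using eventually_gt_at_top[of 0] by eventually_elim simp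
    ultimately show ?thesis by (rule filterlim_mono_eventually[OF _ order_refl order_refl])
  qed
  then have "filterlim m at_top sequentially" by (simp add: filterlim_sequentially_iff_filterlim_real)
  then have "(\<lambda>n. new_max (m n) / m n) \<longlonglongrightarrow> 0" by (rule filterlim_compose[OF new_max_sublinear])
  from tendsto_mult[OF this mn] have "(\<lambda>n. new_max (m n) / m n * (real (m n) / n)) \<longlonglongrightarrow> 0" by simp
  also have "(\<lambda>n. new_max (m n) / m n * (real (m n) / n)) = (\<lambda>n. new_max (m n) / n)"
  proof
    \<comment> \<open>When \<open>m n = 0\<close> both sides are 0, since
      \<open>new_max 0 = 0\<close> and a quotient by 0 is 0.\<close>
    fix n show "new_max (m n) / m n * (real (m n) / n) = new_max (m n) / n"
      using new_max_le[of 0] new_max_nonneg[of 0] by (cases "m n = 0") auto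
  qed
  finally have 1: "(\<lambda>n. new_max (m n) / n) \<longlonglongrightarrow> 0" .
  have 2: "(\<lambda>n. (T / k + 1 / real n)\<^sup>2) \<longlonglongrightarrow> (T / k + 0)\<^sup>2"
    by (intro tendsto_intros lim_1_over_n)
  have "(\<lambda>n. L * e + 2 * c * (16 / e\<^sup>2 * (new_max (m n) / n) + k * 48 / e ^ 4 * (T / k + 1 / real n)\<^sup>2))
      \<longlonglongrightarrow> L * e + 2 * c * (16 / e\<^sup>2 * 0 + k * 48 / e ^ 4 * (T / k + 0)\<^sup>2)"
    by (intro tendsto_intros 1 2)
  moreover have "eventually (\<lambda>n. L * e + 2 * c * (16 / e\<^sup>2 * (new_max (m n) / n) + k * 48 / e ^ 4 * (T / k + 1 / real n)\<^sup>2)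
      = approx_error T L c e k n) sequentially"
    using eventually_gt_at_top[of 0]
  proof eventually_elim
    case (elim n)
    have "(real n * T / k + 1) = real n * (T / k + 1 / real n)" using elim by (simp add: field_simps)
    then have "(real n * T / k + 1)\<^sup>2 / ((real n)\<^sup>2 * e ^ 4) = (T / k + 1 / real n)\<^sup>2 / e ^ 4"
      using elim by (simp add: power_mult_distrib)
    then have "k * 48 * ((real n * T / k + 1)\<^sup>2 / ((real n)\<^sup>2 * e ^ 4)) = k * 48 * ((T / k + 1 / real n)\<^sup>2 / e ^ 4)"
      by (simp only:)
    then have "k * (48 * (real n * T / k + 1)\<^sup>2 / ((real n)\<^sup>2 * e ^ 4)) = k * 48 / e ^ 4 * (T / k + 1 / real n)\<^sup>2"
      by (simp only: times_divide_eq_right times_divide_eq_left mult.assoc)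
    then show ?case unfolding approx_error_def m_def by simp
  qed
  ultimately have "(\<lambda>n. approx_error T L c e k n) \<longlonglongrightarrow> L * e + 2 * c * (16 / e\<^sup>2 * 0 + k * 48 / e ^ 4 * (T / k + 0)\<^sup>2)"
    by (rule Lim_transform_eventually)
  also have "L * e + 2 * c * (16 / e\<^sup>2 * 0 + k * 48 / e ^ 4 * (T / k + 0)\<^sup>2) = L * e + 96 * c * T\<^sup>2 / (e ^ 4 * k)"
    using k by (simp add: power_divide power2_eq_square)
  finally show ?thesis .
qed

text \<open>For fixed \<open>k\<close> the block path is determined by \<open>k\<close> independent
  increments, each a normalised sum of about n T / k signs; Levy's continuity theorem gives their
  convergence in law to the increments of \<open>B\<close>.\<close>

lemma block_path_integral_limit:
  assumes Z: "balanced_excited_random_walk M Z" and B: "standard_brownian_motion N B"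
    and T: "T > 0" and k: "k > 0"
    and F: "skorokhod_lipschitz T L F" and c: "\<And>f. f \<in> cadlag T \<Longrightarrow> \<bar>F f\<bar> \<le> c"
  shows "(\<lambda>n. \<integral>\<omega>. F (block_path T k n (history Z (nat \<lfloor>real n * T\<rfloor>) \<omega>)) \<partial>M)
    \<longlonglongrightarrow> (\<integral>\<omega>. F (step_path T k (\<lambda>j. \<Sum>i<j. brownian_increment B T k i \<omega>)) \<partial>N)"
proof -
  interpret M: prob_space M using Z unfolding balanced_excited_random_walk_def by (elim conjE)
  interpret N: prob_space N using B unfolding standard_brownian_motion_def by (elim conjE)
  define G where "G = (\<lambda>x. F (step_path T k (\<lambda>j. \<Sum>i<j. x i)))"
  have G: "lipschitz_coords k G" unfolding G_def by (rule lipschitz_coords_step_path(2)[OF F T])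
  define C where "C = grid T k"
  define X where "X = (\<lambda>n i \<omega>. (\<Sum>j\<in>{C n i..<C n (Suc i)}. increment Z j \<omega>) * (1 / sqrt (real n)))"
  have mono: "mono (C n)" for n unfolding C_def by (intro monoI grid_mono[OF T])
  have eq: "F (block_path T k n (history Z (nat \<lfloor>real n * T\<rfloor>) \<omega>)) = G (\<lambda>i. X n i \<omega>)" for n \<omega>
  proof -
    have "block_increment T k n (history Z (nat \<lfloor>real n * T\<rfloor>) \<omega>) i = X n i \<omega>" if i: "i < k" for i
    proof -
      have le: "C n i \<le> C n (Suc i)" "C n (Suc i) \<le> nat \<lfloor>real n * T\<rfloor>"
        using i monoD[OF mono, of i "Suc i" n] monoD[OF mono, of "Suc i" k n] grid_last[OF k, of T n]
        by (auto simp: C_def)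
      have "(\<Sum>j\<in>{C n i..<C n (Suc i)}. increment Z j \<omega>) = coord_sum (Z (C n (Suc i)) \<omega>) - coord_sum (Z (C n i) \<omega>)"
        unfolding increment_def[OF Z] using sum_Suc_diff'[OF le(1), of "\<lambda>j. coord_sum (Z j \<omega>)"] .
      then show ?thesis
        using le unfolding block_increment_def X_def C_def[symmetric] by (simp add: nth_history[OF Z])
    qed
    then have "G (block_increment T k n (history Z (nat \<lfloor>real n * T\<rfloor>) \<omega>)) = G (\<lambda>i. X n i \<omega>)"
      by (rule lipschitz_coords_cong[OF G])
    then show ?thesis unfolding block_path_def G_def .
  qed
  have rv: "X n i \<in> borel_measurable M" for n i
    unfolding X_def by (intro borel_measurable_times borel_measurable_sum increment_measurable[OF Z]) auto
  have Brv: "brownian_increment B T k i \<in> borel_measurable N" for i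
    unfolding brownian_increment_def[OF B T, abs_def]
    by (intro borel_measurable_diff brownian_random_variable[OF B T]) (use T in auto)
  have "(\<lambda>n. \<integral>\<omega>. G (\<lambda>i. X n i \<omega>) \<partial>M) \<longlonglongrightarrow> (\<integral>\<omega>. G (\<lambda>i. brownian_increment B T k i \<omega>) \<partial>N)"
  proof (rule indep_weak_conv_integral[OF M.prob_space_axioms N.prob_space_axioms k _ _ _ G])
    show "M.indep_vars (\<lambda>_. borel) (X n) {..<k}" for n
      unfolding X_def by (rule increment_sums_indep[OF Z mono])
    show "N.indep_vars (\<lambda>_. borel) (brownian_increment B T k) {..<k}"
      by (rule brownian_increments_indep[OF B T k])
    show "\<bar>G x\<bar> \<le> c" for x unfolding G_def by (intro c step_path_cadlag[OF T])
    fix i assume "i < k"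
    show "weak_conv_m (\<lambda>n. distr M borel (X n i)) (distr N borel (brownian_increment B T k i))"
    proof (rule levy_continuity)
      show "real_distribution (distr M borel (X n i))" for n by (rule M.real_distribution_distr[OF rv])
      show "real_distribution (distr N borel (brownian_increment B T k i))" by (rule N.real_distribution_distr[OF Brv])
      fix \<xi> :: real
      have "(\<lambda>n. real (C n (Suc i) - C n i) / n) \<longlonglongrightarrow> real (Suc i) * T / k - real i * T / k"
      proof -
        have "(\<lambda>n. real (C n (Suc i)) / n - real (C n i) / n) \<longlonglongrightarrow> real (Suc i) * T / k - real i * T / k"
          unfolding C_def grid_def using T by (intro tendsto_diff floor_multiple_limit) auto
        moreover have "real (C n (Suc i)) / n - real (C n i) / n = real (C n (Suc i) - C n i) / n" for n
          using monoD[OF mono, of i "Suc i" n] by (simp add: of_nat_diff diff_divide_distrib)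
        ultimately show ?thesis by simp
      qed
      also have "real (Suc i) * T / k - real i * T / k = T / k" by (simp add: add_divide_distrib algebra_simps)
      finally have "(\<lambda>n. cos (\<xi> / sqrt n) ^ (C n (Suc i) - C n i)) \<longlonglongrightarrow> exp (- (T / k * \<xi>\<^sup>2) / 2)"
        by (rule cos_power_tendsto)
      then have "(\<lambda>n. complex_of_real (cos (\<xi> / sqrt n) ^ (C n (Suc i) - C n i))) \<longlonglongrightarrow> complex_of_real (exp (- (T / k * \<xi>\<^sup>2) / 2))"
        by (rule tendsto_of_real)
      moreover have "char (distr M borel (X n i)) \<xi> = complex_of_real (cos (\<xi> / sqrt n) ^ (C n (Suc i) - C n i))" for n
        unfolding X_def by (subst increment_sum_char[OF Z]) auto
      ultimately show "(\<lambda>n. char (distr M borel (X n i)) \<xi>) \<longlonglongrightarrow> char (distr N borel (brownian_increment B T k i)) \<xi>"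
        by (simp add: brownian_increment_char[OF B T k])
    qed
  qed
  then show ?thesis unfolding eq by (simp add: G_def)
qed

text \<open>The order of choices is \<open>e\<close>, \<open>k\<close>, \<open>n\<close>:
  \<open>e\<close> makes the Lipschitz error at most r / 8, \<open>k\<close> makes the
  discretisation of \<open>B\<close> and the residual block oscillation small, and \<open>n\<close>
  the rest. Three errors below r / 4 add up.\<close>

lemma scaled_path_integral_limit:
  assumes Z: "balanced_excited_random_walk M Z" and B: "standard_brownian_motion N B" and T: "T > 0"
    and F: "skorokhod_lipschitz T L F" and c: "\<And>f. f \<in> cadlag T \<Longrightarrow> \<bar>F f\<bar> \<le> c"
  shows "(\<lambda>n. \<integral>\<omega>. F (scaled_path T n (history Z (nat \<lfloor>real n * T\<rfloor>) \<omega>)) \<partial>M)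
    \<longlonglongrightarrow> (\<integral>\<omega>. F (\<lambda>t\<in>{0..T}. (B t \<omega>, 0)) \<partial>N)"
proof -
  define a where "a = (\<lambda>n. \<integral>\<omega>. F (scaled_path T n (history Z (nat \<lfloor>real n * T\<rfloor>) \<omega>)) \<partial>M)"
  define a' where "a' = (\<lambda>k n. \<integral>\<omega>. F (block_path T k n (history Z (nat \<lfloor>real n * T\<rfloor>) \<omega>)) \<partial>M)"
  define b where "b = (\<integral>\<omega>. F (\<lambda>t\<in>{0..T}. (B t \<omega>, 0)) \<partial>N)"
  define b' where "b' = (\<lambda>k. \<integral>\<omega>. F (step_path T k (\<lambda>j. \<Sum>i<j. brownian_increment B T k i \<omega>)) \<partial>N)"
  have near: "\<bar>a n - a' k n\<bar> \<le> approx_error T L c e k n" if "k > 0" "n > 0" "e > 0" for k n e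
  proof -
    define m where "m = nat \<lfloor>real n * T\<rfloor>"
    have "a n - a' k n = coin m (\<lambda>w. F (scaled_path T n (walk_path w)) - F (block_path T k n (walk_path w)))"
      unfolding a_def a'_def m_def[symmetric] coin_diff
        expectation_history[OF Z, of "\<lambda>zs. F (scaled_path T n zs)"]
        expectation_history[OF Z, of "\<lambda>zs. F (block_path T k n zs)"] ..
    also have "\<bar>\<dots>\<bar> \<le> coin m (\<lambda>w. \<bar>F (scaled_path T n (walk_path w)) - F (block_path T k n (walk_path w))\<bar>)"
      by (rule coin_abs)
    also have "\<dots> \<le> approx_error T L c e k n"
      unfolding m_def using coin_approx[OF F c T that] by simp
    finally show ?thesis .
  qed
  have L: "0 \<le> L" using F by (simp add: skorokhod_lipschitz_def)
  have "a \<longlonglongrightarrow> b"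
  proof (rule LIMSEQ_I)
    fix r :: real assume r: "0 < r"
    define e where "e = r / (8 * (L + 1))"
    have e: "e > 0" "L * e \<le> r / 8" using r L by (auto simp: e_def field_simps)
    have "(b' \<circ> Suc) \<longlonglongrightarrow> b"
      unfolding b_def b'_def comp_def by (rule brownian_step_integral[OF B T F c])
    then have "eventually (\<lambda>k. \<bar>(b' \<circ> Suc) k - b\<bar> < r / 4) sequentially"
      using tendstoD[of "b' \<circ> Suc" b sequentially "r / 4"] r unfolding dist_real_def by simp
    moreover have "(\<lambda>k. 96 * c * T\<^sup>2 / (e ^ 4) * (1 / real (Suc k))) \<longlonglongrightarrow> 96 * c * T\<^sup>2 / (e ^ 4) * 0"
      by (intro tendsto_mult tendsto_const LIMSEQ_Suc[OF lim_1_over_n])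
    then have "eventually (\<lambda>k. 96 * c * T\<^sup>2 / (e ^ 4) * (1 / real (Suc k)) < r / 8) sequentially"
      using r by (intro order_tendstoD) auto
    ultimately have "eventually (\<lambda>k. \<bar>(b' \<circ> Suc) k - b\<bar> < r / 4 \<and> 96 * c * T\<^sup>2 / (e ^ 4) * (1 / real (Suc k)) < r / 8) sequentially"
      by (rule eventually_conj)
    then obtain k0 where "\<bar>(b' \<circ> Suc) k0 - b\<bar> < r / 4" "96 * c * T\<^sup>2 / (e ^ 4) * (1 / real (Suc k0)) < r / 8"
      by (auto simp: eventually_sequentially)
    then obtain k where k: "k > 0" "\<bar>b' k - b\<bar> < r / 4" "96 * c * T\<^sup>2 / (e ^ 4 * k) < r / 8"
      by (intro that[of "Suc k0"]) auto
    have "eventually (\<lambda>n. approx_error T L c e k n < r / 4) sequentially"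
      by (rule order_tendstoD[OF approx_error_limit[OF T k(1) e(1)]]) (use k(3) e(2) in linarith)
    moreover have "a' k \<longlonglongrightarrow> b' k"
      unfolding a'_def b'_def by (rule block_path_integral_limit[OF Z B T k(1) F]) (rule c)
    then have "eventually (\<lambda>n. \<bar>a' k n - b' k\<bar> < r / 4) sequentially"
      using tendstoD[of "a' k" "b' k" sequentially "r / 4"] r unfolding dist_real_def by simp
    ultimately have "eventually (\<lambda>n. norm (a n - b) < r) sequentially"
      using eventually_gt_at_top[of 0]
    proof eventually_elim
      case (elim n)
      then show ?case using near[OF k(1) elim(3) e(1)] k(2) r unfolding real_norm_def by linarith
    qed
    then show "\<exists>n0. \<forall>n\<ge>n0. norm (a n - b) < r" by (simp add: eventually_sequentially)
  qed
  then show ?thesis unfolding a_def b_def .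
qed

theorem corollary1p6:
  fixes M :: "'a measure" and Z :: "nat \<Rightarrow> 'a \<Rightarrow> int \<times> int"
    and N :: "'b measure" and B :: "real \<Rightarrow> 'b \<Rightarrow> real"
    and T :: real
  assumes "balanced_excited_random_walk M Z"
    and "standard_brownian_motion N B"
    and "T > 0"
  shows "converges_weakly (skorokhod_topology T :: (real \<Rightarrow> real \<times> real) topology)
    M (\<lambda>n \<omega>. \<lambda>t\<in>{0..T}. (1 / sqrt (real n)) *\<^sub>R
           map_prod real_of_int real_of_int (Z (nat \<lfloor>real n * t\<rfloor>) \<omega>))
    N (\<lambda>\<omega>. \<lambda>t\<in>{0..T}. (B t \<omega>, 0))"
proof -
  note Z = assms(1) and B = assms(2) and T = assms(3)
  define X where "X = (\<lambda>n \<omega>. scaled_path T n (history Z (nat \<lfloor>real n * T\<rfloor>) \<omega>))"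
  \<comment> \<open>On [0, T] the path uses positions up to the integer part of n T, so it is a
    function of the history.\<close>
  have X: "(\<lambda>n \<omega>. \<lambda>t\<in>{0..T}. (1 / sqrt (real n)) *\<^sub>R
      map_prod real_of_int real_of_int (Z (nat \<lfloor>real n * t\<rfloor>) \<omega>)) = X"
  proof (intro ext)
    fix n \<omega> t
    have "nat \<lfloor>real n * t\<rfloor> \<le> nat \<lfloor>real n * T\<rfloor>" if "t \<le> T"
      using that by (intro nat_mono floor_mono mult_left_mono) auto
    then show "(\<lambda>t\<in>{0..T}. (1 / sqrt (real n)) *\<^sub>R
        map_prod real_of_int real_of_int (Z (nat \<lfloor>real n * t\<rfloor>) \<omega>)) t = X n \<omega> t"
      by (simp add: X_def scaled_path_def restrict_def nth_history[OF Z])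
  qed
  \<comment> \<open>The measurability condition of \<open>converges_weaklyI\<close> gives no sign
    for \<open>L\<close>, whereas \<open>skorokhod_lipschitz\<close> requires a nonnegative
    constant.\<close>
  have lip: "skorokhod_lipschitz T (max 0 L) f"
    if "\<And>x y. x \<in> cadlag T \<Longrightarrow> y \<in> cadlag T \<Longrightarrow> \<bar>f x - f y\<bar> \<le> L * skorokhod_dist T x y" for f L
    unfolding skorokhod_lipschitz_def
  proof (intro conjI ballI)
    fix x y :: "real \<Rightarrow> real \<times> real" assume xy: "x \<in> cadlag T" "y \<in> cadlag T"
    have "\<bar>f x - f y\<bar> \<le> L * skorokhod_dist T x y" by (rule that[OF xy])
    also have "\<dots> \<le> max 0 L * skorokhod_dist T x y"
      by (intro mult_right_mono skorokhod_dist_nonneg) simp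
    finally show "\<bar>f x - f y\<bar> \<le> max 0 L * skorokhod_dist T x y" .
  qed simp
  show ?thesis
    unfolding X skorokhod_topology_def
  proof (rule Metric_space.converges_weaklyI[OF Metric_space_skorokhod])
    show "prob_space M" using Z unfolding balanced_excited_random_walk_def by (elim conjE)
    show "prob_space N" using B unfolding standard_brownian_motion_def by (elim conjE)
    show "X n \<in> space M \<rightarrow> cadlag T" for n by (simp add: X_def scaled_path_cadlag)
    show "(\<lambda>\<omega>. \<lambda>t\<in>{0..T}. (B t \<omega>, 0 :: real)) \<in> space N \<rightarrow> cadlag T"
    proof (rule funcsetI)
      fix \<omega> assume "\<omega> \<in> space N"
      then have "continuous_on {0..T} (\<lambda>t. B t \<omega>)" by (rule brownian_continuous[OF B T])
      then show "(\<lambda>t\<in>{0..T}. (B t \<omega>, 0 :: real)) \<in> cadlag T" by (rule continuous_path_cadlag)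
    qed
    show "(\<lambda>\<omega>. f (X n \<omega>) :: real) \<in> borel_measurable M" for n f
      unfolding X_def
      by (rule measurable_compose[OF history_measurable[OF Z], of "\<lambda>zs. f (scaled_path T n zs)"]) simp
    fix f :: "(real \<Rightarrow> real \<times> real) \<Rightarrow> real" and c L
    assume f: "\<And>x. x \<in> cadlag T \<Longrightarrow> \<bar>f x\<bar> \<le> c"
      "\<And>x y. x \<in> cadlag T \<Longrightarrow> y \<in> cadlag T \<Longrightarrow> \<bar>f x - f y\<bar> \<le> L * skorokhod_dist T x y"
    show "(\<lambda>\<omega>. f (\<lambda>t\<in>{0..T}. (B t \<omega>, 0))) \<in> borel_measurable N"
      by (rule brownian_functional_measurable[OF B T lip[OF f(2)]])
    show "(\<lambda>n. \<integral>\<omega>. f (X n \<omega>) \<partial>M) \<longlonglongrightarrow> (\<integral>\<omega>. f (\<lambda>t\<in>{0..T}. (B t \<omega>, 0)) \<partial>N)"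
      unfolding X_def by (rule scaled_path_integral_limit[OF Z B T lip[OF f(2)] f(1)])
  qed
qed

end
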